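(* Let $N=2$, $\alpha\in\mathbb R$ and $1<q<p<2$. There is a constant $C$, independent of $t$, such that for every $t>0$ and every $g\in L^2(\mathbb R^2)\cap L^q(\mathbb R^2)$, $$\|\nabla e^{\Delta_\alpha t}P_{ac}g\|_{L^p(\mathbb R^2)}\le C\,t^{-\frac12-\left(\frac1q-\frac1p\right)}\|P_{ac}g\|_{L^q(\mathbb R^2)}.$$
   Context: Point-interaction Laplacian in $\mathbb R^2$: for $\lambda>0$ let $G_\lambda(x)=\frac{1}{2\pi}K_0(\sqrt\lambda|x|)$ ($K_0$ modified Bessel function of the second kind of order zero), $c(\lambda)=\frac{\gamma_E-\ln2}{2\pi}+\frac{1}{2\pi}\ln\sqrt\lambda$ ($\gamma_E$ Euler–Mascheroni), $E_\alpha=4e^{-4\pi\alpha-2\gamma_E}$. $\Delta_\alpha$ is the self-adjoint operator on $L^2(\mathbb R^2)$ with domain $\{u=\phi_\lambda+\frac{\phi_\lambda(0)}{\alpha+c(\lambda)}G_\lambda:\phi_\lambda\in H^2\}$ and action $(\lambda-\Delta_\alpha)u=(\lambda-\Delta)\phi_\lambda$ ($\lambda>0$, $\lambda\ne E_\alpha$); spectrum $(-\infty,0]\cup\{E_\alpha\}$, simple eigenvalue $E_\alpha$ with normalized eigenfunction $\psi_\alpha=G_{E_\alpha}/\|G_{E_\alpha}\|_{L^2}$. $P_d\varphi=\langle\varphi,\psi_\alpha\rangle_{L^2}\psi_\alpha$, $P_{ac}=I-P_d$, extended to $L^p$, $1<p<\infty$. *)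

theory Defs
  imports "HOL-Analysis.Analysis"
begin

type_synonym R2 = "real^2"

text \<open>Modified Bessel function of the second kind of order zero,
  via its standard integral representation \<open>K_0(r) = \<integral>_0^\<infinity> exp(-r cosh s) ds\<close>, r > 0.\<close>
definition K0 :: "real \<Rightarrow> real" where
  "K0 r = (LBINT s:{0<..}. exp (- r * cosh s))"

definition Gk :: "real \<Rightarrow> R2 \<Rightarrow> real" where
  "Gk lam x = K0 (sqrt lam * norm x) / (2 * pi)"

definition cc :: "real \<Rightarrow> real" where
  "cc lam = (euler_mascheroni - ln 2) / (2 * pi) + ln (sqrt lam) / (2 * pi)"

definition Ealpha :: "real \<Rightarrow> real" where
  "Ealpha alpha = 4 * exp (- 4 * pi * alpha - 2 * euler_mascheroni)"

definition Lp_mem :: "real \<Rightarrow> (R2 \<Rightarrow> 'b::real_normed_vector) \<Rightarrow> bool" where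
  "Lp_mem p f \<longleftrightarrow> f \<in> borel_measurable lborel \<and>
     (\<integral>\<^sup>+ x. ennreal (norm (f x) powr p) \<partial>lborel) < \<infinity>"

definition Lp_norm :: "real \<Rightarrow> (R2 \<Rightarrow> 'b::real_normed_vector) \<Rightarrow> real" where
  "Lp_norm p f = enn2real (\<integral>\<^sup>+ x. ennreal (norm (f x) powr p) \<partial>lborel) powr (1 / p)"

text \<open>Resolvent \<open>(\<lambda> - \<Delta>_\<alpha>)^{-1}\<close> (Krein formula, equivalent to the definition of the
  domain and action of \<open>\<Delta>_\<alpha>\<close> in the context): for \<open>f\<close>,
  \<open>\<phi>_\<lambda> = (\<lambda>-\<Delta>)^{-1} f = G_\<lambda> * f\<close>, so \<open>\<phi>_\<lambda>(0) = \<integral> G_\<lambda>(y) f(y) dy\<close> and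
  \<open>(\<lambda>-\<Delta>_\<alpha>)^{-1} f = \<phi>_\<lambda> + \<phi>_\<lambda>(0)/(\<alpha>+c(\<lambda>)) G_\<lambda>\<close>.\<close>
definition resolv :: "real \<Rightarrow> real \<Rightarrow> (R2 \<Rightarrow> complex) \<Rightarrow> R2 \<Rightarrow> complex" where
  "resolv alpha lam f x =
     (\<integral> y. complex_of_real (Gk lam (x - y)) * f y \<partial>lborel)
     + ((\<integral> y. complex_of_real (Gk lam y) * f y \<partial>lborel) / complex_of_real (alpha + cc lam))
       * complex_of_real (Gk lam x)"

text \<open>The heat semigroup \<open>e^{t\<Delta>_\<alpha>}\<close> via the exponential (Euler/Post--Widder) formula
  \<open>e^{tA} g = lim_n (n/t \<cdot> (n/t - A)^{-1})^n g\<close> in \<open>L^2\<close>.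
  \<open>heat_sg alpha t g u\<close> says that \<open>u\<close> is (a representative of) \<open>e^{t\<Delta>_\<alpha>} g\<close>.\<close>
definition heat_sg :: "real \<Rightarrow> real \<Rightarrow> (R2 \<Rightarrow> complex) \<Rightarrow> (R2 \<Rightarrow> complex) \<Rightarrow> bool" where
  "heat_sg alpha t g u \<longleftrightarrow> Lp_mem 2 u \<and>
     ((\<lambda>n::nat. Lp_norm 2 (\<lambda>x.
         (((\<lambda>f y. complex_of_real (real n / t) * resolv alpha (real n / t) f y) ^^ n) g) x - u x))
      \<longlonglongrightarrow> 0)"

definition psi :: "real \<Rightarrow> R2 \<Rightarrow> real" where
  "psi alpha x = Gk (Ealpha alpha) x / Lp_norm 2 (Gk (Ealpha alpha))"

definition Pd :: "real \<Rightarrow> (R2 \<Rightarrow> complex) \<Rightarrow> R2 \<Rightarrow> complex" where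
  "Pd alpha phi x =
     (\<integral> y. phi y * complex_of_real (psi alpha y) \<partial>lborel) * complex_of_real (psi alpha x)"

definition Pac :: "real \<Rightarrow> (R2 \<Rightarrow> complex) \<Rightarrow> R2 \<Rightarrow> complex" where
  "Pac alpha phi x = phi x - Pd alpha phi x"

definition partial :: "2 \<Rightarrow> (R2 \<Rightarrow> real) \<Rightarrow> R2 \<Rightarrow> real" where
  "partial j f x = frechet_derivative f (at x) (axis j 1)"

fun iter_partial :: "2 list \<Rightarrow> (R2 \<Rightarrow> real) \<Rightarrow> R2 \<Rightarrow> real" where
  "iter_partial [] f = f"
| "iter_partial (j # js) f = partial j (iter_partial js f)"

definition test_fun :: "(R2 \<Rightarrow> real) \<Rightarrow> bool" where
  "test_fun phi \<longleftrightarrow> (\<forall>js. iter_partial js phi differentiable_on UNIV) \<and> bounded {x. phi x \<noteq> 0}"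

definition weak_grad :: "(R2 \<Rightarrow> complex) \<Rightarrow> (R2 \<Rightarrow> complex^2) \<Rightarrow> bool" where
  "weak_grad u h \<longleftrightarrow> (\<forall>j. (\<lambda>x. h x $ j) \<in> borel_measurable lborel) \<and>
     (\<forall>phi. test_fun phi \<longrightarrow> (\<forall>j::2.
        (\<integral> x. u x * complex_of_real (partial j phi x) \<partial>lborel)
        = - (\<integral> x. h x $ j * complex_of_real (phi x) \<partial>lborel)))"

end

theory Submission
  imports Defs "HOL-Probability.Probability"
begin

text \<open>
  Write \<open>E = Ealpha alpha\<close>. Krein's formula contains the factor \<open>1 / (alpha + cc l) = 4 pi / ln (l / E)\<close>, and
  \<open>4 pi / ln (l / E) = 4 pi E / (l - E) + laplace k l\<close>, where the memory kernel
  \<open>k t = 4 pi \<integral> exp (- t s) / (pi\<^sup>2 + (ln (s / E))\<^sup>2) ds\<close> over \<open>s > 0\<close> is positive, integrable and \<open>O (1 / t)\<close>.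
  On functions \<open>f\<close> orthogonal to the eigenfunction \<open>Gk E\<close> the pole at \<open>l = E\<close> disappears, and the semigroup is
  \<open>u t x = (heat_kernel t * f) x + \<integral> heat_kernel (t - r) x m r dr\<close> over \<open>0 < r < t\<close>, where, with
  \<open>a s = (heat_kernel s * f) 0\<close>, the charge is \<open>m s = (k * a) s - 4 pi E \<integral> exp (- E r) a (s + r) dr\<close> over \<open>r > 0\<close>.
  Hence \<open>m s\<close>, like \<open>a s\<close>, is bounded by \<open>C s powr (- 1 / q)\<close> times the \<open>L\<^sup>q\<close> norm of \<open>f\<close>, with \<open>C\<close> independent
  of \<open>s\<close>, and the gradient estimate follows from Gaussian bounds and Minkowski's integral inequality; \<open>p < 2\<close> makes
  the \<open>L\<^sup>p\<close> norm of the gradient of \<open>heat_kernel\<close> integrable in time near 0.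
  That \<open>u t\<close> is the Post--Widder limit follows from the resolvent identity, which turns powers of the resolvent
  into averages of \<open>u\<close> against Erlang densities concentrating at \<open>t\<close>.
\<close>

section \<open>Integration on Euclidean spaces\<close>

lemma lborel_Fubini:
  fixes f :: "'a::euclidean_space \<Rightarrow> 'b::euclidean_space \<Rightarrow> 'c::{banach, second_countable_topology}"
  assumes [measurable]: "case_prod f \<in> borel_measurable (lborel \<Otimes>\<^sub>M lborel)"
    and fin: "(\<integral>\<^sup>+ x. \<integral>\<^sup>+ y. ennreal (norm (f x y)) \<partial>lborel \<partial>lborel) < \<infinity>"
  shows "(\<integral>x. \<integral>y. f x y \<partial>lborel \<partial>lborel) = (\<integral>y. \<integral>x. f x y \<partial>lborel \<partial>lborel)"
    and "integrable lborel (\<lambda>x. \<integral>y. f x y \<partial>lborel)"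
    and "integrable lborel (\<lambda>y. \<integral>x. f x y \<partial>lborel)"
    and "AE x in lborel. integrable lborel (f x)"
proof -
  have int: "integrable (lborel \<Otimes>\<^sub>M lborel) (case_prod f)"
  proof (rule integrableI_bounded)
    show "(\<integral>\<^sup>+ z. ennreal (norm (case z of (x, y) \<Rightarrow> f x y)) \<partial>(lborel \<Otimes>\<^sub>M lborel)) < \<infinity>"
      using fin by (subst lborel.nn_integral_fst[symmetric]) auto
  qed simp
  show "(\<integral>x. \<integral>y. f x y \<partial>lborel \<partial>lborel) = (\<integral>y. \<integral>x. f x y \<partial>lborel \<partial>lborel)"
    using lborel_pair.Fubini_integral[OF int] by simp
  show "integrable lborel (\<lambda>x. \<integral>y. f x y \<partial>lborel)"
    using lborel_pair.integrable_fst[OF int] by simp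
  show "integrable lborel (\<lambda>y. \<integral>x. f x y \<partial>lborel)"
    using lborel_pair.integrable_snd[OF int] by simp
  show "AE x in lborel. integrable lborel (f x)"
    using lborel_pair.AE_integrable_fst[OF int] by simp
qed

lemma lborel_Tonelli:
  fixes f :: "'a::euclidean_space \<Rightarrow> 'b::euclidean_space \<Rightarrow> ennreal"
  assumes "case_prod f \<in> borel_measurable (lborel \<Otimes>\<^sub>M lborel)"
  shows "(\<integral>\<^sup>+ x. \<integral>\<^sup>+ y. f x y \<partial>lborel \<partial>lborel) = (\<integral>\<^sup>+ y. \<integral>\<^sup>+ x. f x y \<partial>lborel \<partial>lborel)"
  using lborel_pair.Fubini'[OF assms] by simp

lemma lborel_distr_reflect: "distr lborel borel (\<lambda>x. t - x) = (lborel :: 'a::euclidean_space measure)"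
  using lborel_affine[of "-1" t] by (simp add: density_1)

lemma nn_integral_mult_nn_integral:
  fixes F :: "'z::euclidean_space \<Rightarrow> 'a::euclidean_space \<Rightarrow> ennreal" and G :: "'w::euclidean_space \<Rightarrow> 'a \<Rightarrow> ennreal"
  assumes [measurable]: "case_prod F \<in> borel_measurable (lborel \<Otimes>\<^sub>M lborel)"
    "case_prod G \<in> borel_measurable (lborel \<Otimes>\<^sub>M lborel)"
  shows "(\<integral>\<^sup>+ y. (\<integral>\<^sup>+ s. F s y \<partial>lborel) * (\<integral>\<^sup>+ r. G r y \<partial>lborel) \<partial>lborel)
     = (\<integral>\<^sup>+ s. \<integral>\<^sup>+ r. \<integral>\<^sup>+ y. F s y * G r y \<partial>lborel \<partial>lborel \<partial>lborel)"
proof -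
  have "(\<integral>\<^sup>+ y. (\<integral>\<^sup>+ s. F s y \<partial>lborel) * (\<integral>\<^sup>+ r. G r y \<partial>lborel) \<partial>lborel)
     = (\<integral>\<^sup>+ y. \<integral>\<^sup>+ s. \<integral>\<^sup>+ r. F s y * G r y \<partial>lborel \<partial>lborel \<partial>lborel)"
    by (simp add: nn_integral_cmult nn_integral_multc)
  also have "\<dots> = (\<integral>\<^sup>+ s. \<integral>\<^sup>+ y. \<integral>\<^sup>+ r. F s y * G r y \<partial>lborel \<partial>lborel \<partial>lborel)"
    by (rule lborel_Tonelli) measurable
  also have "\<dots> = (\<integral>\<^sup>+ s. \<integral>\<^sup>+ r. \<integral>\<^sup>+ y. F s y * G r y \<partial>lborel \<partial>lborel \<partial>lborel)"
    by (intro nn_integral_cong lborel_Tonelli) measurable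
  finally show ?thesis .
qed

lemma nn_integral_lborel_shift:
  fixes f :: "'a::euclidean_space \<Rightarrow> ennreal"
  assumes "f \<in> borel_measurable borel"
  shows "(\<integral>\<^sup>+ x. f (t + x) \<partial>lborel) = (\<integral>\<^sup>+ x. f x \<partial>lborel)"
  using assms by (subst (2) lborel_distr_plus[of t, symmetric]) (simp add: nn_integral_distr)

lemma nn_integral_lborel_reflect:
  fixes f :: "'a::euclidean_space \<Rightarrow> ennreal"
  assumes "f \<in> borel_measurable borel"
  shows "(\<integral>\<^sup>+ x. f (t - x) \<partial>lborel) = (\<integral>\<^sup>+ x. f x \<partial>lborel)"
  using assms by (subst (2) lborel_distr_reflect[of t, symmetric]) (simp add: nn_integral_distr)

lemma integral_lborel_shift:
  fixes f :: "'a::euclidean_space \<Rightarrow> 'b::{banach, second_countable_topology}"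
  assumes "f \<in> borel_measurable borel"
  shows "(\<integral>x. f (t + x) \<partial>lborel) = (\<integral>x. f x \<partial>lborel)"
  using assms by (subst (2) lborel_distr_plus[of t, symmetric]) (simp add: integral_distr)

lemma integral_lborel_reflect:
  fixes f :: "'a::euclidean_space \<Rightarrow> 'b::{banach, second_countable_topology}"
  assumes "f \<in> borel_measurable borel"
  shows "(\<integral>x. f (t - x) \<partial>lborel) = (\<integral>x. f x \<partial>lborel)"
  using assms by (subst (2) lborel_distr_reflect[of t, symmetric]) (simp add: integral_distr)

lemma norm_integral_le_nn_integral:
  fixes f :: "'a \<Rightarrow> 'b::{banach, second_countable_topology}"
  shows "ennreal (norm (integral\<^sup>L M f)) \<le> (\<integral>\<^sup>+ x. ennreal (norm (f x)) \<partial>M)"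
  by (cases "integrable M f") (auto simp: not_integrable_integral_eq intro: integral_norm_bound_ennreal)

lemma norm_integral_le:
  fixes f :: "'a \<Rightarrow> 'b::{banach, second_countable_topology}" and g :: "'a \<Rightarrow> real"
  assumes g: "integrable M g" and le: "\<And>x. norm (f x) \<le> g x"
  shows "norm (integral\<^sup>L M f) \<le> integral\<^sup>L M g"
proof -
  have "ennreal (norm (integral\<^sup>L M f)) \<le> (\<integral>\<^sup>+ x. ennreal (g x) \<partial>M)"
    using le by (intro order_trans[OF norm_integral_le_nn_integral] nn_integral_mono ennreal_leI)
  also have "\<dots> = ennreal (integral\<^sup>L M g)"
    using order_trans[OF norm_ge_zero le] by (intro nn_integral_eq_integral g) auto
  finally show ?thesis
    using order_trans[OF norm_ge_zero le] by (simp add: integral_nonneg_AE)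
qed

lemma integral_dominated_convergence_at:
  fixes f :: "'t::first_countable_topology \<Rightarrow> 'a \<Rightarrow> 'b::{banach, second_countable_topology}"
  assumes meas: "\<And>s. f s \<in> borel_measurable M" "g \<in> borel_measurable M" and w: "integrable M w"
    and lim: "AE x in M. ((\<lambda>s. f s x) \<longlongrightarrow> g x) (at t)"
    and bound: "\<forall>\<^sub>F s in at t. AE x in M. norm (f s x) \<le> w x"
  shows "((\<lambda>s. \<integral>x. f s x \<partial>M) \<longlongrightarrow> (\<integral>x. g x \<partial>M)) (at t)"
  unfolding tendsto_at_iff_sequentially comp_def
proof (intro allI impI)
  fix X :: "nat \<Rightarrow> 't" assume "\<forall>i. X i \<in> UNIV - {t}" "X \<longlonglongrightarrow> t"
  then have X: "filterlim X (at t) sequentially" by (auto simp: filterlim_at)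
  obtain N where N: "\<And>n. N \<le> n \<Longrightarrow> AE x in M. norm (f (X n) x) \<le> w x"
    using eventually_compose_filterlim[OF bound X] unfolding eventually_sequentially by blast
  have "(\<lambda>n. \<integral>x. f (X (n + N)) x \<partial>M) \<longlonglongrightarrow> (\<integral>x. g x \<partial>M)"
  proof (rule integral_dominated_convergence[OF _ _ w])
    show "AE x in M. (\<lambda>n. f (X (n + N)) x) \<longlonglongrightarrow> g x"
      using lim
    proof eventually_elim
      case (elim x)
      show ?case by (rule LIMSEQ_ignore_initial_segment) (rule filterlim_compose[OF elim X])
    qed
  qed (use meas N in auto)
  then show "(\<lambda>n. \<integral>x. f (X n) x \<partial>M) \<longlonglongrightarrow> (\<integral>x. g x \<partial>M)" by (rule LIMSEQ_offset)
qed

lemma isCont_integral_dominated: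
  fixes f :: "'t::{first_countable_topology, t2_space} \<Rightarrow> 'a \<Rightarrow> 'b::{banach, second_countable_topology}"
  assumes "\<And>s. f s \<in> borel_measurable M" "integrable M w"
    and "AE x in M. isCont (\<lambda>s. f s x) t"
    and "\<forall>\<^sub>F s in at t. AE x in M. norm (f s x) \<le> w x"
  shows "isCont (\<lambda>s. \<integral>x. f s x \<partial>M) t"
  using assms unfolding isCont_def by (intro integral_dominated_convergence_at)

lemma has_vector_derivative_iff_tendsto:
  fixes f :: "real \<Rightarrow> 'b::real_normed_vector"
  shows "(f has_vector_derivative D) (at t) \<longleftrightarrow> ((\<lambda>s. (f s - f t) /\<^sub>R (s - t)) \<longlongrightarrow> D) (at t)"
proof -
  have "norm (f s - f t - (s - t) *\<^sub>R D) / norm (s - t) = norm ((f s - f t) /\<^sub>R (s - t) - D)" if "s \<noteq> t" for s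
  proof -
    have "f s - f t - (s - t) *\<^sub>R D = (s - t) *\<^sub>R ((f s - f t) /\<^sub>R (s - t) - D)"
      using that by (simp add: scaleR_diff_right)
    then show ?thesis using that by simp
  qed
  then have "((\<lambda>s. norm (f s - f t - (s - t) *\<^sub>R D) / norm (s - t)) \<longlongrightarrow> 0) (at t)
     \<longleftrightarrow> ((\<lambda>s. norm ((f s - f t) /\<^sub>R (s - t) - D)) \<longlongrightarrow> 0) (at t)"
    by (intro tendsto_cong) (auto simp: eventually_at_filter)
  also have "\<dots> \<longleftrightarrow> ((\<lambda>s. (f s - f t) /\<^sub>R (s - t)) \<longlongrightarrow> D) (at t)"
    by (simp only: tendsto_norm_zero_iff LIM_zero_iff)
  finally show ?thesis
    by (simp add: has_vector_derivative_def has_derivative_iff_norm bounded_linear_scaleR_left)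
qed

lemma has_vector_derivative_integral_dominated:
  fixes f :: "real \<Rightarrow> 'a \<Rightarrow> 'b::{banach, second_countable_topology}"
  assumes e: "0 < e" and f: "\<And>s. \<bar>s - t\<bar> < e \<Longrightarrow> integrable M (f s)"
    and deriv: "\<And>s x. \<bar>s - t\<bar> < e \<Longrightarrow> ((\<lambda>s. f s x) has_vector_derivative f' s x) (at s)"
    and w: "integrable M w" and bound: "\<And>s x. \<bar>s - t\<bar> < e \<Longrightarrow> norm (f' s x) \<le> w x"
    and meas: "f' t \<in> borel_measurable M"
  shows "((\<lambda>s. \<integral>x. f s x \<partial>M) has_vector_derivative (\<integral>x. f' t x \<partial>M)) (at t)"
  unfolding has_vector_derivative_iff_tendsto
proof (rule Lim_transform_eventually)
  define q where "q s x = (if \<bar>s - t\<bar> < e then (f s x - f t x) /\<^sub>R (s - t) else 0)" for s x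
  have near: "\<forall>\<^sub>F s in at t. \<bar>s - t\<bar> < e"
    using e unfolding eventually_at by (auto simp: dist_real_def)
  have q_le: "norm (q s x) \<le> w x" if "s \<noteq> t" for s x
  proof (cases "\<bar>s - t\<bar> < e")
    case True
    have "norm (f s x - f t x) \<le> w x * norm (s - t)"
    proof (rule differentiable_bound[of "ball t e" _ "\<lambda>r h. h *\<^sub>R f' r x"])
      show "((\<lambda>s. f s x) has_derivative (\<lambda>h. h *\<^sub>R f' r x)) (at r within ball t e)" if "r \<in> ball t e" for r
        using deriv[of r x] that
        by (auto simp: dist_real_def has_vector_derivative_def abs_minus_commute intro: has_derivative_at_withinI)
      show "onorm (\<lambda>h. h *\<^sub>R f' r x) \<le> w x" if "r \<in> ball t e" for r
        using bound[of r x] that by (intro onorm_le)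
          (auto simp: dist_real_def abs_minus_commute mult.commute mult_left_mono)
    qed (use e True in \<open>auto simp: dist_real_def abs_minus_commute\<close>)
    moreover have "norm (q s x) = norm (f s x - f t x) / \<bar>s - t\<bar>"
      using True by (simp add: q_def divide_inverse_commute)
    ultimately show ?thesis using that by (simp add: pos_divide_le_eq)
  next
    case False
    then show ?thesis using order_trans[OF norm_ge_zero bound[of t x]] e by (simp add: q_def)
  qed
  show "((\<lambda>s. \<integral>x. q s x \<partial>M) \<longlongrightarrow> (\<integral>x. f' t x \<partial>M)) (at t)"
  proof (rule integral_dominated_convergence_at[OF _ meas w])
    show "q s \<in> borel_measurable M" for s
      using f[of s] f[of t] e by (cases "\<bar>s - t\<bar> < e") (auto simp: q_def[abs_def])
    show "AE x in M. ((\<lambda>s. q s x) \<longlongrightarrow> f' t x) (at t)"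
    proof (rule AE_I2)
      fix x
      have "((\<lambda>s. (f s x - f t x) /\<^sub>R (s - t)) \<longlongrightarrow> f' t x) (at t)"
        using deriv[of t x] e by (simp add: has_vector_derivative_iff_tendsto)
      then show "((\<lambda>s. q s x) \<longlongrightarrow> f' t x) (at t)"
        by (rule Lim_transform_eventually) (use near in \<open>auto simp: q_def elim: eventually_mono\<close>)
    qed
    show "\<forall>\<^sub>F s in at t. AE x in M. norm (q s x) \<le> w x"
      using eventually_neq_at_within[of t t UNIV] by eventually_elim (auto intro: q_le)
  qed
  show "\<forall>\<^sub>F s in at t. (\<integral>x. q s x \<partial>M) = ((\<integral>x. f s x \<partial>M) - (\<integral>x. f t x \<partial>M)) /\<^sub>R (s - t)"
    using near by eventually_elim (use f e in \<open>simp add: q_def\<close>)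
qed

lemma nn_integral_Holder:
  fixes f g :: "'a \<Rightarrow> real"
  assumes [measurable]: "f \<in> borel_measurable M" "g \<in> borel_measurable M"
    and nonneg: "\<And>x. 0 \<le> f x" "\<And>x. 0 \<le> g x" and pq: "1 < p" "1 < q" "1 / p + 1 / q = 1"
    and A: "0 \<le> A" "(\<integral>\<^sup>+ x. ennreal (f x powr p) \<partial>M) \<le> ennreal (A powr p)"
    and B: "0 \<le> B" "(\<integral>\<^sup>+ x. ennreal (g x powr q) \<partial>M) \<le> ennreal (B powr q)"
  shows "(\<integral>\<^sup>+ x. ennreal (f x * g x) \<partial>M) \<le> ennreal (A * B)"
proof -
  have "(\<integral>\<^sup>+ x. ennreal (f x * g x) \<partial>M) \<le> ennreal (a * b)" if ab: "A < a" "B < b" for a b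
  proof -
    have pos: "0 < a" "0 < b" using ab A B by auto
    have young: "f x * g x \<le> a * b / (p * a powr p) * f x powr p + a * b / (q * b powr q) * g x powr q" for x
    proof -
      have "f x / a * (g x / b) \<le> (f x / a) powr p / p + (g x / b) powr q / q"
        using pos pq nonneg by (intro Youngs_inequality) auto
      then have "a * b * (f x / a * (g x / b)) \<le> a * b * ((f x / a) powr p / p + (g x / b) powr q / q)"
        using pos by (intro mult_left_mono) auto
      then show ?thesis
        using pos nonneg by (simp add: powr_divide distrib_left mult_ac)
    qed
    have "(\<integral>\<^sup>+ x. ennreal (f x * g x) \<partial>M)
       \<le> (\<integral>\<^sup>+ x. ennreal (a * b / (p * a powr p)) * ennreal (f x powr p) +
         ennreal (a * b / (q * b powr q)) * ennreal (g x powr q) \<partial>M)"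
      using young pos pq
      by (intro nn_integral_mono)
        (simp add: ennreal_mult'[symmetric] ennreal_plus[symmetric] ennreal_leI del: ennreal_plus)
    also have "\<dots> = ennreal (a * b / (p * a powr p)) * (\<integral>\<^sup>+ x. ennreal (f x powr p) \<partial>M)
        + ennreal (a * b / (q * b powr q)) * (\<integral>\<^sup>+ x. ennreal (g x powr q) \<partial>M)"
      by (simp add: nn_integral_add nn_integral_cmult)
    also have "\<dots> \<le> ennreal (a * b / (p * a powr p)) * ennreal (a powr p)
         + ennreal (a * b / (q * b powr q)) * ennreal (b powr q)"
      using A B ab pq by (intro add_mono mult_left_mono order_trans[OF A(2)]
        order_trans[OF B(2)] ennreal_leI powr_mono2) auto
    also have "\<dots> = ennreal (a * b * (1 / p + 1 / q))"
      using pos pq(1,2) by (simp add: ennreal_mult'[symmetric] ennreal_plus[symmetric] distrib_left del: ennreal_plus)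
    finally show ?thesis unfolding pq(3) by simp
  qed
  then have "\<forall>\<^sub>F e in at_right 0. (\<integral>\<^sup>+ x. ennreal (f x * g x) \<partial>M) \<le> ennreal ((A + e) * (B + e))"
    by (intro eventually_at_rightI[of 0 1]) auto
  moreover have "((\<lambda>e. ennreal ((A + e) * (B + e))) \<longlongrightarrow> ennreal ((A + 0) * (B + 0))) (at_right 0)"
    by (intro tendsto_intros)
  ultimately show ?thesis
    by (intro tendsto_lowerbound[of _ _ "at_right 0"]) auto
qed

lemma nn_integral_weighted_Holder:
  fixes w F :: "'a \<Rightarrow> real"
  assumes [measurable]: "w \<in> borel_measurable M" "F \<in> borel_measurable M"
    and nonneg: "\<And>x. 0 \<le> w x" "\<And>x. 0 \<le> F x" and p: "1 < p" and "0 \<le> W" "0 \<le> B"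
    and w: "(\<integral>\<^sup>+ x. ennreal (w x) \<partial>M) \<le> ennreal W"
    and F: "(\<integral>\<^sup>+ x. ennreal (w x * F x powr p) \<partial>M) \<le> ennreal B"
  shows "(\<integral>\<^sup>+ x. ennreal (w x * F x) \<partial>M) \<le> ennreal (W powr (1 - 1 / p) * B powr (1 / p))"
proof -
  define q where "q = p / (p - 1)"
  have q: "1 < q" "1 / q = 1 - 1 / p" "1 / q + 1 / p = 1" using p by (auto simp: q_def field_simps)
  have factor: "w x * F x = w x powr (1 / q) * (w x powr (1 / p) * F x)" for x
    using nonneg(1)[of x] by (simp add: q(3) mult.assoc[symmetric] powr_add[symmetric])
  have "(\<integral>\<^sup>+ x. ennreal (w x * F x) \<partial>M) \<le> ennreal (W powr (1 / q) * B powr (1 / p))"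
    unfolding factor
    by (rule nn_integral_Holder[OF _ _ _ _ q(1) p q(3)])
      (use assms q in \<open>simp_all add: powr_mult powr_powr\<close>)
  then show ?thesis unfolding q(2) .
qed

lemma integral_weighted_Holder_powr:
  fixes w F :: "'a \<Rightarrow> real" and g :: "'a \<Rightarrow> 'b::{banach, second_countable_topology}"
  assumes [measurable]: "w \<in> borel_measurable M" "F \<in> borel_measurable M"
    and nonneg: "\<And>x. 0 \<le> w x" "\<And>x. 0 \<le> F x" and p: "1 < p" and W: "0 < W"
    and w: "(\<integral>\<^sup>+ x. ennreal (w x) \<partial>M) \<le> ennreal W"
    and g: "\<And>x. norm (g x) \<le> w x * F x"
  shows "ennreal (norm (integral\<^sup>L M g) powr p)
     \<le> ennreal (W powr (p - 1)) * (\<integral>\<^sup>+ x. ennreal (w x * F x powr p) \<partial>M)"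
proof (cases "(\<integral>\<^sup>+ x. ennreal (w x * F x powr p) \<partial>M)")
  case (real B)
  have "ennreal (norm (integral\<^sup>L M g)) \<le> (\<integral>\<^sup>+ x. ennreal (w x * F x) \<partial>M)"
    by (intro order_trans[OF norm_integral_le_nn_integral] nn_integral_mono ennreal_leI g)
  also have "\<dots> \<le> ennreal (W powr (1 - 1 / p) * B powr (1 / p))"
    by (rule nn_integral_weighted_Holder) (use assms real in auto)
  finally have "norm (integral\<^sup>L M g) powr p \<le> (W powr (1 - 1 / p) * B powr (1 / p)) powr p"
    using p by (intro powr_mono2) (auto simp: ennreal_le_iff)
  also have "\<dots> = W powr (p - 1) * B"
    using p W \<open>0 \<le> B\<close> by (simp add: powr_mult powr_powr algebra_simps)
  finally show ?thesis using real W by (simp add: ennreal_mult'[symmetric] ennreal_leI)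
next
  case top
  then show ?thesis using W by (simp add: ennreal_mult_top)
qed

section \<open>Lebesgue spaces\<close>

lemma Lp_norm_nonneg [simp]: "0 \<le> Lp_norm p f"
  by (simp add: Lp_norm_def)

lemma Lp_mem_measurable [measurable_dest]: "Lp_mem p f \<Longrightarrow> f \<in> borel_measurable borel"
  by (simp add: Lp_mem_def)

lemma Lp_mem_measurable_compose [measurable_dest]:
  "Lp_mem p f \<Longrightarrow> g \<in> borel_measurable M \<Longrightarrow> (\<lambda>x. f (g x)) \<in> borel_measurable M"
  using measurable_compose[OF _ Lp_mem_measurable] by blast

lemma nn_integral_Lp_norm:
  assumes "Lp_mem p f" "0 < p"
  shows "(\<integral>\<^sup>+ x. ennreal (norm (f x) powr p) \<partial>lborel) = ennreal (Lp_norm p f powr p)"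
  using assms unfolding Lp_mem_def Lp_norm_def
  by (simp add: powr_powr top.not_eq_extremum)

lemma Lp_boundI:
  assumes "f \<in> borel_measurable borel" "0 \<le> B" "0 < p"
    and bound: "(\<integral>\<^sup>+ x. ennreal (norm (f x) powr p) \<partial>lborel) \<le> ennreal (B powr p)"
  shows "Lp_mem p f" "Lp_norm p f \<le> B"
proof -
  show "Lp_mem p f"
    using assms(1) le_less_trans[OF bound] by (simp add: Lp_mem_def)
  have "enn2real (\<integral>\<^sup>+ x. ennreal (norm (f x) powr p) \<partial>lborel) \<le> B powr p"
    using bound by (intro enn2real_leI) auto
  then have "Lp_norm p f \<le> (B powr p) powr (1 / p)"
    unfolding Lp_norm_def using assms by (intro powr_mono2) auto
  then show "Lp_norm p f \<le> B" using assms by (simp add: powr_powr)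
qed

lemma Lp_dominated:
  assumes "f \<in> borel_measurable borel" and g [measurable]: "Lp_mem p g" and "0 < p" "0 \<le> c"
    and le: "AE x in lborel. norm (f x) \<le> c * norm (g x)"
  shows "Lp_mem p f" "Lp_norm p f \<le> c * Lp_norm p g"
proof -
  have "(\<integral>\<^sup>+ x. ennreal (norm (f x) powr p) \<partial>lborel)
       \<le> (\<integral>\<^sup>+ x. ennreal (c powr p) * ennreal (norm (g x) powr p) \<partial>lborel)"
  proof (rule nn_integral_mono_AE)
    show "AE x in lborel. ennreal (norm (f x) powr p) \<le> ennreal (c powr p) * ennreal (norm (g x) powr p)"
      using le
    proof eventually_elim
      case (elim x)
      then have "norm (f x) powr p \<le> (c * norm (g x)) powr p" using assms by (intro powr_mono2) auto
      then show ?case using assms by (simp add: powr_mult ennreal_mult'[symmetric] ennreal_leI)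
    qed
  qed
  also have "\<dots> = ennreal ((c * Lp_norm p g) powr p)"
    using assms by (simp add: nn_integral_cmult nn_integral_Lp_norm[OF g] powr_mult ennreal_mult')
  finally have bound: "(\<integral>\<^sup>+ x. ennreal (norm (f x) powr p) \<partial>lborel) \<le> \<dots>" .
  show "Lp_mem p f" "Lp_norm p f \<le> c * Lp_norm p g"
    using assms by (auto intro!: Lp_boundI[OF _ _ _ bound])
qed

lemma Lp_mem_norm: "Lp_mem p f \<Longrightarrow> Lp_mem p (\<lambda>x. norm (f x))"
  and Lp_norm_norm: "Lp_norm p (\<lambda>x. norm (f x)) = Lp_norm p f"
  by (auto simp: Lp_mem_def Lp_norm_def)

lemma powr_convex_on_nonneg:
  assumes "1 \<le> p"
  shows "convex_on {0..} (\<lambda>x::real. x powr p)"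
proof (intro convex_onI)
  fix t x y :: real assume t: "0 < t" "t < 1" and xy: "x \<in> {0..}" "y \<in> {0..}"
  have scaled: "(c * z) powr p \<le> c * z powr p" if "0 < c" "c < 1" "0 \<le> z" for c z :: real
  proof -
    have "c powr p \<le> c powr 1" using that assms by (intro powr_mono') auto
    then show ?thesis using that by (simp add: powr_mult mult_right_mono)
  qed
  show "((1 - t) *\<^sub>R x + t *\<^sub>R y) powr p \<le> (1 - t) * x powr p + t * y powr p"
  proof (cases "x = 0 \<or> y = 0")
    case True
    then show ?thesis using scaled[of t y] scaled[of "1 - t" x] t xy by auto
  next
    case False
    then show ?thesis using convex_onD[OF powr_convex[OF assms], of t x y] t xy by auto
  qed
qed auto

lemma nn_integral_Minkowski:
  fixes f :: "R2 \<Rightarrow> 'b::real_normed_vector" and g :: "R2 \<Rightarrow> 'c::real_normed_vector"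
  assumes f [measurable]: "Lp_mem p f" and g [measurable]: "Lp_mem p g" and p: "1 \<le> p"
    and ab: "Lp_norm p f < a" "Lp_norm p g < b"
  shows "(\<integral>\<^sup>+ x. ennreal ((norm (f x) + norm (g x)) powr p) \<partial>lborel) \<le> ennreal ((a + b) powr p)"
proof -
  have pos: "0 < a" "0 < b" using ab Lp_norm_nonneg[of p f] Lp_norm_nonneg[of p g] by linarith+
  define A B where "A = (a + b) powr p * a / (a + b) / a powr p" and "B = (a + b) powr p * b / (a + b) / b powr p"
  have AB: "0 \<le> A" "0 \<le> B" using pos by (auto simp: A_def B_def)
  have "(norm (f x) + norm (g x)) powr p \<le> A * norm (f x) powr p + B * norm (g x) powr p" for x
  proof -
    have "((1 - b / (a + b)) *\<^sub>R (norm (f x) / a) + (b / (a + b)) *\<^sub>R (norm (g x) / b)) powr p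
       \<le> (1 - b / (a + b)) * (norm (f x) / a) powr p + b / (a + b) * (norm (g x) / b) powr p"
      using pos by (intro convex_onD[OF powr_convex_on_nonneg[OF p]]) auto
    moreover have "1 - b / (a + b) = a / (a + b)" using pos by (simp add: field_simps)
    ultimately have "((norm (f x) + norm (g x)) / (a + b)) powr p
       \<le> a / (a + b) * (norm (f x) / a) powr p + b / (a + b) * (norm (g x) / b) powr p"
      using pos by (simp add: add_divide_distrib)
    then have "(a + b) powr p * ((norm (f x) + norm (g x)) / (a + b)) powr p
       \<le> (a + b) powr p * (a / (a + b) * (norm (f x) / a) powr p + b / (a + b) * (norm (g x) / b) powr p)"
      by (intro mult_left_mono) auto
    then show ?thesis using pos by (simp add: A_def B_def powr_divide distrib_left)
  qed
  then have "(\<integral>\<^sup>+ x. ennreal ((norm (f x) + norm (g x)) powr p) \<partial>lborel)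
     \<le> (\<integral>\<^sup>+ x. ennreal A * ennreal (norm (f x) powr p) + ennreal B * ennreal (norm (g x) powr p) \<partial>lborel)"
    using AB by (intro nn_integral_mono)
      (simp add: ennreal_mult'[symmetric] ennreal_plus[symmetric] ennreal_leI del: ennreal_plus)
  also have "\<dots> = ennreal A * ennreal (Lp_norm p f powr p) + ennreal B * ennreal (Lp_norm p g powr p)"
    using p by (simp add: nn_integral_add nn_integral_cmult nn_integral_Lp_norm f g)
  also have "\<dots> \<le> ennreal A * ennreal (a powr p) + ennreal B * ennreal (b powr p)"
    using ab p by (intro add_mono mult_left_mono ennreal_leI powr_mono2) auto
  also have "\<dots> = ennreal ((a + b) powr p)"
  proof -
    have "A * a powr p + B * b powr p = (a + b) powr p * (a / (a + b) + b / (a + b))"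
      using pos by (simp add: A_def B_def distrib_left)
    also have "a / (a + b) + b / (a + b) = 1" using pos by (simp add: add_divide_distrib[symmetric])
    finally show ?thesis using AB by (simp add: ennreal_mult'[symmetric] ennreal_plus[symmetric] del: ennreal_plus)
  qed
  finally show ?thesis .
qed

lemma Lp_triangle:
  assumes h: "h \<in> borel_measurable borel" and fg: "Lp_mem p f" "Lp_mem p g" and p: "1 \<le> p"
    and le: "\<And>x. norm (h x) \<le> norm (f x) + norm (g x)"
  shows "Lp_mem p h" "Lp_norm p h \<le> Lp_norm p f + Lp_norm p g"
proof -
  have bound: "Lp_mem p h \<and> Lp_norm p h \<le> Lp_norm p f + Lp_norm p g + e" if "0 < e" for e
  proof -
    have "(\<integral>\<^sup>+ x. ennreal (norm (h x) powr p) \<partial>lborel)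
       \<le> (\<integral>\<^sup>+ x. ennreal ((norm (f x) + norm (g x)) powr p) \<partial>lborel)"
      using le p by (intro nn_integral_mono ennreal_leI powr_mono2) auto
    also have "\<dots> \<le> ennreal (((Lp_norm p f + e / 2) + (Lp_norm p g + e / 2)) powr p)"
      using that by (intro nn_integral_Minkowski fg p) auto
    finally show ?thesis
      using h p that by (intro conjI Lp_boundI) (auto simp: add.assoc add.left_commute[of "e / 2"])
  qed
  show "Lp_mem p h" using bound[of 1] by simp
  show "Lp_norm p h \<le> Lp_norm p f + Lp_norm p g" by (rule field_le_epsilon) (use bound in blast)
qed

lemma Lp_interpolation:
  assumes f [measurable]: "Lp_mem q f" and pq: "0 < q" "q \<le> p" and S: "\<And>x. norm (f x) \<le> S"
  shows "Lp_mem p f" "Lp_norm p f \<le> S powr (1 - q / p) * Lp_norm q f powr (q / p)"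
proof -
  have "(\<integral>\<^sup>+ x. ennreal (norm (f x) powr p) \<partial>lborel)
       \<le> (\<integral>\<^sup>+ x. ennreal (S powr (p - q)) * ennreal (norm (f x) powr q) \<partial>lborel)"
  proof (rule nn_integral_mono)
    fix x
    have "norm (f x) powr p = norm (f x) powr (p - q) * norm (f x) powr q" by (simp add: powr_add[symmetric])
    also have "\<dots> \<le> S powr (p - q) * norm (f x) powr q"
      using S pq by (intro mult_right_mono powr_mono2) auto
    finally show "ennreal (norm (f x) powr p) \<le> ennreal (S powr (p - q)) * ennreal (norm (f x) powr q)"
      by (simp add: ennreal_mult'[symmetric] ennreal_leI)
  qed
  also have "\<dots> = ennreal (S powr (p - q) * Lp_norm q f powr q)"
    using pq by (simp add: nn_integral_cmult nn_integral_Lp_norm[OF f] ennreal_mult')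
  also have "S powr (p - q) * Lp_norm q f powr q = (S powr (1 - q / p) * Lp_norm q f powr (q / p)) powr p"
  proof -
    have "(1 - q / p) * p = p - q" using pq by (simp add: field_simps)
    then show ?thesis using pq by (simp add: powr_mult powr_powr)
  qed
  finally have bound: "(\<integral>\<^sup>+ x. ennreal (norm (f x) powr p) \<partial>lborel) \<le> \<dots>" .
  show "Lp_mem p f" "Lp_norm p f \<le> S powr (1 - q / p) * Lp_norm q f powr (q / p)"
    using pq by (auto intro!: Lp_boundI[OF _ _ _ bound])
qed

lemma Lp_mem_between:
  assumes f [measurable]: "Lp_mem q f" "Lp_mem r f" and "q \<le> p" "p \<le> r"
  shows "Lp_mem p f"
proof -
  have powr_le_add_powr: "x powr p \<le> x powr q + x powr r" if "0 \<le> x" for x :: real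
  proof (cases "1 \<le> x")
    case True
    then have "x powr p \<le> x powr r" using assms by (intro powr_mono)
    then show ?thesis using powr_ge_zero[of x q] by linarith
  next
    case False
    then have "x powr p \<le> x powr q" using assms that by (intro powr_mono') auto
    then show ?thesis using powr_ge_zero[of x r] by linarith
  qed
  have "(\<integral>\<^sup>+ x. ennreal (norm (f x) powr p) \<partial>lborel)
       \<le> (\<integral>\<^sup>+ x. ennreal (norm (f x) powr q) + ennreal (norm (f x) powr r) \<partial>lborel)"
    using powr_le_add_powr by (intro nn_integral_mono) (simp add: ennreal_plus[symmetric] ennreal_leI del: ennreal_plus)
  also have "\<dots> < \<infinity>"
    using f by (subst nn_integral_add) (auto simp: Lp_mem_def)
  finally show ?thesis by (simp add: Lp_mem_def)
qed

lemma weighted_Minkowski_integral_inequality: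
  fixes g :: "'z::euclidean_space \<Rightarrow> R2 \<Rightarrow> 'b::{banach, second_countable_topology}"
  assumes [measurable]: "case_prod g \<in> borel_measurable (lborel \<Otimes>\<^sub>M lborel)"
      "w \<in> borel_measurable borel" "case_prod F \<in> borel_measurable (lborel \<Otimes>\<^sub>M lborel)"
    and nonneg: "\<And>\<tau>. 0 \<le> w \<tau>" "\<And>\<tau> x. 0 \<le> F \<tau> x" and p: "1 < p" and "0 < W" "0 \<le> B"
    and w: "(\<integral>\<^sup>+ \<tau>. ennreal (w \<tau>) \<partial>lborel) \<le> ennreal W"
    and F: "\<And>\<tau>. 0 < w \<tau> \<Longrightarrow> (\<integral>\<^sup>+ x. ennreal (F \<tau> x powr p) \<partial>lborel) \<le> ennreal (B powr p)"
    and g: "\<And>\<tau> x. norm (g \<tau> x) \<le> w \<tau> * F \<tau> x"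
  shows "Lp_mem p (\<lambda>x. \<integral>\<tau>. g \<tau> x \<partial>lborel)" "Lp_norm p (\<lambda>x. \<integral>\<tau>. g \<tau> x \<partial>lborel) \<le> W * B"
proof -
  have "(\<integral>\<^sup>+ x. ennreal (norm (\<integral>\<tau>. g \<tau> x \<partial>lborel) powr p) \<partial>lborel)
     \<le> (\<integral>\<^sup>+ x. ennreal (W powr (p - 1)) * (\<integral>\<^sup>+ \<tau>. ennreal (w \<tau> * F \<tau> x powr p) \<partial>lborel) \<partial>lborel)"
    by (intro nn_integral_mono integral_weighted_Holder_powr) (use assms in auto)
  also have "\<dots> = ennreal (W powr (p - 1)) * (\<integral>\<^sup>+ x. \<integral>\<^sup>+ \<tau>. ennreal (w \<tau> * F \<tau> x powr p) \<partial>lborel \<partial>lborel)"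
    by (rule nn_integral_cmult) measurable
  also have "(\<integral>\<^sup>+ x. \<integral>\<^sup>+ \<tau>. ennreal (w \<tau> * F \<tau> x powr p) \<partial>lborel \<partial>lborel)
     = (\<integral>\<^sup>+ \<tau>. \<integral>\<^sup>+ x. ennreal (w \<tau>) * ennreal (F \<tau> x powr p) \<partial>lborel \<partial>lborel)"
    using nonneg by (subst lborel_Tonelli) (simp_all add: ennreal_mult')
  also have "\<dots> \<le> (\<integral>\<^sup>+ \<tau>. ennreal (w \<tau>) * ennreal (B powr p) \<partial>lborel)"
  proof (rule nn_integral_mono)
    fix \<tau>
    have "(\<integral>\<^sup>+ x. ennreal (w \<tau>) * ennreal (F \<tau> x powr p) \<partial>lborel)
         = ennreal (w \<tau>) * (\<integral>\<^sup>+ x. ennreal (F \<tau> x powr p) \<partial>lborel)"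
      by (rule nn_integral_cmult) measurable
    also have "\<dots> \<le> ennreal (w \<tau>) * ennreal (B powr p)"
      using F[of \<tau>] nonneg(1)[of \<tau>] by (cases "w \<tau> = 0") (auto intro: mult_left_mono)
    finally show "(\<integral>\<^sup>+ x. ennreal (w \<tau>) * ennreal (F \<tau> x powr p) \<partial>lborel) \<le> ennreal (w \<tau>) * ennreal (B powr p)" .
  qed
  also have "\<dots> \<le> ennreal W * ennreal (B powr p)"
    by (subst nn_integral_multc) (auto intro: mult_right_mono w)
  also have "ennreal (W powr (p - 1)) * (ennreal W * ennreal (B powr p)) = ennreal ((W * B) powr p)"
    using \<open>0 < W\<close> \<open>0 \<le> B\<close> by (simp add: ennreal_mult'[symmetric] powr_mult powr_diff)
  finally have bound: "(\<integral>\<^sup>+ x. ennreal (norm (\<integral>\<tau>. g \<tau> x \<partial>lborel) powr p) \<partial>lborel) \<le> ennreal ((W * B) powr p)"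
    by (auto simp: mult_left_mono)
  show "Lp_mem p (\<lambda>x. \<integral>\<tau>. g \<tau> x \<partial>lborel)" "Lp_norm p (\<lambda>x. \<integral>\<tau>. g \<tau> x \<partial>lborel) \<le> W * B"
    using assms by (auto intro!: Lp_boundI[OF _ _ _ bound] lborel.borel_measurable_lebesgue_integral)
qed

lemma Minkowski_integral_inequality:
  fixes g :: "'z::euclidean_space \<Rightarrow> R2 \<Rightarrow> 'b::{banach, second_countable_topology}"
    and F :: "'z \<Rightarrow> R2 \<Rightarrow> 'c::{second_countable_topology, real_normed_vector}"
  assumes [measurable]: "case_prod g \<in> borel_measurable (lborel \<Otimes>\<^sub>M lborel)" "w \<in> borel_measurable borel"
      "N \<in> borel_measurable borel" "case_prod F \<in> borel_measurable (lborel \<Otimes>\<^sub>M lborel)"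
    and p: "1 < p" and W: "0 < W" "(\<integral>\<^sup>+ \<tau>. ennreal (w \<tau> * N \<tau>) \<partial>lborel) \<le> ennreal W"
    and nonneg: "\<And>\<tau>. 0 \<le> w \<tau>" "\<And>\<tau>. 0 \<le> N \<tau>" and N: "\<And>\<tau>. 0 < w \<tau> \<Longrightarrow> 0 < N \<tau>"
    and F: "\<And>\<tau>. 0 < w \<tau> \<Longrightarrow> Lp_mem p (F \<tau>)" "\<And>\<tau>. 0 < w \<tau> \<Longrightarrow> Lp_norm p (F \<tau>) \<le> N \<tau>"
    and g: "\<And>\<tau> x. norm (g \<tau> x) \<le> w \<tau> * norm (F \<tau> x)"
  shows "Lp_mem p (\<lambda>x. \<integral>\<tau>. g \<tau> x \<partial>lborel)" "Lp_norm p (\<lambda>x. \<integral>\<tau>. g \<tau> x \<partial>lborel) \<le> W"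
proof -
  have "(\<integral>\<^sup>+ x. ennreal ((norm (F \<tau> x) / N \<tau>) powr p) \<partial>lborel) \<le> ennreal (1 powr p)" if "0 < w \<tau> * N \<tau>" for \<tau>
  proof -
    have w: "0 < w \<tau>" using that nonneg[of \<tau>] by (simp add: zero_less_mult_iff)
    have "(\<integral>\<^sup>+ x. ennreal ((norm (F \<tau> x) / N \<tau>) powr p) \<partial>lborel)
         = ennreal (1 / N \<tau> powr p) * (\<integral>\<^sup>+ x. ennreal (norm (F \<tau> x) powr p) \<partial>lborel)"
      using N[OF w] by (subst nn_integral_cmult[symmetric]) (simp_all add: powr_divide ennreal_mult'[symmetric])
    also have "\<dots> \<le> ennreal (1 / N \<tau> powr p) * ennreal (N \<tau> powr p)"
      using F[OF w] p by (subst nn_integral_Lp_norm) (auto intro!: mult_left_mono ennreal_leI powr_mono2)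
    also have "\<dots> = ennreal (1 powr p)" using N[OF w] by (simp add: ennreal_mult'[symmetric])
    finally show ?thesis .
  qed
  moreover have "norm (g \<tau> x) \<le> w \<tau> * N \<tau> * (norm (F \<tau> x) / N \<tau>)" for \<tau> x
    using g[of \<tau> x] N[of \<tau>] nonneg[of \<tau>] by (cases "w \<tau> = 0") simp_all
  moreover have "(\<lambda>\<tau>. w \<tau> * N \<tau>) \<in> borel_measurable borel"
    "(\<lambda>(\<tau>, x). norm (F \<tau> x) / N \<tau>) \<in> borel_measurable (lborel \<Otimes>\<^sub>M lborel)"
    by measurable
  ultimately show "Lp_mem p (\<lambda>x. \<integral>\<tau>. g \<tau> x \<partial>lborel)" "Lp_norm p (\<lambda>x. \<integral>\<tau>. g \<tau> x \<partial>lborel) \<le> W"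
    using weighted_Minkowski_integral_inequality[of g "\<lambda>\<tau>. w \<tau> * N \<tau>"
      "\<lambda>\<tau> x. norm (F \<tau> x) / N \<tau>" p W 1] p W nonneg by simp_all
qed

lemma Lp_tendsto_dominated:
  fixes f :: "'t::first_countable_topology \<Rightarrow> R2 \<Rightarrow> 'b::{banach, second_countable_topology}" and D :: "R2 \<Rightarrow> real"
  assumes [measurable]: "\<And>s. f s \<in> borel_measurable borel" "g \<in> borel_measurable borel"
    and D [measurable]: "Lp_mem p D" and p: "0 < p"
    and lim: "AE x in lborel. ((\<lambda>s. f s x) \<longlongrightarrow> g x) (at t)"
    and bound: "\<forall>\<^sub>F s in at t. AE x in lborel. norm (f s x) \<le> D x" "AE x in lborel. norm (g x) \<le> D x"
  shows "((\<lambda>s. Lp_norm p (\<lambda>x. f s x - g x)) \<longlongrightarrow> 0) (at t)"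
proof -
  let ?d = "\<lambda>s x. norm (f s x - g x) powr p"
  have D_int: "integrable lborel (\<lambda>x. (2 * norm (D x)) powr p)"
    using D p by (intro integrableI_nonneg)
      (auto simp: powr_mult ennreal_mult' nn_integral_cmult ennreal_mult_less_top Lp_mem_def)
  have d_le: "\<forall>\<^sub>F s in at t. AE x in lborel. norm (?d s x) \<le> (2 * norm (D x)) powr p"
    using bound(1)
  proof eventually_elim
    case (elim s)
    then show ?case using bound(2)
    proof eventually_elim
      case (elim x)
      then have "norm (f s x - g x) \<le> 2 * norm (D x)" using norm_triangle_ineq4[of "f s x" "g x"] by simp
      then show ?case using p by (simp add: powr_mono2)
    qed
  qed
  have "AE x in lborel. ((\<lambda>s. ?d s x) \<longlongrightarrow> 0) (at t)"
    using lim
  proof eventually_elim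
    case (elim x)
    then have "((\<lambda>s. norm (f s x - g x)) \<longlongrightarrow> 0) (at t)" by (intro tendsto_norm_zero LIM_zero)
    then show ?case by (rule tendsto_zero_powrI[OF _ tendsto_const[of p] always_eventually]) (use p in simp_all)
  qed
  then have "((\<lambda>s. \<integral>x. ?d s x \<partial>lborel) \<longlongrightarrow> (\<integral>x. 0 \<partial>(lborel :: R2 measure))) (at t)"
    by (rule integral_dominated_convergence_at[OF _ _ D_int _ d_le, rotated 2]) measurable
  then have "((\<lambda>s. (\<integral>x. ?d s x \<partial>lborel) powr (1 / p)) \<longlongrightarrow> 0) (at t)"
    using p by (intro tendsto_zero_powrI[OF _ tendsto_const]) auto
  moreover have "Lp_norm p (\<lambda>x. f s x - g x) = (\<integral>x. ?d s x \<partial>lborel) powr (1 / p)" for s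
    by (subst integral_eq_nn_integral) (auto simp: Lp_norm_def)
  ultimately show ?thesis by simp
qed

lemma Lp_norm_eq_0_AE:
  assumes f [measurable]: "Lp_mem p f" and p: "0 < p" and zero: "Lp_norm p f = 0"
  shows "AE x in lborel. f x = 0"
proof -
  have "(\<integral>\<^sup>+ x. ennreal (norm (f x) powr p) \<partial>lborel) = 0"
    using nn_integral_Lp_norm[OF f p] zero p by simp
  then have "AE x in lborel. ennreal (norm (f x) powr p) = 0" by (subst (asm) nn_integral_0_iff_AE) auto
  then show ?thesis by eventually_elim simp
qed

lemma Lp_limit_unique:
  fixes a :: "nat \<Rightarrow> R2 \<Rightarrow> 'b::{second_countable_topology, real_normed_vector}"
  assumes [measurable]: "\<And>n. a n \<in> borel_measurable borel" and u [measurable]: "Lp_mem p u"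
    and v [measurable]: "Lp_mem p v" and p: "1 \<le> p"
    and mem: "\<forall>\<^sub>F n in sequentially. Lp_mem p (\<lambda>x. a n x - v x)"
    and lim: "(\<lambda>n. Lp_norm p (\<lambda>x. a n x - u x)) \<longlonglongrightarrow> 0" "(\<lambda>n. Lp_norm p (\<lambda>x. a n x - v x)) \<longlonglongrightarrow> 0"
  shows "AE x in lborel. u x = v x"
proof -
  have uv: "Lp_mem p (\<lambda>x. u x - v x)" by (rule Lp_triangle(1)[OF _ u v p]) (auto simp: norm_triangle_ineq4)
  have "\<forall>\<^sub>F n in sequentially. Lp_norm p (\<lambda>x. u x - v x) \<le> Lp_norm p (\<lambda>x. a n x - u x) + Lp_norm p (\<lambda>x. a n x - v x)"
    using mem
  proof eventually_elim
    case (elim n)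
    have au: "Lp_mem p (\<lambda>x. a n x - u x)"
    proof (rule Lp_triangle(1)[OF _ elim uv p])
      show "norm (a n x - u x) \<le> norm (a n x - v x) + norm (u x - v x)" for x
        using norm_triangle_ineq4[of "a n x - v x" "u x - v x"] by simp
    qed measurable
    show ?case
    proof (rule Lp_triangle(2)[OF _ au elim p])
      show "norm (u x - v x) \<le> norm (a n x - u x) + norm (a n x - v x)" for x
        using norm_triangle_ineq4[of "a n x - v x" "a n x - u x"] by simp
    qed measurable
  qed
  then have "Lp_norm p (\<lambda>x. u x - v x) \<le> 0"
    using tendsto_lowerbound[OF tendsto_add_zero[OF lim]] by simp
  then have "Lp_norm p (\<lambda>x. u x - v x) = 0" using Lp_norm_nonneg[of p "\<lambda>x. u x - v x"] by linarith
  then show ?thesis using Lp_norm_eq_0_AE[OF uv] p by simp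
qed

section \<open>Convolutions\<close>

definition convolve :: "('a::euclidean_space \<Rightarrow> real) \<Rightarrow> ('a \<Rightarrow> 'b::{banach, second_countable_topology}) \<Rightarrow> 'a \<Rightarrow> 'b" where
  "convolve k f x = (\<integral>y. k (x - y) *\<^sub>R f y \<partial>lborel)"

lemma convolve_measurable [measurable (raw)]:
  assumes [measurable]: "case_prod k \<in> borel_measurable (M \<Otimes>\<^sub>M borel)"
    "case_prod f \<in> borel_measurable (M \<Otimes>\<^sub>M borel)" "h \<in> borel_measurable M"
  shows "(\<lambda>z. convolve (k z) (f z) (h z)) \<in> borel_measurable M"
  unfolding convolve_def by (rule lborel.borel_measurable_lebesgue_integral) measurable

lemma norm_convolve_le: "ennreal (norm (convolve k f x)) \<le> (\<integral>\<^sup>+ y. ennreal (\<bar>k (x - y)\<bar> * norm (f y)) \<partial>lborel)"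
  unfolding convolve_def using norm_integral_le_nn_integral[of lborel "\<lambda>y. k (x - y) *\<^sub>R f y"] by simp

lemma nn_integral_convolve_le_Lp:
  assumes [measurable]: "k \<in> borel_measurable borel" and f [measurable]: "Lp_mem p f" and p: "1 < p"
    and k: "\<And>z. 0 \<le> k z" "\<And>z. k z \<le> S" and W: "0 \<le> W" "(\<integral>\<^sup>+ z. ennreal (k z) \<partial>lborel) \<le> ennreal W"
  shows "(\<integral>\<^sup>+ y. ennreal (k (x - y) * norm (f y)) \<partial>lborel)
       \<le> ennreal (W powr (1 - 1 / p) * S powr (1 / p) * Lp_norm p f)"
proof -
  have S: "0 \<le> S" using order_trans[OF k(1) k(2)] .
  have "(\<integral>\<^sup>+ y. ennreal (k (x - y) * norm (f y) powr p) \<partial>lborel)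
       \<le> (\<integral>\<^sup>+ y. ennreal S * ennreal (norm (f y) powr p) \<partial>lborel)"
    using k S by (intro nn_integral_mono) (auto simp: ennreal_mult'[symmetric] intro!: ennreal_leI mult_right_mono)
  also have "\<dots> = ennreal (S * Lp_norm p f powr p)"
    using p S by (simp add: nn_integral_cmult nn_integral_Lp_norm[OF f] ennreal_mult')
  finally have Sf: "(\<integral>\<^sup>+ y. ennreal (k (x - y) * norm (f y) powr p) \<partial>lborel) \<le> ennreal (S * Lp_norm p f powr p)" .
  have "(\<integral>\<^sup>+ y. ennreal (k (x - y)) \<partial>lborel) \<le> ennreal W"
    using W by (subst nn_integral_lborel_reflect[of "\<lambda>z. ennreal (k z)"]) auto
  then have "(\<integral>\<^sup>+ y. ennreal (k (x - y) * norm (f y)) \<partial>lborel)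
      \<le> ennreal (W powr (1 - 1 / p) * (S * Lp_norm p f powr p) powr (1 / p))"
    using k W S p by (intro nn_integral_weighted_Holder[OF _ _ _ _ p _ _ _ Sf]) auto
  also have "(S * Lp_norm p f powr p) powr (1 / p) = S powr (1 / p) * Lp_norm p f"
    using S p by (simp add: powr_mult powr_powr)
  finally show ?thesis by (simp add: mult.assoc)
qed

lemma Lp_convolve:
  fixes f :: "R2 \<Rightarrow> 'b::{banach, second_countable_topology}"
  assumes [measurable]: "k \<in> borel_measurable borel" and f [measurable]: "Lp_mem p f" and p: "1 < p"
    and W: "0 < W" "(\<integral>\<^sup>+ z. ennreal \<bar>k z\<bar> \<partial>lborel) \<le> ennreal W"
  shows "Lp_mem p (convolve k f)" "Lp_norm p (convolve k f) \<le> W * Lp_norm p f"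
proof -
  have conv: "convolve k f = (\<lambda>x. \<integral>z. k z *\<^sub>R f (x - z) \<partial>lborel)"
  proof
    fix x
    show "convolve k f x = (\<integral>z. k z *\<^sub>R f (x - z) \<partial>lborel)"
      using integral_lborel_reflect[of "\<lambda>z. k z *\<^sub>R f (x - z)" x] by (simp add: convolve_def)
  qed
  have F: "(\<integral>\<^sup>+ x. ennreal (norm (f (x - z)) powr p) \<partial>lborel) \<le> ennreal (Lp_norm p f powr p)" for z
    using nn_integral_lborel_shift[of "\<lambda>x. ennreal (norm (f x) powr p)" "- z"] nn_integral_Lp_norm[OF f] p by simp
  show "Lp_mem p (convolve k f)" "Lp_norm p (convolve k f) \<le> W * Lp_norm p f"
    unfolding conv using W p F
    by (auto intro!: weighted_Minkowski_integral_inequality[where B = "Lp_norm p f"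
      and w = "\<lambda>z. \<bar>k z\<bar>" and F = "\<lambda>z x. norm (f (x - z))"])
qed

lemma convolve_convolve:
  fixes k h H :: "'a::euclidean_space \<Rightarrow> real" and f :: "'a \<Rightarrow> 'b::{banach, second_countable_topology}"
  assumes [measurable]: "k \<in> borel_measurable borel" "h \<in> borel_measurable borel"
    "H \<in> borel_measurable borel" "f \<in> borel_measurable borel"
    and nonneg: "\<And>z. 0 \<le> k z" "\<And>z. 0 \<le> h z"
    and H: "AE z in lborel. 0 \<le> H (x - z) \<and> (\<integral>\<^sup>+ y. ennreal (k (x - y) * h (y - z)) \<partial>lborel) = ennreal (H (x - z))"
    and int: "integrable lborel (\<lambda>z. H (x - z) *\<^sub>R f z)"
  shows "integrable lborel (\<lambda>y. k (x - y) *\<^sub>R convolve h f y)" "convolve k (convolve h f) x = convolve H f x"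
proof -
  define g where "g y z = (k (x - y) * h (y - z)) *\<^sub>R f z" for y z
  have [measurable]: "case_prod g \<in> borel_measurable (lborel \<Otimes>\<^sub>M lborel)" unfolding g_def by measurable
  have "(\<integral>\<^sup>+ y. \<integral>\<^sup>+ z. ennreal (norm (g y z)) \<partial>lborel \<partial>lborel) = (\<integral>\<^sup>+ z. \<integral>\<^sup>+ y. ennreal (norm (g y z)) \<partial>lborel \<partial>lborel)"
    by (rule lborel_Tonelli) measurable
  also have "\<dots> = (\<integral>\<^sup>+ z. ennreal (norm (H (x - z) *\<^sub>R f z)) \<partial>lborel)"
  proof (rule nn_integral_cong_AE)
    show "AE z in lborel. (\<integral>\<^sup>+ y. ennreal (norm (g y z)) \<partial>lborel) = ennreal (norm (H (x - z) *\<^sub>R f z))"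
      using H
    proof eventually_elim
      case (elim z)
      have "(\<integral>\<^sup>+ y. ennreal (norm (g y z)) \<partial>lborel)
           = (\<integral>\<^sup>+ y. ennreal (k (x - y) * h (y - z)) * ennreal (norm (f z)) \<partial>lborel)"
        using nonneg by (intro nn_integral_cong) (simp add: g_def ennreal_mult'[symmetric])
      then show ?case using elim by (simp add: nn_integral_multc ennreal_mult')
    qed
  qed
  also have "\<dots> < \<infinity>" using int by (simp add: integrable_iff_bounded)
  finally have fin: "(\<integral>\<^sup>+ y. \<integral>\<^sup>+ z. ennreal (norm (g y z)) \<partial>lborel \<partial>lborel) < \<infinity>" .
  have inner: "(\<integral>z. g y z \<partial>lborel) = k (x - y) *\<^sub>R convolve h f y" for y
    unfolding g_def convolve_def scaleR_scaleR[symmetric] by (rule integral_scaleR_right)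
  show "integrable lborel (\<lambda>y. k (x - y) *\<^sub>R convolve h f y)"
    unfolding inner[symmetric] using fin by (intro lborel_Fubini(2)) auto
  have "convolve k (convolve h f) x = (\<integral>y. \<integral>z. g y z \<partial>lborel \<partial>lborel)"
    unfolding inner by (simp add: convolve_def)
  also have "\<dots> = (\<integral>z. \<integral>y. g y z \<partial>lborel \<partial>lborel)" using fin by (intro lborel_Fubini(1)) auto
  also have "\<dots> = convolve H f x"
    unfolding convolve_def
  proof (rule integral_cong_AE)
    show "AE z in lborel. (\<integral>y. g y z \<partial>lborel) = H (x - z) *\<^sub>R f z"
      using H
    proof eventually_elim
      case (elim z)
      have "(\<integral>y. k (x - y) * h (y - z) \<partial>lborel) = H (x - z)"
        using elim nonneg by (subst integral_eq_nn_integral) auto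
      moreover have "integrable lborel (\<lambda>y. k (x - y) * h (y - z))"
        using elim nonneg by (intro integrableI_nonneg) auto
      ultimately show ?case by (simp add: g_def)
    qed
  qed (auto simp: g_def intro!: lborel.borel_measurable_lebesgue_integral)
  finally show "convolve k (convolve h f) x = convolve H f x" .
qed

lemma
  fixes k :: "'a::euclidean_space \<Rightarrow> real" and v :: "'a \<Rightarrow> 'b::{banach, second_countable_topology}"
  assumes k: "integrable lborel k" and v: "integrable lborel v"
  shows integrable_convolve: "integrable lborel (convolve k v)"
    and integral_convolve: "(\<integral>x. convolve k v x \<partial>lborel) = (\<integral>x. k x \<partial>lborel) *\<^sub>R (\<integral>x. v x \<partial>lborel)"
proof -
  have [measurable]: "k \<in> borel_measurable borel" "v \<in> borel_measurable borel" using k v by simp_all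
  have "(\<integral>\<^sup>+ x. ennreal (norm (k (x - y) *\<^sub>R v y)) \<partial>lborel)
       = (\<integral>\<^sup>+ x. ennreal \<bar>k x\<bar> \<partial>lborel) * ennreal (norm (v y))" for y
    using nn_integral_lborel_shift[of "\<lambda>x. ennreal \<bar>k x\<bar>" "- y"] by (simp add: ennreal_mult' nn_integral_multc)
  then have "(\<integral>\<^sup>+ x. \<integral>\<^sup>+ y. ennreal (norm (k (x - y) *\<^sub>R v y)) \<partial>lborel \<partial>lborel)
     = (\<integral>\<^sup>+ x. ennreal \<bar>k x\<bar> \<partial>lborel) * (\<integral>\<^sup>+ y. ennreal (norm (v y)) \<partial>lborel)"
    by (subst lborel_Tonelli) (measurable, simp only:, rule nn_integral_cmult, measurable)
  also have "\<dots> < \<infinity>" using k v by (simp add: integrable_iff_bounded ennreal_mult_less_top)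
  finally have fin: "(\<integral>\<^sup>+ x. \<integral>\<^sup>+ y. ennreal (norm (k (x - y) *\<^sub>R v y)) \<partial>lborel \<partial>lborel) < \<infinity>" .
  show "integrable lborel (convolve k v)"
    unfolding convolve_def[abs_def] by (rule lborel_Fubini(2)[OF _ fin]) measurable
  have "(\<integral>x. k (x - y) *\<^sub>R v y \<partial>lborel) = (\<integral>x. k x \<partial>lborel) *\<^sub>R v y" for y
    using integral_lborel_shift[of "\<lambda>x. k x *\<^sub>R v y" "- y"] k by (simp add: integral_scaleR_left)
  then show "(\<integral>x. convolve k v x \<partial>lborel) = (\<integral>x. k x \<partial>lborel) *\<^sub>R (\<integral>x. v x \<partial>lborel)"
    unfolding convolve_def by (subst lborel_Fubini(1)[OF _ fin]) simp_all
qed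

lemma convolve_average:
  fixes u :: "'z::euclidean_space \<Rightarrow> 'a::euclidean_space \<Rightarrow> 'b::{banach, second_countable_topology}"
  assumes [measurable]: "k \<in> borel_measurable borel" "\<omega> \<in> borel_measurable borel"
    "case_prod u \<in> borel_measurable (lborel \<Otimes>\<^sub>M lborel)"
    and fin: "(\<integral>\<^sup>+ s. \<integral>\<^sup>+ y. ennreal (\<bar>\<omega> s\<bar> * (\<bar>k (x - y)\<bar> * norm (u s y))) \<partial>lborel \<partial>lborel) < \<infinity>"
  shows "integrable lborel (\<lambda>s. \<omega> s *\<^sub>R convolve k (u s) x)"
    and "convolve k (\<lambda>y. \<integral>s. \<omega> s *\<^sub>R u s y \<partial>lborel) x = (\<integral>s. \<omega> s *\<^sub>R convolve k (u s) x \<partial>lborel)"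
proof -
  define g where "g s y = \<omega> s *\<^sub>R k (x - y) *\<^sub>R u s y" for s y
  have [measurable]: "case_prod g \<in> borel_measurable (lborel \<Otimes>\<^sub>M lborel)" unfolding g_def by measurable
  have fin': "(\<integral>\<^sup>+ s. \<integral>\<^sup>+ y. ennreal (norm (g s y)) \<partial>lborel \<partial>lborel) < \<infinity>"
    using fin by (simp add: g_def abs_mult mult.assoc)
  have over_y: "(\<integral>y. g s y \<partial>lborel) = \<omega> s *\<^sub>R convolve k (u s) x" for s
    by (simp add: g_def convolve_def del: scaleR_scaleR)
  have over_s: "(\<integral>s. g s y \<partial>lborel) = k (x - y) *\<^sub>R (\<integral>s. \<omega> s *\<^sub>R u s y \<partial>lborel)" for y
    unfolding g_def scaleR_left_commute[of "\<omega> _"] by (rule integral_scaleR_right)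
  show "integrable lborel (\<lambda>s. \<omega> s *\<^sub>R convolve k (u s) x)"
    unfolding over_y[symmetric] using fin' by (intro lborel_Fubini(2)) auto
  show "convolve k (\<lambda>y. \<integral>s. \<omega> s *\<^sub>R u s y \<partial>lborel) x = (\<integral>s. \<omega> s *\<^sub>R convolve k (u s) x \<partial>lborel)"
    unfolding convolve_def[of k "\<lambda>y. \<integral>s. \<omega> s *\<^sub>R u s y \<partial>lborel"] over_s[symmetric] over_y[symmetric]
    using fin' by (intro lborel_Fubini(1)[symmetric]) auto
qed

lemma convolve_kernel_average:
  fixes k :: "'z::euclidean_space \<Rightarrow> 'a::euclidean_space \<Rightarrow> real" and f :: "'a \<Rightarrow> 'b::{banach, second_countable_topology}"
  assumes [measurable]: "case_prod k \<in> borel_measurable (lborel \<Otimes>\<^sub>M lborel)" "\<omega> \<in> borel_measurable borel"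
      "f \<in> borel_measurable borel" "K \<in> borel_measurable borel"
    and fin: "(\<integral>\<^sup>+ s. \<integral>\<^sup>+ y. ennreal (\<bar>\<omega> s\<bar> * (\<bar>k s (x - y)\<bar> * norm (f y))) \<partial>lborel \<partial>lborel) < \<infinity>"
    and K: "AE y in lborel. has_bochner_integral lborel (\<lambda>s. \<omega> s * k s (x - y)) (K (x - y))"
  shows "integrable lborel (\<lambda>y. K (x - y) *\<^sub>R f y)"
    and "(\<integral>s. \<omega> s *\<^sub>R convolve (k s) f x \<partial>lborel) = convolve K f x"
proof -
  define g where "g s y = (\<omega> s * k s (x - y)) *\<^sub>R f y" for s y
  have [measurable]: "case_prod g \<in> borel_measurable (lborel \<Otimes>\<^sub>M lborel)" unfolding g_def by measurable
  have fin': "(\<integral>\<^sup>+ s. \<integral>\<^sup>+ y. ennreal (norm (g s y)) \<partial>lborel \<partial>lborel) < \<infinity>"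
    using fin by (simp add: g_def abs_mult mult.assoc)
  have over_s: "AE y in lborel. (\<integral>s. g s y \<partial>lborel) = K (x - y) *\<^sub>R f y"
    using K by eventually_elim (auto simp: g_def has_bochner_integral_iff)
  have "integrable lborel (\<lambda>y. \<integral>s. g s y \<partial>lborel)" using fin' by (intro lborel_Fubini(3)) auto
  then show "integrable lborel (\<lambda>y. K (x - y) *\<^sub>R f y)"
    by (rule integrable_cong_AE_imp) (use over_s in auto)
  have "(\<integral>s. \<omega> s *\<^sub>R convolve (k s) f x \<partial>lborel) = (\<integral>s. \<integral>y. g s y \<partial>lborel \<partial>lborel)"
    unfolding g_def convolve_def scaleR_scaleR[symmetric] integral_scaleR_right ..
  also have "\<dots> = (\<integral>y. \<integral>s. g s y \<partial>lborel \<partial>lborel)" using fin' by (intro lborel_Fubini(1)) auto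
  also have "\<dots> = convolve K f x"
    unfolding convolve_def using over_s
    by (intro integral_cong_AE) (auto intro!: lborel.borel_measurable_lebesgue_integral)
  finally show "(\<integral>s. \<omega> s *\<^sub>R convolve (k s) f x \<partial>lborel) = convolve K f x" .
qed

section \<open>The heat kernel\<close>

definition heat_kernel :: "real \<Rightarrow> 'a::euclidean_space \<Rightarrow> real" where
  "heat_kernel t x = (if 0 < t then exp (- (norm x)\<^sup>2 / (4 * t)) / sqrt (4 * pi * t) ^ DIM('a) else 0)"

lemma heat_kernel_R2: "heat_kernel t (x :: R2) = (if 0 < t then exp (- (norm x)\<^sup>2 / (4 * t)) / (4 * pi * t) else 0)"
  by (simp add: heat_kernel_def)

lemma heat_kernel_nonneg [simp]: "0 \<le> heat_kernel t x"
  by (simp add: heat_kernel_def)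

lemma heat_kernel_nonpos [simp]: "t \<le> 0 \<Longrightarrow> heat_kernel t x = 0"
  by (simp add: heat_kernel_def)

lemma heat_kernel_measurable [measurable (raw)]:
  assumes [measurable]: "f \<in> borel_measurable M" "g \<in> borel_measurable M"
  shows "(\<lambda>z. heat_kernel (f z) (g z)) \<in> borel_measurable M"
  unfolding heat_kernel_def by measurable

lemma heat_kernel_le: "0 < t \<Longrightarrow> heat_kernel t (x :: 'a::euclidean_space) \<le> 1 / sqrt (4 * pi * t) ^ DIM('a)"
  by (auto simp: heat_kernel_def intro!: divide_right_mono)

lemma heat_kernel_le_inverse_norm:
  assumes "x \<noteq> 0"
  shows "heat_kernel t (x :: R2) \<le> 1 / (pi * (norm x)\<^sup>2)"
proof (cases "0 < t")
  case True
  define z where "z = (norm x)\<^sup>2 / (4 * t)"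
  have z: "0 < z" using assms True by (simp add: z_def)
  have "z \<le> exp z" using exp_ge_add_one_self[of z] by linarith
  then have "exp (- z) \<le> 1 / z" using z by (simp add: exp_minus field_simps)
  then have "exp (- z) / (4 * pi * t) \<le> 1 / z / (4 * pi * t)"
    using True by (intro divide_right_mono) auto
  then show ?thesis using True by (simp add: heat_kernel_R2 z_def field_simps)
qed simp

lemma heat_kernel_le_dilated:
  assumes "0 < t" "t / 2 \<le> s" "s \<le> 2 * t"
  shows "heat_kernel s (x :: 'a::euclidean_space) \<le> 2 ^ DIM('a) * heat_kernel (2 * t) x"
proof -
  have s: "0 < s" using assms by simp
  have "sqrt (4 * pi * (2 * t)) = 2 * sqrt (pi * (2 * t))"
    using real_sqrt_mult[of 4 "pi * (2 * t)"] by (simp only: mult.assoc real_sqrt_four)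
  then have "sqrt (4 * pi * (2 * t)) / 2 \<le> sqrt (4 * pi * s)"
    using assms by simp
  then have "(sqrt (4 * pi * (2 * t)) / 2) ^ DIM('a) \<le> sqrt (4 * pi * s) ^ DIM('a)"
    using assms by (intro power_mono) auto
  moreover have "exp (- (norm x)\<^sup>2 / (4 * s)) \<le> exp (- (norm x)\<^sup>2 / (4 * (2 * t)))"
    using assms s by (simp add: frac_le)
  ultimately have "exp (- (norm x)\<^sup>2 / (4 * s)) / sqrt (4 * pi * s) ^ DIM('a)
     \<le> exp (- (norm x)\<^sup>2 / (4 * (2 * t))) / (sqrt (4 * pi * (2 * t)) / 2) ^ DIM('a)"
    using assms by (intro frac_le) auto
  then show ?thesis using assms s by (simp add: heat_kernel_def power_divide mult.commute)
qed

lemma heat_kernel_mult_le_dilated: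
  assumes "0 < t" and s: "t / 2 \<le> s" "s \<le> 2 * t"
  shows "heat_kernel (s * r) (x :: 'a::euclidean_space) \<le> 2 ^ DIM('a) * heat_kernel (2 * t * r) x"
proof (cases "0 < r")
  case True
  have "t * r / 2 \<le> s * r" "s * r \<le> 2 * (t * r)"
    using mult_right_mono[OF s(1), of r] mult_right_mono[OF s(2), of r] True by simp_all
  then show ?thesis using heat_kernel_le_dilated[of "t * r" "s * r" x] True assms by (simp add: mult.assoc)
qed (use assms in \<open>simp add: mult_nonneg_nonpos\<close>)

lemma heat_kernel_isCont:
  assumes "0 < t"
  shows "isCont (\<lambda>t. heat_kernel t (x :: 'a::euclidean_space)) t"
proof -
  have "isCont (\<lambda>t. exp (- (norm x)\<^sup>2 / (4 * t)) / sqrt (4 * pi * t) ^ DIM('a)) t"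
    using assms by (intro continuous_intros) auto
  moreover have "\<forall>\<^sub>F s in nhds t. heat_kernel s x = exp (- (norm x)\<^sup>2 / (4 * s)) / sqrt (4 * pi * s) ^ DIM('a)"
    by (rule eventually_mono[OF eventually_nhds_in_open[of "{0<..}" t]]) (use assms in \<open>auto simp: heat_kernel_def\<close>)
  ultimately show ?thesis by (simp add: isCont_cong)
qed

lemma heat_kernel_eq_prod_normal_density:
  assumes "0 < t"
  shows "heat_kernel t x = (\<Prod>b\<in>Basis. normal_density 0 (sqrt (2 * t)) (x \<bullet> b))"
proof -
  have "(norm x)\<^sup>2 = (\<Sum>b\<in>Basis. (x \<bullet> b)\<^sup>2)"
    unfolding power2_norm_eq_inner by (subst euclidean_inner) (simp add: power2_eq_square)
  then have "exp (- (norm x)\<^sup>2 / (4 * t)) = (\<Prod>b\<in>Basis. exp (- (x \<bullet> b)\<^sup>2 / (4 * t)))"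
    by (simp add: exp_sum[symmetric] sum_negf[symmetric] sum_divide_distrib)
  moreover have "2 * pi * (sqrt (2 * t))\<^sup>2 = 4 * pi * t" "2 * (sqrt (2 * t))\<^sup>2 = 4 * t" using assms by simp_all
  ultimately show ?thesis
    using assms unfolding normal_density_def prod.distrib
    by (simp only: heat_kernel_def power_divide) (simp add: power_one_over)
qed

lemma nn_integral_heat_kernel:
  assumes "0 < t"
  shows "(\<integral>\<^sup>+ x. ennreal (heat_kernel t (x :: 'a::euclidean_space)) \<partial>lborel) = 1"
proof -
  have "(\<integral>\<^sup>+ x. ennreal (normal_density 0 (sqrt (2 * t)) x) \<partial>lborel) = 1"
    using assms by (subst nn_integral_eq_integral) auto
  moreover have "(\<integral>\<^sup>+ x. ennreal (heat_kernel t (x :: 'a)) \<partial>lborel)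
      = (\<Prod>b\<in>(Basis :: 'a set). \<integral>\<^sup>+ x. ennreal (normal_density 0 (sqrt (2 * t)) x) \<partial>lborel)"
    unfolding heat_kernel_eq_prod_normal_density[OF assms] prod_ennreal[OF normal_density_nonneg, symmetric]
    by (rule nn_integral_lborel_prod) auto
  ultimately show ?thesis by simp
qed

lemma nn_integral_heat_kernel_shift:
  assumes "0 < t"
  shows "(\<integral>\<^sup>+ y. ennreal (heat_kernel t (y - x)) \<partial>lborel) = 1"
  using nn_integral_lborel_shift[of "\<lambda>y. ennreal (heat_kernel t y)" "- x"] nn_integral_heat_kernel[OF assms] by simp

lemma nn_integral_heat_kernel_powr:
  assumes t: "0 < t" and p: "0 < p"
  shows "(\<integral>\<^sup>+ x. ennreal (heat_kernel t (x :: 'a::euclidean_space) powr p) \<partial>lborel)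
     = ennreal ((sqrt (4 * pi * t) ^ DIM('a)) powr (1 - p) / sqrt p ^ DIM('a))"
proof -
  let ?c = "(sqrt (4 * pi * t) ^ DIM('a)) powr (1 - p) / sqrt p ^ DIM('a)"
  have "heat_kernel t x powr p = ?c * heat_kernel (t / p) x" for x :: 'a
  proof -
    have "(sqrt (4 * pi * t) ^ DIM('a)) powr (1 - p)
         = sqrt (4 * pi * t) ^ DIM('a) / (sqrt (4 * pi * t) ^ DIM('a)) powr p"
      using t by (simp add: powr_diff)
    moreover have "sqrt (4 * pi * (t / p)) ^ DIM('a) = sqrt (4 * pi * t) ^ DIM('a) / sqrt p ^ DIM('a)"
      by (simp add: real_sqrt_divide power_divide)
    ultimately show ?thesis
      using t p by (simp add: heat_kernel_def powr_divide exp_powr_real)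
  qed
  then have "(\<integral>\<^sup>+ x. ennreal (heat_kernel t (x :: 'a) powr p) \<partial>lborel)
      = (\<integral>\<^sup>+ x. ennreal ?c * ennreal (heat_kernel (t / p) (x :: 'a)) \<partial>lborel)"
    using p by (subst ennreal_mult'[symmetric]) simp_all
  then show ?thesis using t p by (simp add: nn_integral_cmult nn_integral_heat_kernel)
qed

lemma heat_kernel_mult:
  assumes st: "0 < s" "0 < t"
  shows "heat_kernel s (x - y) * heat_kernel t y
     = heat_kernel (s + t) x * heat_kernel (s * t / (s + t)) (y - (t / (s + t)) *\<^sub>R (x :: 'a::euclidean_space))"
proof -
  define X Y Z where "X = inner x x" and "Y = inner y y" and "Z = inner x y"
  have norms: "(norm (x - y))\<^sup>2 = X - 2 * Z + Y" "(norm y)\<^sup>2 = Y" "(norm x)\<^sup>2 = X"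
    "(norm (y - (t / (s + t)) *\<^sub>R x))\<^sup>2 = Y - 2 * (t / (s + t)) * Z + (t / (s + t))\<^sup>2 * X"
    unfolding power2_norm_eq_inner X_def Y_def Z_def
    by (simp_all add: inner_diff inner_commute power2_eq_square algebra_simps)
  have nonzero: "s + t \<noteq> 0" "s \<noteq> 0" "t \<noteq> 0" using st by auto
  have "- (X - 2 * Z + Y) / (4 * s) + - Y / (4 * t)
     = - X / (4 * (s + t)) + - (Y - 2 * (t / (s + t)) * Z + (t / (s + t))\<^sup>2 * X) / (4 * (s * t / (s + t)))"
    using nonzero by (simp add: divide_simps) (simp add: algebra_simps power2_eq_square)
  then have "exp (- (X - 2 * Z + Y) / (4 * s)) * exp (- Y / (4 * t))
     = exp (- X / (4 * (s + t))) * exp (- (Y - 2 * (t / (s + t)) * Z + (t / (s + t))\<^sup>2 * X) / (4 * (s * t / (s + t))))"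
    unfolding exp_add[symmetric] by simp
  moreover have "sqrt (4 * pi * s) ^ DIM('a) * sqrt (4 * pi * t) ^ DIM('a)
     = sqrt (4 * pi * (s + t)) ^ DIM('a) * sqrt (4 * pi * (s * t / (s + t))) ^ DIM('a)"
  proof -
    have "4 * pi * s * (4 * pi * t) = 4 * pi * (s + t) * (4 * pi * (s * t / (s + t)))" using nonzero by simp
    then show ?thesis by (simp only: power_mult_distrib[symmetric] real_sqrt_mult[symmetric])
  qed
  ultimately show ?thesis
    using st unfolding heat_kernel_def norms by (simp add: add_pos_pos)
qed

lemma nn_integral_heat_kernel_mult:
  assumes "0 < s" "0 < t"
  shows "(\<integral>\<^sup>+ y. ennreal (heat_kernel s (x - y)) * ennreal (heat_kernel t y) \<partial>lborel) = ennreal (heat_kernel (s + t) x)"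
proof -
  have "(\<integral>\<^sup>+ y. ennreal (heat_kernel s (x - y)) * ennreal (heat_kernel t y) \<partial>lborel)
    = (\<integral>\<^sup>+ y. ennreal (heat_kernel (s + t) x) *
        ennreal (heat_kernel (s * t / (s + t)) (y - (t / (s + t)) *\<^sub>R x)) \<partial>lborel)"
    using heat_kernel_mult[OF assms, of x] by (simp add: ennreal_mult'[symmetric])
  also have "\<dots> = ennreal (heat_kernel (s + t) x)"
    using assms by (simp add: nn_integral_cmult nn_integral_heat_kernel_shift)
  finally show ?thesis .
qed

definition heat_kernel_deriv :: "'a::euclidean_space \<Rightarrow> real \<Rightarrow> 'a \<Rightarrow> real" where
  "heat_kernel_deriv v s z = - (z \<bullet> v) / (2 * s) * heat_kernel s z"

lemma heat_kernel_deriv_measurable [measurable (raw)]: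
  assumes [measurable]: "f \<in> borel_measurable M" "g \<in> borel_measurable M"
  shows "(\<lambda>z. heat_kernel_deriv v (f z) (g z)) \<in> borel_measurable M"
  unfolding heat_kernel_deriv_def by measurable

lemma heat_kernel_deriv_nonpos [simp]: "s \<le> 0 \<Longrightarrow> heat_kernel_deriv v s z = 0"
  by (simp add: heat_kernel_deriv_def)

lemma heat_kernel_has_directional_derivative:
  fixes v z :: "'a::euclidean_space"
  shows "((\<lambda>h. heat_kernel s (z + h *\<^sub>R v)) has_real_derivative heat_kernel_deriv v s (z + h *\<^sub>R v)) (at h)"
proof (cases "0 < s")
  case s: True
  have norm_sq: "(norm (z + h *\<^sub>R v))\<^sup>2 = (norm z)\<^sup>2 + 2 * h * (z \<bullet> v) + h\<^sup>2 * (v \<bullet> v)" for h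
    unfolding power2_norm_eq_inner by (simp add: inner_add inner_commute[of v z] power2_eq_square algebra_simps)
  have "((\<lambda>h. - ((norm z)\<^sup>2 + 2 * h * (z \<bullet> v) + h\<^sup>2 * (v \<bullet> v)) / (4 * s)) has_real_derivative
      - (2 * (z \<bullet> v) + 2 * h * (v \<bullet> v)) / (4 * s)) (at h)"
    by (rule DERIV_cdivide) (auto intro!: derivative_eq_intros)
  from DERIV_cdivide[OF DERIV_fun_exp[OF this], of "sqrt (4 * pi * s) ^ DIM('a)"]
  have deriv: "((\<lambda>h. heat_kernel s (z + h *\<^sub>R v)) has_real_derivative
      exp (- ((norm z)\<^sup>2 + 2 * h * (z \<bullet> v) + h\<^sup>2 * (v \<bullet> v)) / (4 * s)) * (- (2 * (z \<bullet> v) + 2 * h * (v \<bullet> v)) / (4 * s))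
        / sqrt (4 * pi * s) ^ DIM('a)) (at h)"
    using s unfolding heat_kernel_def norm_sq by simp
  have exponent: "- (2 * (z \<bullet> v) + 2 * h * (v \<bullet> v)) / (4 * s) = - ((z + h *\<^sub>R v) \<bullet> v) / (2 * s)"
    using s by (simp add: inner_add_left field_simps)
  from deriv show ?thesis
    by (rule DERIV_cong) (use s in \<open>unfold exponent, simp add: heat_kernel_deriv_def heat_kernel_def norm_sq\<close>)
qed (simp add: heat_kernel_deriv_def)

lemma abs_heat_kernel_deriv_le:
  assumes s: "0 < s"
  shows "\<bar>heat_kernel_deriv v s (z :: 'a::euclidean_space)\<bar>
       \<le> sqrt 2 ^ DIM('a) * norm v / sqrt s * heat_kernel (2 * s) z"
proof -
  define y where "y = norm z / sqrt s"
  have y: "0 \<le> y" "y\<^sup>2 = (norm z)\<^sup>2 / s" using s by (auto simp: y_def power_divide)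
  have "0 \<le> (y - 2)\<^sup>2" by simp
  then have "y / 2 \<le> 1 + y\<^sup>2 / 8" by (simp add: power2_eq_square algebra_simps)
  also have "\<dots> \<le> exp (y\<^sup>2 / 8)" by (rule exp_ge_add_one_self)
  finally have "y / 2 * exp (- (y\<^sup>2 / 4)) \<le> exp (y\<^sup>2 / 8) * exp (- (y\<^sup>2 / 4))" by (intro mult_right_mono) auto
  then have decay: "y / 2 * exp (- (y\<^sup>2 / 4)) \<le> exp (- (y\<^sup>2 / 8))" by (simp add: exp_add[symmetric])
  have "\<bar>heat_kernel_deriv v s z\<bar> = \<bar>z \<bullet> v\<bar> / (2 * s) * heat_kernel s z"
    using s by (simp add: heat_kernel_deriv_def abs_mult)
  also have "\<dots> \<le> norm z * norm v / (2 * s) * heat_kernel s z"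
    using s by (intro mult_right_mono divide_right_mono Cauchy_Schwarz_ineq2) auto
  also have "\<dots> = norm v / sqrt s * (y / 2 * exp (- (y\<^sup>2 / 4))) / sqrt (4 * pi * s) ^ DIM('a)"
  proof -
    have "norm z * norm v / (2 * s) = norm v * (norm z / s) / 2" by (simp add: mult_ac)
    also have "norm z / s = y / sqrt s" using s by (simp add: y_def)
    finally have "norm z * norm v / (2 * s) = norm v / sqrt s * (y / 2)" by (simp add: mult.commute)
    then show ?thesis using s by (simp add: heat_kernel_def y(2))
  qed
  also have "\<dots> \<le> norm v / sqrt s * exp (- (y\<^sup>2 / 8)) / sqrt (4 * pi * s) ^ DIM('a)"
    using s by (intro divide_right_mono mult_left_mono decay) auto
  also have "\<dots> = sqrt 2 ^ DIM('a) * norm v / sqrt s * heat_kernel (2 * s) z"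
  proof -
    have "sqrt (4 * pi * (2 * s)) = sqrt 2 * sqrt (4 * pi * s)"
      unfolding real_sqrt_mult[symmetric] by (simp add: mult_ac)
    then have "sqrt (4 * pi * (2 * s)) ^ DIM('a) = sqrt 2 ^ DIM('a) * sqrt (4 * pi * s) ^ DIM('a)"
      by (simp only: power_mult_distrib)
    then show ?thesis using s by (simp add: heat_kernel_def y(2))
  qed
  finally show ?thesis .
qed

section \<open>Laplace transforms on the half-line\<close>

definition exp_decay :: "real \<Rightarrow> real \<Rightarrow> real" where
  "exp_decay l s = indicator {0..} s * exp (- l * s)"

lemma exp_decay_nonneg [simp]: "0 \<le> exp_decay l s"
  by (simp add: exp_decay_def)

lemma exp_decay_neg [simp]: "s < 0 \<Longrightarrow> exp_decay l s = 0"
  by (simp add: exp_decay_def)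

lemma exp_decay_measurable [measurable (raw)]:
  assumes [measurable]: "f \<in> borel_measurable M" "g \<in> borel_measurable M"
  shows "(\<lambda>z. exp_decay (f z) (g z)) \<in> borel_measurable M"
  unfolding exp_decay_def by measurable

lemma erlang_density_0: "erlang_density 0 l s = l * exp_decay l s"
  by (auto simp: erlang_density_def exp_decay_def mult.commute)

lemma has_bochner_integral_erlang_moment:
  assumes "0 < m"
  shows "has_bochner_integral lborel (\<lambda>s. erlang_density k m s * s ^ i) (fact (k + i) / (fact k * m ^ i))"
proof (rule has_bochner_integral_nn_integral)
  show "(\<integral>\<^sup>+ s. ennreal (erlang_density k m s * s ^ i) \<partial>lborel) = ennreal (fact (k + i) / (fact k * m ^ i))"
    by (rule nn_integral_erlang_ith_moment[OF assms])
qed (use assms in \<open>auto simp: erlang_density_def\<close>)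

lemma nn_integral_erlang_density_eq_1: "0 < m \<Longrightarrow> (\<integral>\<^sup>+ s. ennreal (erlang_density k m s) \<partial>lborel) = 1"
  using nn_integral_erlang_ith_moment[of m k 0] by simp

lemma has_bochner_integral_exp_decay:
  assumes "0 < l"
  shows "has_bochner_integral lborel (exp_decay l) (1 / l)"
  using has_bochner_integral_mult_right[of "1 / l", OF has_bochner_integral_erlang_moment[OF assms, of 0 0]] assms
  by (simp add: erlang_density_0)

lemma nn_integral_exp_decay:
  assumes "0 < l"
  shows "(\<integral>\<^sup>+ s. ennreal (exp_decay l s) \<partial>lborel) = ennreal (1 / l)"
  using has_bochner_integral_exp_decay[OF assms]
  by (subst nn_integral_eq_integral) (auto simp: has_bochner_integral_iff)

lemma nn_integral_powr_exp_decay: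
  assumes z: "0 < (z::real)" and a: "0 < a"
  shows "(\<integral>\<^sup>+ s. ennreal (s powr (z - 1) * exp_decay a s) \<partial>lborel) = ennreal (Gamma z / a powr z)"
proof -
  have scale: "(0 + a * t) powr (z - 1) * exp_decay 1 (0 + a * t)
       = a powr (z - 1) * (t powr (z - 1) * exp_decay a t)" for t
    using a by (auto simp: exp_decay_def powr_mult zero_le_mult_iff split: split_indicator)
  have "ennreal (Gamma z) = (\<integral>\<^sup>+ t. ennreal (t powr (z - 1) / exp t) * indicator {0..} t \<partial>lborel)"
    by (rule nn_integral_has_integral_lebesgue'[OF _ Gamma_integral_real[OF z], symmetric]) auto
  also have "\<dots> = (\<integral>\<^sup>+ t. ennreal (t powr (z - 1) * exp_decay 1 t) \<partial>lborel)"
    by (intro nn_integral_cong) (auto split: split_indicator simp: exp_decay_def exp_minus field_simps)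
  also have "\<dots> = a * (\<integral>\<^sup>+ t. ennreal ((0 + a * t) powr (z - 1) * exp_decay 1 (0 + a * t)) \<partial>lborel)"
    using a by (subst nn_integral_real_affine[of _ a 0]) simp_all
  also have "\<dots> = ennreal a * ennreal (a powr (z - 1)) * (\<integral>\<^sup>+ t. ennreal (t powr (z - 1) * exp_decay a t) \<partial>lborel)"
    unfolding scale by (simp only: ennreal_mult'[OF powr_ge_zero]) (simp add: nn_integral_cmult mult.assoc)
  also have "ennreal a * ennreal (a powr (z - 1)) = ennreal (a powr z)"
    using a by (simp add: ennreal_mult'[symmetric] powr_diff)
  finally have "ennreal (1 / a powr z) * ennreal (Gamma z)
     = ennreal (1 / a powr z) * (ennreal (a powr z) * (\<integral>\<^sup>+ t. ennreal (t powr (z - 1) * exp_decay a t) \<partial>lborel))"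
    by simp
  then show ?thesis using a z by (simp add: mult.assoc[symmetric] ennreal_mult'[symmetric])
qed

definition laplace_class :: "(real \<Rightarrow> 'b::{banach, second_countable_topology}) \<Rightarrow> bool" where
  "laplace_class v \<longleftrightarrow> v \<in> borel_measurable borel \<and> (\<forall>s\<le>0. v s = 0) \<and>
     (\<forall>e>0. (\<integral>\<^sup>+ s. ennreal (exp (- e * s) * norm (v s)) \<partial>lborel) < \<infinity>)"

definition laplace :: "(real \<Rightarrow> 'b::{banach, second_countable_topology}) \<Rightarrow> real \<Rightarrow> 'b" where
  "laplace v l = (\<integral>s. exp (- l * s) *\<^sub>R v s \<partial>lborel)"

lemma laplace_class_measurable [measurable_dest]: "laplace_class v \<Longrightarrow> v \<in> borel_measurable borel"
  by (simp add: laplace_class_def)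

lemma laplace_class_measurable_compose [measurable_dest]:
  "laplace_class v \<Longrightarrow> g \<in> borel_measurable M \<Longrightarrow> (\<lambda>x. v (g x)) \<in> borel_measurable M"
  using measurable_compose[OF _ laplace_class_measurable] by blast

lemma laplace_class_nonpos: "laplace_class v \<Longrightarrow> s \<le> 0 \<Longrightarrow> v s = 0"
  by (simp add: laplace_class_def)

lemma laplace_class_finite: "laplace_class v \<Longrightarrow> 0 < l \<Longrightarrow> (\<integral>\<^sup>+ s. ennreal (exp (- l * s) * norm (v s)) \<partial>lborel) < \<infinity>"
  by (simp add: laplace_class_def)

lemma laplace_class_integrable:
  assumes v [measurable]: "laplace_class v" and l: "0 < l"
  shows "integrable lborel (\<lambda>s. exp (- l * s) *\<^sub>R v s)"
  using laplace_class_finite[OF v l] by (intro integrableI_bounded) auto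

lemma laplace_class_integrableI:
  assumes "v \<in> borel_measurable borel" "\<And>s. s \<le> 0 \<Longrightarrow> v s = 0"
    and "\<And>l. 0 < l \<Longrightarrow> integrable lborel (\<lambda>s. exp (- l * s) *\<^sub>R v s)"
  shows "laplace_class v"
  using assms by (auto simp: laplace_class_def integrable_iff_bounded)

lemma laplace_class_scaleR: "laplace_class v \<Longrightarrow> laplace_class (\<lambda>s. c *\<^sub>R v s)"
  by (rule laplace_class_integrableI)
    (auto simp: laplace_class_nonpos laplace_class_integrable[simplified] scaleR_left_commute[of _ c]
      simp del: scaleR_scaleR)

lemma laplace_class_add: "laplace_class v \<Longrightarrow> laplace_class w \<Longrightarrow> laplace_class (\<lambda>s. v s + w s)"
  by (rule laplace_class_integrableI)
    (auto simp: laplace_class_nonpos laplace_class_integrable[simplified] scaleR_add_right)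

lemma laplace_class_diff: "laplace_class v \<Longrightarrow> laplace_class w \<Longrightarrow> laplace_class (\<lambda>s. v s - w s)"
  by (rule laplace_class_integrableI)
    (auto simp: laplace_class_nonpos laplace_class_integrable[simplified] scaleR_diff_right)

lemma laplace_scaleR: "laplace (\<lambda>s. c *\<^sub>R v s) l = c *\<^sub>R laplace v l"
  unfolding laplace_def scaleR_left_commute[of _ c] by (rule integral_scaleR_right)

lemma laplace_add: "laplace_class v \<Longrightarrow> laplace_class w \<Longrightarrow> 0 < l \<Longrightarrow> laplace (\<lambda>s. v s + w s) l = laplace v l + laplace w l"
  unfolding laplace_def scaleR_add_right by (intro Bochner_Integration.integral_add laplace_class_integrable)

lemma laplace_diff: "laplace_class v \<Longrightarrow> laplace_class w \<Longrightarrow> 0 < l \<Longrightarrow> laplace (\<lambda>s. v s - w s) l = laplace v l - laplace w l"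
  unfolding laplace_def scaleR_diff_right by (intro Bochner_Integration.integral_diff laplace_class_integrable)

lemma laplace_class_powr_bound:
  assumes [measurable]: "v \<in> borel_measurable borel" and zero: "\<And>s. s \<le> 0 \<Longrightarrow> v s = 0"
    and bound: "\<And>s. 0 < s \<Longrightarrow> norm (v s) \<le> A * s powr (- b)" and b: "b < 1"
  shows "laplace_class v"
  unfolding laplace_class_def
proof (intro conjI allI impI)
  fix e :: real assume e: "0 < e"
  have A: "0 \<le> A" using order_trans[OF norm_ge_zero bound[of 1]] by simp
  have weighted_norm_le: "exp (- e * s) * norm (v s) \<le> A * (s powr ((1 - b) - 1) * exp_decay e s)" for s
    using mult_left_mono[OF bound[of s], of "exp (- e * s)"] zero[of s] A
    by (cases "0 < s") (auto simp: exp_decay_def mult_ac split: split_indicator)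
  have "(\<integral>\<^sup>+ s. ennreal (exp (- e * s) * norm (v s)) \<partial>lborel)
     \<le> (\<integral>\<^sup>+ s. ennreal A * ennreal (s powr ((1 - b) - 1) * exp_decay e s) \<partial>lborel)"
    using weighted_norm_le A by (intro nn_integral_mono) (simp add: ennreal_mult'[symmetric] ennreal_leI)
  also have "\<dots> = ennreal A * ennreal (Gamma (1 - b) / e powr (1 - b))"
    using b e nn_integral_powr_exp_decay[of "1 - b" e] by (simp add: nn_integral_cmult)
  also have "\<dots> < \<infinity>" by (simp add: ennreal_mult_less_top)
  finally show "(\<integral>\<^sup>+ s. ennreal (exp (- e * s) * norm (v s)) \<partial>lborel) < \<infinity>" .
qed (use zero in auto)

lemma norm_laplace_le:
  assumes l: "0 < l" and v: "\<And>s. s < 0 \<Longrightarrow> v s = 0" "\<And>s. 0 \<le> s \<Longrightarrow> norm (v s) \<le> A"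
  shows "norm (laplace v l) \<le> A / l"
proof -
  have "norm (laplace v l) \<le> (\<integral>s. A * exp_decay l s \<partial>lborel)"
    unfolding laplace_def
  proof (rule norm_integral_le)
    show "integrable lborel (\<lambda>s. A * exp_decay l s)"
      using has_bochner_integral_exp_decay[OF l] by (auto simp: has_bochner_integral_iff)
    show "norm (exp (- l * s) *\<^sub>R v s) \<le> A * exp_decay l s" for s
      using v[of s] by (cases "s < 0") (auto simp: exp_decay_def mult.commute)
  qed
  also have "\<dots> = A / l" using has_bochner_integral_exp_decay[OF l] by (simp add: has_bochner_integral_iff)
  finally show ?thesis .
qed

lemma nn_integral_laplace:
  assumes v: "laplace_class v" and nonneg: "\<And>s. 0 \<le> v s" and l: "0 < l"
  shows "(\<integral>\<^sup>+ s. ennreal (exp (- l * s) * v s) \<partial>lborel) = ennreal (laplace v l)"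
  using nn_integral_eq_integral[OF laplace_class_integrable[OF v l]] nonneg by (simp add: laplace_def)

lemma laplace_eqI:
  assumes "v \<in> borel_measurable borel" "\<And>s. 0 \<le> v s" "0 \<le> c"
    and "(\<integral>\<^sup>+ s. ennreal (exp (- l * s) * v s) \<partial>lborel) = ennreal c"
  shows "laplace v l = c"
  using assms by (simp add: laplace_def integral_eq_nn_integral)

lemma laplace_antimono:
  fixes v :: "real \<Rightarrow> real"
  assumes v: "laplace_class v" and nonneg: "\<And>s. 0 \<le> v s" and lm: "0 < l" "l \<le> m"
  shows "laplace v m \<le> laplace v l"
  unfolding laplace_def
proof (intro integral_mono laplace_class_integrable v)
  fix s show "exp (- m * s) *\<^sub>R v s \<le> exp (- l * s) *\<^sub>R v s"
    using lm nonneg[of s] laplace_class_nonpos[OF v, of s] by (cases "0 < s") (auto intro: mult_right_mono)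
qed (use lm in auto)

lemma laplace_class_ident:
  assumes v [measurable]: "laplace_class v"
  shows "laplace_class (\<lambda>s. s *\<^sub>R v s)"
  unfolding laplace_class_def
proof (intro conjI allI impI)
  fix e :: real assume e: "0 < e"
  have weighted_norm_le: "exp (- e * s) * norm (s *\<^sub>R v s) \<le> 2 / e * (exp (- (e / 2) * s) * norm (v s))" for s
  proof (cases "0 < s")
    case True
    have "(e / 2) * s \<le> exp ((e / 2) * s)" using exp_ge_add_one_self[of "(e / 2) * s"] by linarith
    then have "exp (- e * s) * s \<le> exp (- e * s) * (2 / e * exp ((e / 2) * s))"
      using e by (intro mult_left_mono) (auto simp: field_simps)
    also have "\<dots> = 2 / e * exp (- (e / 2) * s)" by (simp add: exp_add[symmetric])
    finally have "exp (- e * s) * s * norm (v s) \<le> 2 / e * exp (- (e / 2) * s) * norm (v s)"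
      by (intro mult_right_mono) auto
    then show ?thesis using True by (simp add: mult.assoc)
  qed (use v in \<open>simp add: laplace_class_nonpos\<close>)
  have "(\<integral>\<^sup>+ s. ennreal (exp (- e * s) * norm (s *\<^sub>R v s)) \<partial>lborel)
     \<le> (\<integral>\<^sup>+ s. ennreal (2 / e) * ennreal (exp (- (e / 2) * s) * norm (v s)) \<partial>lborel)"
    using weighted_norm_le e by (intro nn_integral_mono) (simp add: ennreal_mult'[symmetric] ennreal_leI)
  also have "\<dots> < \<infinity>"
    using laplace_class_finite[OF v, of "e / 2"] e by (simp add: nn_integral_cmult ennreal_mult_less_top)
  finally show "(\<integral>\<^sup>+ s. ennreal (exp (- e * s) * norm (s *\<^sub>R v s)) \<partial>lborel) < \<infinity>" .
qed (use v in \<open>auto simp: laplace_class_nonpos\<close>)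

lemma laplace_class_power: "laplace_class v \<Longrightarrow> laplace_class (\<lambda>s. s ^ k *\<^sub>R v s)"
proof (induction k)
  case (Suc k)
  then show ?case using laplace_class_ident[of "\<lambda>s. s ^ k *\<^sub>R v s"] by simp
qed simp

lemma has_vector_derivative_laplace:
  assumes v [measurable]: "laplace_class v" and l: "0 < l"
  shows "(laplace v has_vector_derivative - laplace (\<lambda>s. s *\<^sub>R v s) l) (at l)"
proof -
  have "((\<lambda>r. \<integral>s. exp (- r * s) *\<^sub>R v s \<partial>lborel) has_vector_derivative (\<integral>s. - (exp (- l * s) *\<^sub>R s *\<^sub>R v s) \<partial>lborel))
       (at l)"
  proof (rule has_vector_derivative_integral_dominated[where e = "l / 2"
    and f' = "\<lambda>r s. - (exp (- r * s) *\<^sub>R s *\<^sub>R v s)"])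
    show "integrable lborel (\<lambda>s. exp (- r * s) *\<^sub>R v s)" if "\<bar>r - l\<bar> < l / 2" for r
      using that l by (intro laplace_class_integrable v) (auto simp: abs_if split: if_splits)
    show "((\<lambda>r. exp (- r * s) *\<^sub>R v s) has_vector_derivative - (exp (- r * s) *\<^sub>R s *\<^sub>R v s)) (at r)" for r s
    proof -
      have "((\<lambda>r. exp (- r * s)) has_real_derivative - (exp (- r * s) * s)) (at r)"
        by (auto intro!: derivative_eq_intros)
      from has_vector_derivative_scaleR[OF this has_vector_derivative_const[of "v s"]] show ?thesis by simp
    qed
    show "integrable lborel (\<lambda>s. norm (exp (- (l / 2) * s) *\<^sub>R s *\<^sub>R v s))"
      using l by (intro integrable_norm laplace_class_integrable laplace_class_ident v) auto
    fix r s :: real assume r: "\<bar>r - l\<bar> < l / 2"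
    show "norm (- (exp (- r * s) *\<^sub>R s *\<^sub>R v s)) \<le> norm (exp (- (l / 2) * s) *\<^sub>R s *\<^sub>R v s)"
    proof (cases "0 < s")
      case True
      then have "(l / 2) * s \<le> r * s" using r by (intro mult_right_mono) (auto simp: abs_if split: if_splits)
      then show ?thesis using True by (simp add: abs_mult mult_right_mono)
    qed (use v in \<open>simp add: laplace_class_nonpos\<close>)
  qed (use l in simp_all)
  then show ?thesis unfolding laplace_def[abs_def] by simp
qed

lemma isCont_laplace: "laplace_class v \<Longrightarrow> 0 < l \<Longrightarrow> isCont (laplace v) l"
  by (rule has_vector_derivative_continuous[OF has_vector_derivative_laplace])

lemma laplace_eq_0:
  assumes v: "laplace_class v" and X: "finite X" and zero: "\<And>l. 0 < l \<Longrightarrow> l \<notin> X \<Longrightarrow> laplace v l = 0" and l: "0 < l"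
  shows "laplace v l = 0"
proof -
  have "open ({0<..} - (X - {l}))" using X by (intro open_Diff finite_imp_closed) auto
  then have "\<forall>\<^sub>F r in at l. laplace v r = 0"
    using eventually_at_in_open[of "{0<..} - (X - {l})" l] l by (auto elim!: eventually_mono intro: zero)
  then have "(laplace v \<longlongrightarrow> 0) (at l)" by (rule tendsto_eventually)
  with isCont_laplace[OF v l] show ?thesis
    unfolding isCont_def by (rule tendsto_unique[OF trivial_limit_at])
qed

lemma laplace_power_eq_0:
  assumes v: "laplace_class v" and zero: "\<And>l. 0 < l \<Longrightarrow> laplace v l = 0" and l: "0 < l"
  shows "laplace (\<lambda>s. s ^ k *\<^sub>R v s) l = 0"
  using l
proof (induction k arbitrary: l)
  case (Suc k)
  have "(laplace (\<lambda>s. s ^ k *\<^sub>R v s) has_vector_derivative - laplace (\<lambda>s. s *\<^sub>R s ^ k *\<^sub>R v s) l) (at l)"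
    using Suc.prems by (intro has_vector_derivative_laplace laplace_class_power v)
  moreover have "(laplace (\<lambda>s. s ^ k *\<^sub>R v s) has_vector_derivative 0) (at l)"
    by (rule has_vector_derivative_transform_within_open[OF has_vector_derivative_const[of 0], where S = "{0<..}"])
      (use Suc in auto)
  ultimately have "- laplace (\<lambda>s. s *\<^sub>R s ^ k *\<^sub>R v s) l = 0" by (rule vector_derivative_unique_at)
  then show ?case by simp
qed (simp add: zero)

lemma erlang_density_scaleR:
  assumes "laplace_class v"
  shows "erlang_density k m s *\<^sub>R v s = (m ^ Suc k / fact k) *\<^sub>R exp (- m * s) *\<^sub>R s ^ k *\<^sub>R v s"
  using assms by (cases "s < 0") (auto simp: erlang_density_def laplace_class_nonpos)

lemma integrable_erlang_density_scaleR:
  assumes "laplace_class v" "0 < m"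
  shows "integrable lborel (\<lambda>s. erlang_density k m s *\<^sub>R v s)"
  unfolding erlang_density_scaleR[OF assms(1)]
  by (intro integrable_scaleR_right impI laplace_class_integrable laplace_class_power assms)

lemma integral_erlang_density_scaleR:
  assumes "laplace_class v"
  shows "(\<integral>s. erlang_density k m s *\<^sub>R v s \<partial>lborel) = (m ^ Suc k / fact k) *\<^sub>R laplace (\<lambda>s. s ^ k *\<^sub>R v s) m"
  unfolding erlang_density_scaleR[OF assms] laplace_def by (rule integral_scaleR_right)

lemma integral_erlang_density_eq_if_laplace_eq:
  assumes v: "laplace_class v" and w: "laplace_class w" and "finite X"
    and eq: "\<And>l. 0 < l \<Longrightarrow> l \<notin> X \<Longrightarrow> laplace v l = laplace w l" and m: "0 < m"
  shows "(\<integral>s. erlang_density k m s *\<^sub>R v s \<partial>lborel) = (\<integral>s. erlang_density k m s *\<^sub>R w s \<partial>lborel)"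
proof -
  define u where "u s = v s - w s" for s
  have u: "laplace_class u" unfolding u_def by (rule laplace_class_diff[OF v w])
  have "laplace u l = 0" if "0 < l" for l
    by (rule laplace_eq_0[OF u \<open>finite X\<close> _ that]) (simp add: u_def[abs_def] laplace_diff v w eq)
  then have "(\<integral>s. erlang_density k m s *\<^sub>R u s \<partial>lborel) = 0"
    using laplace_power_eq_0[OF u _ m] by (simp add: integral_erlang_density_scaleR[OF u])
  then show ?thesis
    using integrable_erlang_density_scaleR[OF v m] integrable_erlang_density_scaleR[OF w m]
    by (simp add: u_def scaleR_diff_right)
qed

lemma convolve_eq_0_nonpos:
  assumes "s \<le> 0" "\<And>r. r \<le> 0 \<Longrightarrow> v r = 0" "\<And>r. r \<le> 0 \<Longrightarrow> w r = 0"
  shows "convolve v w (s::real) = 0"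
proof -
  have "v (s - r) *\<^sub>R w r = 0" for r using assms by (cases "r \<le> 0") auto
  then show ?thesis unfolding convolve_def by (simp only: Bochner_Integration.integral_zero)
qed

lemma
  fixes k :: "real \<Rightarrow> real" and v :: "real \<Rightarrow> 'b::{banach, second_countable_topology}"
  assumes k [measurable]: "laplace_class k" and v [measurable]: "laplace_class v"
  shows laplace_class_convolve: "laplace_class (convolve k v)"
    and laplace_convolve: "0 < l \<Longrightarrow> laplace (convolve k v) l = laplace k l *\<^sub>R laplace v l"
proof -
  have weight: "exp (- l * s) *\<^sub>R convolve k v s
       = convolve (\<lambda>s. exp (- l * s) *\<^sub>R k s) (\<lambda>s. exp (- l * s) *\<^sub>R v s) s" for l s
  proof -
    have "exp (- l * s) *\<^sub>R k (s - r) *\<^sub>R v r = (exp (- l * (s - r)) *\<^sub>R k (s - r)) *\<^sub>R exp (- l * r) *\<^sub>R v r" for r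
      by (simp add: mult_ac exp_add[symmetric] algebra_simps)
    then show ?thesis unfolding convolve_def integral_scaleR_right[symmetric]
      by (rule Bochner_Integration.integral_cong[OF refl])
  qed
  note int = laplace_class_integrable[OF k] laplace_class_integrable[OF v]
  show "laplace_class (convolve k v)"
  proof (rule laplace_class_integrableI)
    show "convolve k v s = 0" if "s \<le> 0" for s
      using that k v by (intro convolve_eq_0_nonpos) (simp_all add: laplace_class_nonpos)
    show "integrable lborel (\<lambda>s. exp (- l * s) *\<^sub>R convolve k v s)" if "0 < l" for l
      unfolding weight using that by (intro integrable_convolve int)
  qed measurable
  assume "0 < l"
  then show "laplace (convolve k v) l = laplace k l *\<^sub>R laplace v l"
    unfolding laplace_def weight by (intro integral_convolve int)
qed

section \<open>The resolvent of the translation semigroup\<close>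

lemma nn_integral_shift_pairing:
  fixes F G V :: "'a::euclidean_space \<Rightarrow> ennreal"
  assumes [measurable]: "F \<in> borel_measurable borel" "G \<in> borel_measurable borel" "V \<in> borel_measurable borel"
  shows "(\<integral>\<^sup>+ s. F s * (\<integral>\<^sup>+ r. G r * V (s + r) \<partial>lborel) \<partial>lborel)
       = (\<integral>\<^sup>+ x. (\<integral>\<^sup>+ s. F s * G (x - s) \<partial>lborel) * V x \<partial>lborel)"
proof -
  have "F s * (\<integral>\<^sup>+ r. G r * V (s + r) \<partial>lborel) = (\<integral>\<^sup>+ x. F s * G (x - s) * V x \<partial>lborel)" for s
  proof -
    have "(\<integral>\<^sup>+ x. F s * G (x - s) * V x \<partial>lborel) = (\<integral>\<^sup>+ r. F s * G (s + r - s) * V (s + r) \<partial>lborel)"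
      by (rule nn_integral_lborel_shift[symmetric]) measurable
    then show ?thesis by (simp add: mult.assoc nn_integral_cmult)
  qed
  then have "(\<integral>\<^sup>+ s. F s * (\<integral>\<^sup>+ r. G r * V (s + r) \<partial>lborel) \<partial>lborel)
      = (\<integral>\<^sup>+ s. \<integral>\<^sup>+ x. F s * G (x - s) * V x \<partial>lborel \<partial>lborel)"
    by simp
  also have "\<dots> = (\<integral>\<^sup>+ x. \<integral>\<^sup>+ s. F s * G (x - s) * V x \<partial>lborel \<partial>lborel)"
    by (rule lborel_Tonelli) measurable
  finally show ?thesis by (simp add: nn_integral_multc)
qed

lemma integral_shift_pairing:
  fixes F G K :: "'a::euclidean_space \<Rightarrow> real" and v :: "'a \<Rightarrow> 'b::{banach, second_countable_topology}"
  assumes [measurable]: "F \<in> borel_measurable borel" "G \<in> borel_measurable borel" "v \<in> borel_measurable borel"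
    and nonneg: "\<And>s. 0 \<le> F s" "\<And>s. 0 \<le> G s" "\<And>x. 0 \<le> K x"
    and K: "\<And>x. (\<integral>\<^sup>+ s. ennreal (F s * G (x - s)) \<partial>lborel) = ennreal (K x)"
    and int: "integrable lborel (\<lambda>x. K x *\<^sub>R v x)"
  shows "integrable lborel (\<lambda>s. F s *\<^sub>R (\<integral>r. G r *\<^sub>R v (s + r) \<partial>lborel))"
    and "(\<integral>s. F s *\<^sub>R (\<integral>r. G r *\<^sub>R v (s + r) \<partial>lborel) \<partial>lborel) = (\<integral>x. K x *\<^sub>R v x \<partial>lborel)"
proof -
  define f where "f s x = (F s * G (x - s)) *\<^sub>R v x" for s x
  have [measurable]: "case_prod f \<in> borel_measurable (lborel \<Otimes>\<^sub>M lborel)" unfolding f_def by measurable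
  have over_s: "(\<integral>\<^sup>+ s. ennreal (norm (f s x)) \<partial>lborel) = ennreal (norm (K x *\<^sub>R v x))" for x
    using nonneg K[of x] by (simp add: f_def ennreal_mult' nn_integral_multc)
  have fin: "(\<integral>\<^sup>+ s. \<integral>\<^sup>+ x. ennreal (norm (f s x)) \<partial>lborel \<partial>lborel) < \<infinity>"
    using int by (subst lborel_Tonelli) (simp_all add: over_s integrable_iff_bounded del: norm_scaleR)
  have over_x: "(\<integral>x. f s x \<partial>lborel) = F s *\<^sub>R (\<integral>r. G r *\<^sub>R v (s + r) \<partial>lborel)" for s
  proof -
    have "(\<integral>x. f s x \<partial>lborel) = (\<integral>r. f s (s + r) \<partial>lborel)"
      by (rule integral_lborel_shift[symmetric]) (simp add: f_def)
    also have "\<dots> = (\<integral>r. F s *\<^sub>R G r *\<^sub>R v (s + r) \<partial>lborel)" by (simp add: f_def)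
    also have "\<dots> = F s *\<^sub>R (\<integral>r. G r *\<^sub>R v (s + r) \<partial>lborel)" by (rule integral_scaleR_right)
    finally show ?thesis .
  qed
  show "integrable lborel (\<lambda>s. F s *\<^sub>R (\<integral>r. G r *\<^sub>R v (s + r) \<partial>lborel))"
    unfolding over_x[symmetric] using fin by (intro lborel_Fubini(2)) auto
  have "(\<integral>s. F s *\<^sub>R (\<integral>r. G r *\<^sub>R v (s + r) \<partial>lborel) \<partial>lborel) = (\<integral>x. \<integral>s. f s x \<partial>lborel \<partial>lborel)"
    unfolding over_x[symmetric] using fin by (intro lborel_Fubini(1)) auto
  also have "\<dots> = (\<integral>x. K x *\<^sub>R v x \<partial>lborel)"
  proof (intro Bochner_Integration.integral_cong refl)
    fix x
    have "integrable lborel (\<lambda>s. F s * G (x - s))" using nonneg K[of x] by (intro integrableI_nonneg) auto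
    moreover have "(\<integral>s. F s * G (x - s) \<partial>lborel) = K x" using nonneg K[of x] by (simp add: integral_eq_nn_integral)
    ultimately show "(\<integral>s. f s x \<partial>lborel) = K x *\<^sub>R v x" by (simp add: f_def)
  qed
  finally show "(\<integral>s. F s *\<^sub>R (\<integral>r. G r *\<^sub>R v (s + r) \<partial>lborel) \<partial>lborel) = (\<integral>x. K x *\<^sub>R v x \<partial>lborel)" .
qed

definition shift_resolvent :: "real \<Rightarrow> (real \<Rightarrow> 'b::{banach, second_countable_topology}) \<Rightarrow> real \<Rightarrow> 'b" where
  "shift_resolvent m v s = (if 0 < s then \<integral>r. exp_decay m r *\<^sub>R v (s + r) \<partial>lborel else 0)"

lemma shift_resolvent_nonpos [simp]: "s \<le> 0 \<Longrightarrow> shift_resolvent m v s = 0"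
  by (simp add: shift_resolvent_def)

lemma shift_resolvent_measurable [measurable]:
  assumes [measurable]: "v \<in> borel_measurable borel"
  shows "shift_resolvent m v \<in> borel_measurable borel"
proof -
  have [measurable]: "(\<lambda>s. \<integral>r. exp_decay m r *\<^sub>R v (s + r) \<partial>lborel) \<in> borel_measurable borel"
    by (rule lborel.borel_measurable_lebesgue_integral) measurable
  show ?thesis unfolding shift_resolvent_def[abs_def] by measurable
qed

lemma integral_shift_resolvent:
  assumes [measurable]: "F \<in> borel_measurable borel" "v \<in> borel_measurable borel"
    and F: "\<And>s. 0 \<le> F s" "\<And>s. s < 0 \<Longrightarrow> F s = 0" and K: "\<And>x. 0 \<le> K x"
      "\<And>x. (\<integral>\<^sup>+ s. ennreal (F s * exp_decay m (x - s)) \<partial>lborel) = ennreal (K x)"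
    and int: "integrable lborel (\<lambda>x. K x *\<^sub>R v x)"
  shows "integrable lborel (\<lambda>s. F s *\<^sub>R shift_resolvent m v s)"
    and "(\<integral>s. F s *\<^sub>R shift_resolvent m v s \<partial>lborel) = (\<integral>x. K x *\<^sub>R v x \<partial>lborel)"
proof -
  note pairing = integral_shift_pairing[OF _ _ _ F(1) exp_decay_nonneg K int]
  have shift_AE: "AE s in lborel. F s *\<^sub>R (\<integral>r. exp_decay m r *\<^sub>R v (s + r) \<partial>lborel) = F s *\<^sub>R shift_resolvent m v s"
    using AE_lborel_singleton[of 0] by eventually_elim (auto simp: shift_resolvent_def F(2))
  show "integrable lborel (\<lambda>s. F s *\<^sub>R shift_resolvent m v s)"
    by (rule integrable_cong_AE_imp[OF pairing(1)]) (use shift_AE in \<open>auto elim: eventually_mono\<close>)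
  have "(\<integral>s. F s *\<^sub>R shift_resolvent m v s \<partial>lborel) = (\<integral>s. F s *\<^sub>R (\<integral>r. exp_decay m r *\<^sub>R v (s + r) \<partial>lborel) \<partial>lborel)"
    using shift_AE by (intro integral_cong_AE)
      (auto intro!: borel_measurable_scaleR lborel.borel_measurable_lebesgue_integral)
  also have "\<dots> = (\<integral>x. K x *\<^sub>R v x \<partial>lborel)" by (rule pairing(2)) measurable
  finally show "(\<integral>s. F s *\<^sub>R shift_resolvent m v s \<partial>lborel) = (\<integral>x. K x *\<^sub>R v x \<partial>lborel)" .
qed

definition exp_diff_kernel :: "real \<Rightarrow> real \<Rightarrow> real \<Rightarrow> real" where
  "exp_diff_kernel l m x = indicator {0..} x * ((exp (- l * x) - exp (- m * x)) / (m - l))"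

lemma exp_diff_kernel_nonneg [simp]: "0 \<le> exp_diff_kernel l m x"
  by (cases "l \<le> m") (auto simp: exp_diff_kernel_def zero_le_divide_iff mult_right_mono split: split_indicator)

lemma exp_diff_kernel_measurable [measurable]: "exp_diff_kernel l m \<in> borel_measurable borel"
  unfolding exp_diff_kernel_def[abs_def] by measurable

lemma exp_diff_kernel_commute: "exp_diff_kernel l m = exp_diff_kernel m l"
proof
  have "(a - b) / (m - l) = (b - a) / (l - m)" for a b :: real
    by (metis minus_diff_eq minus_divide_divide)
  then show "exp_diff_kernel l m x = exp_diff_kernel m l x" for x
    by (simp add: exp_diff_kernel_def)
qed

lemma nn_integral_exp_decay_convolution:
  assumes "l \<noteq> m"
  shows "(\<integral>\<^sup>+ s. ennreal (exp_decay l s * exp_decay m (x - s)) \<partial>lborel) = ennreal (exp_diff_kernel l m x)"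
proof (cases "0 \<le> x")
  case True
  have "(\<integral>\<^sup>+ s. ennreal (exp_decay l s * exp_decay m (x - s)) \<partial>lborel)
      = (\<integral>\<^sup>+ s. ennreal (exp (- m * x) * exp ((m - l) * s)) * indicator {0..x} s \<partial>lborel)"
    by (intro nn_integral_cong) (auto split: split_indicator simp: exp_decay_def exp_add[symmetric] algebra_simps)
  also have "\<dots> = ennreal (exp (- m * x) * exp ((m - l) * x) / (m - l) - exp (- m * x) * exp ((m - l) * 0) / (m - l))"
    using True assms by (intro nn_integral_FTC_Icc) (auto intro!: derivative_eq_intros)
  also have "exp (- m * x) * exp ((m - l) * x) / (m - l) - exp (- m * x) * exp ((m - l) * 0) / (m - l)
       = exp_diff_kernel l m x"
    using True by (simp add: exp_diff_kernel_def exp_add[symmetric] diff_divide_distrib[symmetric] algebra_simps)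
  finally show ?thesis .
next
  case False
  then have "exp_decay l s * exp_decay m (x - s) = 0" for s by (auto simp: exp_decay_def split: split_indicator)
  then show ?thesis using False unfolding exp_diff_kernel_def by (simp only: ennreal_0 nn_integral_const) simp
qed

lemma exp_diff_kernel_scaleR:
  assumes "laplace_class v"
  shows "exp_diff_kernel l m x *\<^sub>R v x = (exp (- l * x) *\<^sub>R v x - exp (- m * x) *\<^sub>R v x) /\<^sub>R (m - l)"
  using assms by (cases "0 < x")
    (auto simp: exp_diff_kernel_def laplace_class_nonpos divide_inverse_commute
      right_diff_distrib scaleR_diff_left scaleR_diff_right)

lemma
  assumes v [measurable]: "laplace_class v" and m: "0 < m"
  shows laplace_class_shift_resolvent: "laplace_class (shift_resolvent m v)"
    and laplace_shift_resolvent: "0 < l \<Longrightarrow> l \<noteq> m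
        \<Longrightarrow> laplace (shift_resolvent m v) l = (laplace v l - laplace v m) /\<^sub>R (m - l)"
proof -
  have decay: "exp (- l * s) *\<^sub>R shift_resolvent m v s = exp_decay l s *\<^sub>R shift_resolvent m v s" for l s
    by (cases "0 < s") (auto simp: exp_decay_def)
  have int: "integrable lborel (\<lambda>x. exp_diff_kernel l m x *\<^sub>R v x)" if "0 < l" for l
    unfolding exp_diff_kernel_scaleR[OF v] using laplace_class_integrable[OF v that] laplace_class_integrable[OF v m]
    by (intro integrable_scaleR_right impI Bochner_Integration.integrable_diff)
  have pairing: "integrable lborel (\<lambda>s. exp (- l * s) *\<^sub>R shift_resolvent m v s)"
    "laplace (shift_resolvent m v) l = (\<integral>x. exp_diff_kernel l m x *\<^sub>R v x \<partial>lborel)" if "0 < l" "l \<noteq> m" for l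
    unfolding laplace_def decay
    using that integral_shift_resolvent[of "exp_decay l" v "exp_diff_kernel l m" m]
    by (simp_all add: nn_integral_exp_decay_convolution int)
  show "laplace_class (shift_resolvent m v)"
  proof (rule laplace_class_integrableI)
    show "integrable lborel (\<lambda>s. exp (- e * s) *\<^sub>R shift_resolvent m v s)" if "0 < e" for e
    proof (rule Bochner_Integration.integrable_bound[OF pairing(1)[of "min e m / 2"]])
      show "AE s in lborel. norm (exp (- e * s) *\<^sub>R shift_resolvent m v s)
           \<le> norm (exp (- (min e m / 2) * s) *\<^sub>R shift_resolvent m v s)"
      proof (rule AE_I2)
        fix s
        have "min e m / 2 * s \<le> e * s" if "0 < s" using that \<open>0 < e\<close> m by (intro mult_right_mono) auto
        then show "norm (exp (- e * s) *\<^sub>R shift_resolvent m v s)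
            \<le> norm (exp (- (min e m / 2) * s) *\<^sub>R shift_resolvent m v s)"
          by (cases "0 < s") (auto intro: mult_right_mono)
      qed
    qed (use that m in \<open>auto simp: min_def\<close>)
  qed auto
  assume l: "0 < l" "l \<noteq> m"
  have "laplace (shift_resolvent m v) l = (\<integral>x. exp_diff_kernel l m x *\<^sub>R v x \<partial>lborel)" by (rule pairing(2)[OF l])
  also have "\<dots> = (laplace v l - laplace v m) /\<^sub>R (m - l)"
    unfolding exp_diff_kernel_scaleR[OF v] integral_scaleR_right laplace_def
    using laplace_class_integrable[OF v l(1)] laplace_class_integrable[OF v m] by (simp add: integral_diff)
  finally show "laplace (shift_resolvent m v) l = (laplace v l - laplace v m) /\<^sub>R (m - l)" .
qed

lemma integral_erlang_density_shift_resolvent: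
  assumes v [measurable]: "laplace_class v" and m: "0 < m"
  shows "m *\<^sub>R (\<integral>s. erlang_density k m s *\<^sub>R shift_resolvent m v s \<partial>lborel)
       = (\<integral>s. erlang_density (Suc k) m s *\<^sub>R v s \<partial>lborel)"
proof -
  have exp_decay_convolution: "(\<integral>\<^sup>+ s. ennreal (erlang_density k m s * exp_decay m (x - s)) \<partial>lborel)
       = ennreal (erlang_density (Suc k) m x / m)" for x
  proof -
    have "ennreal m * (\<integral>\<^sup>+ s. ennreal (erlang_density k m s * exp_decay m (x - s)) \<partial>lborel)
      = (\<integral>\<^sup>+ s. ennreal (erlang_density 0 m (x - s)) * ennreal (erlang_density k m s) \<partial>lborel)"
      using m by (simp add: nn_integral_cmult[symmetric] erlang_density_0 ennreal_mult'[symmetric] mult_ac)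
    also have "\<dots> = ennreal (erlang_density (Suc k) m x)"
      using fun_cong[OF convolution_erlang_density[OF m, of 0 k], of x] by simp
    finally have "ennreal (1 / m) * (ennreal m * (\<integral>\<^sup>+ s. ennreal (erlang_density k m s * exp_decay m (x - s)) \<partial>lborel))
      = ennreal (1 / m) * ennreal (erlang_density (Suc k) m x)" by simp
    then show ?thesis using m by (simp add: mult.assoc[symmetric] ennreal_mult'[symmetric])
  qed
  have scaled: "(erlang_density (Suc k) m x / m) *\<^sub>R v x = (1 / m) *\<^sub>R erlang_density (Suc k) m x *\<^sub>R v x" for x by simp
  have "integrable lborel (\<lambda>x. (erlang_density (Suc k) m x / m) *\<^sub>R v x)"
    unfolding scaled using integrable_erlang_density_scaleR[OF v m] by (intro integrable_scaleR_right)
  then have "(\<integral>s. erlang_density k m s *\<^sub>R shift_resolvent m v s \<partial>lborel)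
      = (\<integral>x. (erlang_density (Suc k) m x / m) *\<^sub>R v x \<partial>lborel)"
    using m exp_decay_convolution by (intro integral_shift_resolvent) (auto simp: erlang_density_def)
  also have "\<dots> = (1 / m) *\<^sub>R (\<integral>x. erlang_density (Suc k) m x *\<^sub>R v x \<partial>lborel)"
    unfolding scaled by (rule integral_scaleR_right)
  finally show ?thesis using m by simp
qed

section \<open>The Stieltjes representation of the inverse logarithm\<close>

lemma nn_integral_indicator_LIMSEQ:
  assumes "range A \<subseteq> sets M" "incseq A" "f \<in> borel_measurable M"
  shows "(\<lambda>n. \<integral>\<^sup>+ x. f x * indicator (A n) x \<partial>M) \<longlonglongrightarrow> (\<integral>\<^sup>+ x. f x * indicator (\<Union>n. A n) x \<partial>M)"
proof -
  have "emeasure (density M f) B = (\<integral>\<^sup>+ x. f x * indicator B x \<partial>M)" if "B \<in> sets M" for B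
    using that assms by (intro emeasure_density)
  moreover have "(\<Union>n. A n) \<in> sets M" "A n \<in> sets M" for n using assms by auto
  ultimately show ?thesis
    using Lim_emeasure_incseq[of A "density M f"] assms by simp
qed

lemma nn_integral_exp_substitution:
  fixes f :: "real \<Rightarrow> real"
  assumes [measurable]: "f \<in> borel_measurable borel" and c: "0 < c"
  shows "(\<integral>\<^sup>+ t. ennreal (f t) * indicator {0<..} t \<partial>lborel) = (\<integral>\<^sup>+ s. ennreal (f (c * exp s) * (c * exp s)) \<partial>lborel)"
proof (rule LIMSEQ_unique)
  let ?T = "\<lambda>n::nat. {c * exp (- real n) .. c * exp (real n)}" and ?S = "\<lambda>n::nat. {- real n .. real n}"
  have union_T: "(\<Union>n. ?T n) = {0<..}"
  proof (intro equalityI subsetI)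
    fix t :: real assume t: "t \<in> {0<..}"
    obtain n :: nat where "\<bar>ln (t / c)\<bar> \<le> real n" using real_arch_simple by blast
    then have "exp (- real n) \<le> exp (ln (t / c))" "exp (ln (t / c)) \<le> exp (real n)" by auto
    moreover have "exp (ln (t / c)) = t / c" using t c by simp
    ultimately have "exp (- real n) \<le> t / c" "t / c \<le> exp (real n)" by simp_all
    then have "t \<in> ?T n" using c by (simp add: field_simps)
    then show "t \<in> (\<Union>n. ?T n)" by blast
  qed (use c in \<open>auto intro: less_le_trans[rotated] mult_pos_pos\<close>)
  have union_S: "(\<Union>n. ?S n) = UNIV"
  proof (intro equalityI subsetI)
    fix s :: real
    obtain n :: nat where "\<bar>s\<bar> \<le> real n" using real_arch_simple by blast
    then have "s \<in> ?S n" by (simp add: abs_le_iff)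
    then show "s \<in> (\<Union>n. ?S n)" by blast
  qed auto
  have substitution_on: "(\<integral>\<^sup>+ t. ennreal (f t) * indicator (?T n) t \<partial>lborel)
       = (\<integral>\<^sup>+ s. ennreal (f (c * exp s) * (c * exp s)) * indicator (?S n) s \<partial>lborel)" for n
  proof -
    have "(\<integral>\<^sup>+ t. ennreal (f t * indicator (?T n) t) \<partial>lborel)
         = (\<integral>\<^sup>+ s. ennreal (f (c * exp s) * (c * exp s) * indicator (?S n) s) \<partial>lborel)"
      using c by (intro nn_integral_substitution)
        (auto intro!: derivative_eq_intros continuous_intros simp: set_borel_measurable_def)
    then show ?thesis by (simp add: ennreal_mult'' ennreal_indicator)
  qed
  show "(\<lambda>n. \<integral>\<^sup>+ t. ennreal (f t) * indicator (?T n) t \<partial>lborel) \<longlonglongrightarrow> (\<integral>\<^sup>+ t. ennreal (f t) * indicator {0<..} t \<partial>lborel)"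
    unfolding union_T[symmetric]
  proof (rule nn_integral_indicator_LIMSEQ)
    show "incseq ?T" using c by (intro incseq_SucI) (simp add: mult_le_cancel_left_pos)
    show "range ?T \<subseteq> sets lborel" "(\<lambda>t. ennreal (f t)) \<in> borel_measurable lborel" by auto
  qed
  show "(\<lambda>n. \<integral>\<^sup>+ t. ennreal (f t) * indicator (?T n) t \<partial>lborel)
      \<longlonglongrightarrow> (\<integral>\<^sup>+ s. ennreal (f (c * exp s) * (c * exp s)) \<partial>lborel)"
    using nn_integral_indicator_LIMSEQ[of ?S lborel "\<lambda>s. ennreal (f (c * exp s) * (c * exp s))"]
    unfolding substitution_on union_S by (simp add: incseq_def image_subset_iff)
qed

lemma nn_integral_iterated_laplace:
  fixes w :: "real \<Rightarrow> ennreal"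
  assumes [measurable]: "w \<in> borel_measurable borel" and w: "\<And>s. s \<le> 0 \<Longrightarrow> w s = 0" and l: "0 \<le> l"
  shows "(\<integral>\<^sup>+ t. ennreal (exp_decay l t) * (\<integral>\<^sup>+ s. ennreal (exp (- t * s)) * w s \<partial>lborel) \<partial>lborel)
     = (\<integral>\<^sup>+ s. ennreal (1 / (l + s)) * w s \<partial>lborel)"
proof -
  have "(\<integral>\<^sup>+ t. ennreal (exp_decay l t) * (\<integral>\<^sup>+ s. ennreal (exp (- t * s)) * w s \<partial>lborel) \<partial>lborel)
     = (\<integral>\<^sup>+ t. \<integral>\<^sup>+ s. ennreal (exp_decay l t) * (ennreal (exp (- t * s)) * w s) \<partial>lborel \<partial>lborel)"
    by (intro nn_integral_cong nn_integral_cmult[symmetric]) measurable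
  also have "\<dots> = (\<integral>\<^sup>+ s. \<integral>\<^sup>+ t. ennreal (exp_decay l t) * (ennreal (exp (- t * s)) * w s) \<partial>lborel \<partial>lborel)"
    by (rule lborel_Tonelli) measurable
  also have "\<dots> = (\<integral>\<^sup>+ s. ennreal (1 / (l + s)) * w s \<partial>lborel)"
  proof (intro nn_integral_cong)
    fix s
    have "exp_decay l t * exp (- t * s) = exp_decay (l + s) t" for t
      by (simp add: exp_decay_def exp_add[symmetric] algebra_simps)
    then have "ennreal (exp_decay l t) * (ennreal (exp (- t * s)) * w s) = ennreal (exp_decay (l + s) t) * w s" for t
      by (simp only: mult.assoc[symmetric] ennreal_mult'[symmetric] exp_decay_nonneg)
    then show "(\<integral>\<^sup>+ t. ennreal (exp_decay l t) * (ennreal (exp (- t * s)) * w s) \<partial>lborel) = ennreal (1 / (l + s)) * w s"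
      using w[of s] l by (cases "0 < s") (simp_all add: nn_integral_multc nn_integral_exp_decay)
  qed
  finally show ?thesis .
qed

lemma Gamma_reflection_real:
  fixes s :: real
  shows "Gamma s * Gamma (1 - s) = pi / sin (pi * s)"
proof -
  have "complex_of_real (Gamma s * Gamma (1 - s)) = complex_of_real (pi / sin (pi * s))"
    using Gamma_reflection_complex[of "complex_of_real s"]
    by (simp add: Gamma_complex_of_real[symmetric] sin_of_real[symmetric])
  then show ?thesis by (simp only: of_real_eq_iff)
qed

lemma nn_integral_powr_div_add:
  assumes l: "0 < l" and s: "0 < s" "s < (1::real)"
  shows "(\<integral>\<^sup>+ r. ennreal (1 / (l + r)) * ennreal (indicator {0<..} r * r powr (- s)) \<partial>lborel)
       = ennreal (pi / sin (pi * s) * l powr (- s))"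
proof -
  have inner: "(\<integral>\<^sup>+ r. ennreal (exp (- t * r)) * ennreal (indicator {0<..} r * r powr (- s)) \<partial>lborel)
       = ennreal (Gamma (1 - s) * t powr (s - 1))" if "0 < t" for t
  proof -
    have "(\<integral>\<^sup>+ r. ennreal (exp (- t * r)) * ennreal (indicator {0<..} r * r powr (- s)) \<partial>lborel)
         = (\<integral>\<^sup>+ r. ennreal (r powr ((1 - s) - 1) * exp_decay t r) \<partial>lborel)"
      by (intro nn_integral_cong)
        (auto simp: exp_decay_def ennreal_mult'[symmetric] mult.commute split: split_indicator)
    also have "\<dots> = ennreal (Gamma (1 - s) / t powr (1 - s))"
      using s that by (intro nn_integral_powr_exp_decay) auto
    also have "Gamma (1 - s) / t powr (1 - s) = Gamma (1 - s) * t powr (s - 1)"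
      using powr_minus_divide[of t "1 - s"] by simp
    finally show ?thesis .
  qed
  have "(\<integral>\<^sup>+ r. ennreal (1 / (l + r)) * ennreal (indicator {0<..} r * r powr (- s)) \<partial>lborel)
     = (\<integral>\<^sup>+ t. ennreal (exp_decay l t) *
       (\<integral>\<^sup>+ r. ennreal (exp (- t * r)) * ennreal (indicator {0<..} r * r powr (- s)) \<partial>lborel) \<partial>lborel)"
    using l by (intro nn_integral_iterated_laplace[symmetric]) auto
  also have "\<dots> = (\<integral>\<^sup>+ t. ennreal (Gamma (1 - s)) * ennreal (t powr (s - 1) * exp_decay l t) \<partial>lborel)"
  proof (rule nn_integral_cong_AE)
    show "AE t in lborel. ennreal (exp_decay l t)
         * (\<integral>\<^sup>+ r. ennreal (exp (- t * r)) * ennreal (indicator {0<..} r * r powr (- s)) \<partial>lborel)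
        = ennreal (Gamma (1 - s)) * ennreal (t powr (s - 1) * exp_decay l t)"
      using AE_lborel_singleton[of 0]
    proof eventually_elim
      case (elim t)
      then show ?case
        using s by (cases "0 < t") (simp_all only: inner, simp_all add: ennreal_mult'[symmetric] mult_ac)
    qed
  qed
  also have "\<dots> = ennreal (Gamma (1 - s)) * ennreal (Gamma s / l powr s)"
    using l s by (simp add: nn_integral_cmult nn_integral_powr_exp_decay)
  also have "\<dots> = ennreal (Gamma (1 - s) * (Gamma s / l powr s))"
    using s by (simp add: ennreal_mult'[symmetric])
  also have "Gamma (1 - s) * (Gamma s / l powr s) = pi / sin (pi * s) * l powr (- s)"
    unfolding Gamma_reflection_real[symmetric] by (simp add: powr_minus_divide)
  finally show ?thesis .
qed

lemma nn_integral_powr_exponent: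
  assumes l: "0 < l" "l \<noteq> (1::real)"
  shows "(\<integral>\<^sup>+ s. ennreal (l powr (- s)) * indicator {0<..<1} s \<partial>lborel) = ennreal ((l - 1) / (l * ln l))"
proof -
  have ln: "ln l \<noteq> 0" using l by simp
  have "(\<integral>\<^sup>+ s. ennreal (l powr (- s)) * indicator {0<..<1} s \<partial>lborel)
       = (\<integral>\<^sup>+ s. ennreal (exp (- ln l * s)) * indicator {0..1} s \<partial>lborel)"
    using AE_lborel_singleton[of 0] AE_lborel_singleton[of 1] l
    by (intro nn_integral_cong_AE) (auto elim!: eventually_elim2 split: split_indicator simp: powr_def mult_ac)
  also have "\<dots> = ennreal (- exp (- ln l * 1) / ln l - (- exp (- ln l * 0) / ln l))"
    using ln by (intro nn_integral_FTC_Icc) (auto intro!: derivative_eq_intros)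
  also have "- exp (- ln l * 1) / ln l - (- exp (- ln l * 0) / ln l) = (l - 1) / (l * ln l)"
    using l ln by (simp add: exp_minus field_simps)
  finally show ?thesis .
qed

lemma log_density_denominator_pos: "0 < pi\<^sup>2 + (ln r)\<^sup>2" for r :: real
  by (simp add: add_pos_nonneg)

lemma nn_integral_sin_powr:
  assumes r: "0 < r"
  shows "(\<integral>\<^sup>+ s. ennreal (sin (pi * s) / pi * r powr (- s)) * indicator {0<..<1} s \<partial>lborel)
     = ennreal ((1 + 1 / r) / (pi\<^sup>2 + (ln r)\<^sup>2))"
proof -
  define L Q where "L = ln r" and "Q = pi\<^sup>2 + L\<^sup>2"
  define F where "F s = - (exp (- L * s) * (L * sin (pi * s) + pi * cos (pi * s))) / (Q * pi)" for s
  have Q: "0 < Q" by (simp add: Q_def add_pos_nonneg)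
  have "(\<integral>\<^sup>+ s. ennreal (sin (pi * s) / pi * r powr (- s)) * indicator {0<..<1} s \<partial>lborel)
     = (\<integral>\<^sup>+ s. ennreal (sin (pi * s) / pi * exp (- L * s)) * indicator {0..1} s \<partial>lborel)"
    using AE_lborel_singleton[of 0] AE_lborel_singleton[of 1] r
    by (intro nn_integral_cong_AE) (auto elim!: eventually_elim2 split: split_indicator simp: powr_def L_def mult_ac)
  also have "\<dots> = ennreal (F 1 - F 0)"
  proof (rule nn_integral_FTC_Icc)
    fix s :: real
    have "(F has_real_derivative
       - (- L * exp (- L * s) * (L * sin (pi * s) + pi * cos (pi * s)) + exp (- L * s)
         * (L * pi * cos (pi * s) - pi * pi * sin (pi * s))) / (Q * pi)) (at s)"
      unfolding F_def[abs_def] by (rule DERIV_cdivide) (auto intro!: derivative_eq_intros simp: algebra_simps)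
    moreover have "- (- L * exp (- L * s) * (L * sin (pi * s) + pi * cos (pi * s))
         + exp (- L * s) * (L * pi * cos (pi * s) - pi * pi * sin (pi * s)))
       = Q * (exp (- L * s) * sin (pi * s))"
      by (simp add: Q_def algebra_simps power2_eq_square)
    ultimately show "(F has_real_derivative sin (pi * s) / pi * exp (- L * s)) (at s)"
      using Q by (simp add: mult.commute)
  next
    fix s :: real assume "s \<in> {0..1}"
    then show "0 \<le> sin (pi * s) / pi * exp (- L * s)"
      by (intro mult_nonneg_nonneg divide_nonneg_nonneg sin_ge_zero) auto
  qed auto
  also have "F 1 - F 0 = (1 + 1 / r) / (pi\<^sup>2 + (ln r)\<^sup>2)"
  proof -
    have "F 1 - F 0 = (1 + exp (- L)) / Q" using Q by (simp add: F_def field_simps)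
    then show ?thesis using r by (simp add: L_def Q_def exp_minus inverse_eq_divide)
  qed
  finally show ?thesis .
qed

lemma nn_integral_log_density_div_add:
  assumes l: "0 < l" "l \<noteq> (1::real)"
  shows "(\<integral>\<^sup>+ r. ennreal (1 / (l + r)) * ennreal (indicator {0<..} r * ((1 + 1 / r) / (pi\<^sup>2 + (ln r)\<^sup>2))) \<partial>lborel)
     = ennreal ((l - 1) / (l * ln l))"
proof -
  let ?S = "\<lambda>s. indicator {0<..<1} s * (sin (pi * s) / pi)"
  have S: "0 \<le> ?S s" for s by (auto split: split_indicator intro!: divide_nonneg_pos sin_ge_zero)
  have "(\<integral>\<^sup>+ r. ennreal (1 / (l + r)) * ennreal (indicator {0<..} r * ((1 + 1 / r) / (pi\<^sup>2 + (ln r)\<^sup>2))) \<partial>lborel)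
     = (\<integral>\<^sup>+ r. \<integral>\<^sup>+ s. ennreal (?S s) *
       (ennreal (1 / (l + r)) * ennreal (indicator {0<..} r * r powr (- s))) \<partial>lborel \<partial>lborel)"
  proof (intro nn_integral_cong)
    fix r :: real
    show "ennreal (1 / (l + r)) * ennreal (indicator {0<..} r * ((1 + 1 / r) / (pi\<^sup>2 + (ln r)\<^sup>2)))
       = (\<integral>\<^sup>+ s. ennreal (?S s) * (ennreal (1 / (l + r)) * ennreal (indicator {0<..} r * r powr (- s))) \<partial>lborel)"
    proof (cases "0 < r")
      case True
      have "ennreal (?S s) * ennreal (r powr (- s))
           = ennreal (sin (pi * s) / pi * r powr (- s)) * indicator {0<..<1} s" for s
        by (auto simp: ennreal_mult''[symmetric] split: split_indicator)
      then have "(\<integral>\<^sup>+ s. ennreal (?S s) * (ennreal (1 / (l + r)) * ennreal (indicator {0<..} r * r powr (- s))) \<partial>lborel)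
         = (\<integral>\<^sup>+ s. ennreal (1 / (l + r)) * (ennreal (sin (pi * s) / pi * r powr (- s)) * indicator {0<..<1} s) \<partial>lborel)"
        using True by (intro nn_integral_cong) (simp add: mult.left_commute[of _ "ennreal (1 / (l + r))"])
      also have "\<dots> = ennreal (1 / (l + r))
           * (\<integral>\<^sup>+ s. ennreal (sin (pi * s) / pi * r powr (- s)) * indicator {0<..<1} s \<partial>lborel)"
        by (intro nn_integral_cmult) measurable
      finally show ?thesis using True by (simp only: nn_integral_sin_powr) simp
    qed simp
  qed
  also have "\<dots> = (\<integral>\<^sup>+ s. \<integral>\<^sup>+ r. ennreal (?S s)
       * (ennreal (1 / (l + r)) * ennreal (indicator {0<..} r * r powr (- s))) \<partial>lborel \<partial>lborel)"
    by (rule lborel_Tonelli) measurable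
  also have "\<dots> = (\<integral>\<^sup>+ s. ennreal (l powr (- s)) * indicator {0<..<1} s \<partial>lborel)"
  proof (intro nn_integral_cong)
    fix s :: real
    show "(\<integral>\<^sup>+ r. ennreal (?S s) * (ennreal (1 / (l + r)) * ennreal (indicator {0<..} r * r powr (- s))) \<partial>lborel)
       = ennreal (l powr (- s)) * indicator {0<..<1} s"
    proof (cases "s \<in> {0<..<1}")
      case True
      then have "0 < sin (pi * s)" by (intro sin_gt_zero) auto
      then show ?thesis
        using True l by (simp add: nn_integral_cmult nn_integral_powr_div_add ennreal_mult'[symmetric])
    qed simp
  qed
  also have "\<dots> = ennreal ((l - 1) / (l * ln l))" by (rule nn_integral_powr_exponent[OF l])
  finally show ?thesis .
qed

lemma nn_integral_inverse_id_log_density: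
  "(\<integral>\<^sup>+ r. ennreal (1 / (r * (pi\<^sup>2 + (ln r)\<^sup>2))) * indicator {0<..} r \<partial>lborel) = 1"
proof -
  have "(\<integral>\<^sup>+ r. ennreal (1 / (r * (pi\<^sup>2 + (ln r)\<^sup>2))) * indicator {0<..} r \<partial>lborel)
       = (\<integral>\<^sup>+ s. ennreal (1 / (pi\<^sup>2 + s\<^sup>2)) \<partial>lborel)"
    by (subst nn_integral_exp_substitution[where c = 1]) auto
  also have "\<dots> = \<bar>pi\<bar> * (\<integral>\<^sup>+ x. ennreal (1 / (pi\<^sup>2 + (0 + pi * x)\<^sup>2)) \<partial>lborel)"
    by (rule nn_integral_real_affine) auto
  also have "(\<integral>\<^sup>+ x. ennreal (1 / (pi\<^sup>2 + (0 + pi * x)\<^sup>2)) \<partial>lborel)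
       = (\<integral>\<^sup>+ x. ennreal (1 / pi\<^sup>2) * ennreal (inverse (1 + x\<^sup>2)) \<partial>lborel)"
    by (intro nn_integral_cong) (simp add: ennreal_mult'[symmetric] power_mult_distrib field_simps)
  also have "\<dots> = ennreal (1 / pi\<^sup>2) * ennreal pi"
  proof -
    have "integrable lborel (\<lambda>x::real. inverse (1 + x\<^sup>2))"
      using integrable_inverse_1_plus_square by (simp add: set_integrable_def einterval_eq)
    moreover have "(\<integral>x. inverse (1 + (x::real)\<^sup>2) \<partial>lborel) = pi"
      using LBINT_inverse_1_plus_square
      by (simp add: interval_lebesgue_integral_def set_lebesgue_integral_def einterval_eq)
    ultimately show ?thesis by (simp add: nn_integral_cmult nn_integral_eq_integral add_nonneg_nonneg)
  qed
  finally show ?thesis by (simp add: ennreal_mult'[symmetric] power2_eq_square)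
qed

definition log_density :: "real \<Rightarrow> real \<Rightarrow> real" where
  "log_density E r = indicator {0<..} r * (1 / (pi\<^sup>2 + (ln (r / E))\<^sup>2))"

lemma log_density_nonneg [simp]: "0 \<le> log_density E r"
  by (simp add: log_density_def)

lemma log_density_measurable [measurable]: "log_density E \<in> borel_measurable borel"
  unfolding log_density_def[abs_def] by measurable

lemma log_density_nonpos [simp]: "r \<le> 0 \<Longrightarrow> log_density E r = 0"
  by (simp add: log_density_def)

lemma log_density_le: "log_density E r \<le> 1 / pi\<^sup>2"
  using log_density_denominator_pos[of "r / E"]
  by (auto simp: log_density_def split: split_indicator intro!: divide_left_mono)

lemma inverse_ln_ge:
  assumes "0 < (l::real)" "l \<noteq> 1"
  shows "1 / (l - 1) \<le> 1 / ln l"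
proof (rule divide_left_mono)
  show "0 < (l - 1) * ln l" using assms by (cases "1 < l") (auto simp: zero_less_mult_iff)
qed (use assms ln_le_minus_one in auto)

lemma log_density_Stieltjes:
  assumes l: "0 < l" "l \<noteq> 1"
  shows "(\<integral>\<^sup>+ r. ennreal (1 / (l + r)) * ennreal (log_density 1 r) \<partial>lborel) = ennreal (1 / ln l - 1 / (l - 1))"
proof -
  define R where "R r = pi\<^sup>2 + (ln r)\<^sup>2" for r :: real
  define a b c where "a r = indicator {0<..} r * (1 / (l + r) * ((1 + 1 / r) / R r))"
    and "b r = indicator {0<..} r * (1 / (r * R r))" and "c r = indicator {0<..} r * (1 / ((l + r) * R r))" for r
  have R: "0 < R r" for r unfolding R_def by (rule log_density_denominator_pos)
  have [measurable]: "a \<in> borel_measurable borel" "b \<in> borel_measurable borel"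
    unfolding a_def[abs_def] b_def[abs_def] R_def by measurable
  have nonneg: "0 \<le> a r" "0 \<le> b r" "0 \<le> c r" for r
    using l R[of r] by (auto simp: a_def b_def c_def split: split_indicator)
  have "(\<integral>\<^sup>+ r. ennreal (a r) \<partial>lborel) = ennreal ((l - 1) / (l * ln l))"
    unfolding nn_integral_log_density_div_add[OF l, symmetric] using l R
    by (intro nn_integral_cong) (auto simp: a_def R_def ennreal_mult'[symmetric] less_imp_le split: split_indicator)
  moreover have "0 \<le> (l - 1) / (l * ln l)"
    using l by (cases "1 < l") (auto simp: zero_le_divide_iff mult_le_0_iff zero_le_mult_iff)
  ultimately have a: "has_bochner_integral lborel a ((l - 1) / (l * ln l))"
    using nonneg by (intro has_bochner_integral_nn_integral) auto
  have "(\<integral>\<^sup>+ r. ennreal (b r) \<partial>lborel) = ennreal 1"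
    unfolding ennreal_1 nn_integral_inverse_id_log_density[symmetric]
    by (intro nn_integral_cong) (auto simp: b_def R_def split: split_indicator)
  then have b: "has_bochner_integral lborel b 1"
    using nonneg by (intro has_bochner_integral_nn_integral) auto
  have "c r = (l * a r - b r) / (l - 1)" for r
  proof (cases "0 < r")
    case True
    have "l + r \<noteq> 0" "r \<noteq> 0" "R r \<noteq> 0" "l - 1 \<noteq> 0" using l True R[of r] by auto
    then show ?thesis using True unfolding a_def b_def c_def by (simp add: divide_simps) (simp add: algebra_simps)
  qed (simp add: a_def b_def c_def)
  then have c_eq: "c = (\<lambda>r. (l * a r - b r) / (l - 1))" by (rule ext)
  have "has_bochner_integral lborel c ((l * ((l - 1) / (l * ln l)) - 1) / (l - 1))"
    unfolding c_eq by (intro has_bochner_integral_divide_zero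
      has_bochner_integral_diff has_bochner_integral_mult_right a b)
  also have "(l * ((l - 1) / (l * ln l)) - 1) / (l - 1) = 1 / ln l - 1 / (l - 1)"
  proof -
    have "l * ((l - 1) / (l * ln l)) = (l - 1) * (1 / ln l)" using l by simp
    then show ?thesis using l by (simp only: diff_divide_distrib) simp
  qed
  finally have c: "has_bochner_integral lborel c (1 / ln l - 1 / (l - 1))" .
  have "(\<integral>\<^sup>+ r. ennreal (c r) \<partial>lborel) = ennreal (1 / ln l - 1 / (l - 1))"
    using c nonneg by (subst nn_integral_eq_integral) (auto simp: has_bochner_integral_iff)
  moreover have "ennreal (c r) = ennreal (1 / (l + r)) * ennreal (log_density 1 r)" for r
    using l by (simp add: c_def R_def log_density_def ennreal_mult'[symmetric] split: split_indicator)
  ultimately show ?thesis by simp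
qed

section \<open>The memory kernel\<close>

definition memory_kernel :: "real \<Rightarrow> real \<Rightarrow> real" where
  "memory_kernel E t = (if 0 < t then 4 * pi * laplace (log_density E) t else 0)"

lemma laplace_class_log_density: "laplace_class (log_density E)"
  by (rule laplace_class_powr_bound[where A = "1 / pi\<^sup>2" and b = 0]) (auto intro: log_density_le[simplified])

lemma memory_kernel_nonneg [simp]: "0 \<le> memory_kernel E t"
  by (simp add: memory_kernel_def laplace_def)

lemma memory_kernel_nonpos [simp]: "t \<le> 0 \<Longrightarrow> memory_kernel E t = 0"
  by (simp add: memory_kernel_def)

lemma memory_kernel_measurable [measurable]: "memory_kernel E \<in> borel_measurable borel"
proof -
  have [measurable]: "laplace (log_density E) \<in> borel_measurable borel"
    unfolding laplace_def[abs_def] by (rule lborel.borel_measurable_lebesgue_integral) measurable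
  show ?thesis unfolding memory_kernel_def[abs_def] by measurable
qed

lemma memory_kernel_le:
  assumes "0 < t"
  shows "memory_kernel E t \<le> 4 / (pi * t)"
proof -
  have "norm (laplace (log_density E) t) \<le> (1 / pi\<^sup>2) / t"
    using assms log_density_le by (intro norm_laplace_le) auto
  then have "4 * pi * laplace (log_density E) t \<le> 4 * pi * ((1 / pi\<^sup>2) / t)"
    by (intro mult_left_mono) auto
  then show ?thesis using assms by (simp add: memory_kernel_def power2_eq_square)
qed

lemma memory_kernel_antimono: "0 < s \<Longrightarrow> s \<le> t \<Longrightarrow> memory_kernel E t \<le> memory_kernel E s"
  using laplace_antimono[OF laplace_class_log_density, of E s t] by (simp add: memory_kernel_def)

lemma memory_kernel_isCont:
  assumes "0 < t"
  shows "isCont (memory_kernel E) t"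
proof -
  have "isCont (\<lambda>t. 4 * pi * laplace (log_density E) t) t"
    by (intro continuous_intros isCont_laplace laplace_class_log_density assms)
  moreover have "\<forall>\<^sub>F s in nhds t. memory_kernel E s = 4 * pi * laplace (log_density E) s"
    by (rule eventually_mono[OF eventually_nhds_in_open[of "{0<..}" t]]) (use assms in \<open>auto simp: memory_kernel_def\<close>)
  ultimately show ?thesis by (simp add: isCont_cong)
qed

lemma nn_integral_div_add_log_density_scaled:
  assumes E: "0 < E"
  shows "(\<integral>\<^sup>+ s. ennreal (1 / (l + s)) * ennreal (log_density E s) \<partial>lborel)
     = (\<integral>\<^sup>+ r. ennreal (1 / (l / E + r)) * ennreal (log_density 1 r) \<partial>lborel)"
proof -
  have "(\<integral>\<^sup>+ s. ennreal (1 / (l + s)) * ennreal (log_density E s) \<partial>lborel)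
     = \<bar>E\<bar> * (\<integral>\<^sup>+ r. ennreal (1 / (l + (0 + E * r))) * ennreal (log_density E (0 + E * r)) \<partial>lborel)"
    using E by (intro nn_integral_real_affine) auto
  also have "\<dots> = (\<integral>\<^sup>+ r. ennreal E * (ennreal (1 / (l + E * r)) * ennreal (log_density E (E * r))) \<partial>lborel)"
    using E by (subst nn_integral_cmult) auto
  also have "\<dots> = (\<integral>\<^sup>+ r. ennreal (1 / (l / E + r)) * ennreal (log_density 1 r) \<partial>lborel)"
  proof (intro nn_integral_cong)
    fix r :: real
    have "log_density E (E * r) = log_density 1 r"
      using E by (simp add: log_density_def zero_less_mult_iff split: split_indicator)
    moreover have "E * (1 / (l + E * r)) = 1 / (l / E + r)"
    proof -
      have "l / E + r = (l + E * r) / E" using E by (simp add: field_simps)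
      then show ?thesis by simp
    qed
    ultimately show "ennreal E * (ennreal (1 / (l + E * r)) * ennreal (log_density E (E * r)))
         = ennreal (1 / (l / E + r)) * ennreal (log_density 1 r)"
      using E by (simp only: mult.assoc[symmetric] ennreal_mult'[symmetric] less_imp_le)
  qed
  finally show ?thesis .
qed

lemma nn_integral_exp_memory_kernel:
  assumes E: "0 < E" and l: "0 \<le> l"
  shows "(\<integral>\<^sup>+ t. ennreal (exp (- l * t) * memory_kernel E t) \<partial>lborel)
     = ennreal (4 * pi) * (\<integral>\<^sup>+ r. ennreal (1 / (l / E + r)) * ennreal (log_density 1 r) \<partial>lborel)"
proof -
  let ?L = "\<lambda>t. \<integral>\<^sup>+ s. ennreal (exp (- t * s)) * ennreal (log_density E s) \<partial>lborel"
  have "ennreal (exp (- l * t) * memory_kernel E t)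
       = ennreal (4 * pi) * (ennreal (exp_decay l t) * ?L t)" if "t \<noteq> 0" for t
  proof (cases "0 < t")
    case True
    have "?L t = ennreal (laplace (log_density E) t)"
      using nn_integral_laplace[OF laplace_class_log_density log_density_nonneg True] by (simp add: ennreal_mult')
    moreover have "exp (- l * t) * memory_kernel E t = 4 * pi * (exp_decay l t * laplace (log_density E) t)"
      using True by (simp add: memory_kernel_def exp_decay_def)
    ultimately show ?thesis by (simp only: ennreal_mult' exp_decay_nonneg) (simp add: ennreal_mult')
  qed (use that in simp)
  then have "(\<integral>\<^sup>+ t. ennreal (exp (- l * t) * memory_kernel E t) \<partial>lborel)
      = (\<integral>\<^sup>+ t. ennreal (4 * pi) * (ennreal (exp_decay l t) * ?L t) \<partial>lborel)"
    using AE_lborel_singleton[of 0] by (intro nn_integral_cong_AE) (auto elim!: eventually_mono)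
  also have "\<dots> = ennreal (4 * pi) * (\<integral>\<^sup>+ s. ennreal (1 / (l + s)) * ennreal (log_density E s) \<partial>lborel)"
    using l by (subst nn_integral_iterated_laplace[symmetric]) (auto intro!: nn_integral_cmult)
  finally show ?thesis unfolding nn_integral_div_add_log_density_scaled[OF E] .
qed

lemma nn_integral_memory_kernel:
  assumes "0 < E"
  shows "(\<integral>\<^sup>+ t. ennreal (memory_kernel E t) \<partial>lborel) = ennreal (4 * pi)"
proof -
  have "(\<integral>\<^sup>+ r. ennreal (1 / (0 / E + r)) * ennreal (log_density 1 r) \<partial>lborel) = 1"
    unfolding nn_integral_inverse_id_log_density[symmetric]
    by (intro nn_integral_cong) (simp add: log_density_def ennreal_mult'[symmetric] split: split_indicator)
  then show ?thesis using nn_integral_exp_memory_kernel[OF assms, of 0] by simp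
qed

lemma laplace_class_memory_kernel:
  assumes "0 < E"
  shows "laplace_class (memory_kernel E)"
proof (rule laplace_class_integrableI)
  have "integrable lborel (memory_kernel E)"
    using nn_integral_memory_kernel[OF assms] by (intro integrableI_nonneg) auto
  then show "integrable lborel (\<lambda>t. exp (- l * t) *\<^sub>R memory_kernel E t)" if "0 < l" for l
  proof (rule Bochner_Integration.integrable_bound)
    show "AE t in lborel. norm (exp (- l * t) *\<^sub>R memory_kernel E t) \<le> norm (memory_kernel E t)"
    proof (rule AE_I2)
      fix t show "norm (exp (- l * t) *\<^sub>R memory_kernel E t) \<le> norm (memory_kernel E t)"
        using that by (cases "0 < t") (auto intro!: mult_left_le_one_le)
    qed
  qed measurable
qed auto

lemma laplace_memory_kernel:
  assumes E: "0 < E" and l: "0 < l" "l \<noteq> E"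
  shows "laplace (memory_kernel E) l = 4 * pi * (1 / ln (l / E) - E / (l - E))"
proof -
  have ratio: "0 < l / E" "l / E \<noteq> 1" using l E by auto
  have "1 / (l / E - 1) = E / (l - E)"
  proof -
    have "l / E - 1 = (l - E) / E" using E by (simp add: field_simps)
    then show ?thesis by simp
  qed
  moreover have "laplace (memory_kernel E) l = 4 * pi * (1 / ln (l / E) - 1 / (l / E - 1))"
  proof (rule laplace_eqI)
    show "(\<integral>\<^sup>+ t. ennreal (exp (- l * t) * memory_kernel E t) \<partial>lborel)
         = ennreal (4 * pi * (1 / ln (l / E) - 1 / (l / E - 1)))"
      using nn_integral_exp_memory_kernel[OF E, of l] log_density_Stieltjes[OF ratio] l by (simp add: ennreal_mult')
    show "0 \<le> 4 * pi * (1 / ln (l / E) - 1 / (l / E - 1))"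
      using inverse_ln_ge[OF ratio] by (intro mult_nonneg_nonneg) auto
  qed auto
  ultimately show ?thesis by simp
qed

section \<open>The Green function\<close>

lemma nn_integral_K0:
  assumes r: "0 < r"
  shows "(\<integral>\<^sup>+ s. ennreal (exp (- r * cosh s)) * indicator {0<..} s \<partial>lborel) = ennreal (K0 r)"
proof -
  have cosh_ge: "s / 2 \<le> cosh s" for s :: real
  proof -
    have "s \<le> 1 + s" by simp
    also have "\<dots> \<le> exp s" by (rule exp_ge_add_one_self)
    finally have "s + 0 \<le> exp s + exp (- s)" by (intro add_mono) auto
    then show ?thesis by (simp add: cosh_field_def)
  qed
  have "set_integrable lborel {0<..} (\<lambda>s. exp (- r * cosh s))"
    unfolding set_integrable_def
  proof (rule Bochner_Integration.integrable_bound)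
    show "integrable lborel (exp_decay (r / 2))"
      using has_bochner_integral_exp_decay[of "r / 2"] r by (simp add: has_bochner_integral_iff)
    show "AE s in lborel. norm (indicator {0<..} s *\<^sub>R exp (- r * cosh s)) \<le> norm (exp_decay (r / 2) s)"
    proof (rule AE_I2)
      fix s
      have "r * (s / 2) \<le> r * cosh s" using r cosh_ge by (intro mult_left_mono) auto
      then show "norm (indicator {0<..} s *\<^sub>R exp (- r * cosh s)) \<le> norm (exp_decay (r / 2) s)"
        by (auto simp: exp_decay_def split: split_indicator)
    qed
  qed (simp add: cosh_def)
  then have "(\<integral>\<^sup>+ s. ennreal (indicator {0<..} s *\<^sub>R exp (- r * cosh s)) \<partial>lborel) = ennreal (K0 r)"
    unfolding K0_def set_lebesgue_integral_def set_integrable_def by (intro nn_integral_eq_integral) auto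
  moreover have "ennreal (exp (- r * cosh s)) * indicator {0<..} s
       = ennreal (indicator {0<..} s *\<^sub>R exp (- r * cosh s))" for s
    by (auto split: split_indicator)
  ultimately show ?thesis by simp
qed

lemma K0_nonneg: "0 \<le> K0 r"
  unfolding K0_def set_lebesgue_integral_def by (intro integral_nonneg_AE) auto

lemma nn_integral_exp_cosh:
  assumes "0 < r"
  shows "(\<integral>\<^sup>+ s. ennreal (exp (- r * cosh s)) \<partial>lborel) = ennreal (2 * K0 r)"
proof -
  let ?f = "\<lambda>s. ennreal (exp (- r * cosh s)) * indicator {0<..} s"
  have [measurable]: "?f \<in> borel_measurable borel" by (simp add: cosh_def)
  have "(\<integral>\<^sup>+ s. ennreal (exp (- r * cosh s)) \<partial>lborel) = (\<integral>\<^sup>+ s. ?f s + ?f (0 - s) \<partial>lborel)"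
  proof (rule nn_integral_cong_AE)
    show "AE s in lborel. ennreal (exp (- r * cosh s)) = ?f s + ?f (0 - s)"
      using AE_lborel_singleton[of 0] by eventually_elim (auto split: split_indicator)
  qed
  also have "\<dots> = (\<integral>\<^sup>+ s. ?f s \<partial>lborel) + (\<integral>\<^sup>+ s. ?f (0 - s) \<partial>lborel)"
    by (intro nn_integral_add) measurable
  also have "(\<integral>\<^sup>+ s. ?f (0 - s) \<partial>lborel) = (\<integral>\<^sup>+ s. ?f s \<partial>lborel)"
    by (rule nn_integral_lborel_reflect) measurable
  finally show ?thesis
    unfolding nn_integral_K0[OF assms] using K0_nonneg by (simp add: ennreal_plus[symmetric] del: ennreal_plus)
qed

lemma Gk_nonneg [simp]: "0 \<le> Gk l x"
  by (simp add: Gk_def K0_nonneg)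

lemma Gk_minus [simp]: "Gk l (- x) = Gk l x"
  by (simp add: Gk_def)

lemma Gk_measurable [measurable]: "Gk l \<in> borel_measurable borel"
proof -
  have "K0 \<in> borel_measurable borel"
    unfolding K0_def[abs_def] set_lebesgue_integral_def cosh_def
    by (rule lborel.borel_measurable_lebesgue_integral) simp
  then show ?thesis unfolding Gk_def[abs_def] by simp
qed

lemma nn_integral_exp_heat_kernel:
  assumes l: "0 < l" and x: "x \<noteq> 0"
  shows "(\<integral>\<^sup>+ s. ennreal (exp (- l * s) * heat_kernel s x) \<partial>lborel) = ennreal (Gk l x)"
proof -
  define r where "r = sqrt l * norm x"
  define c where "c = norm x / (2 * sqrt l)"
  have r: "0 < r" and c: "0 < c" using l x by (simp_all add: r_def c_def)
  have lc: "l * c = r / 2" using l real_sqrt_mult_self[of l] by (simp add: c_def r_def field_simps)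
  have xc: "(norm x)\<^sup>2 / (4 * c) = r / 2" using l x by (simp add: c_def r_def field_simps power2_eq_square)
  have "exp (- l * (c * exp s)) * heat_kernel (c * exp s) x * (c * exp s) = 1 / (4 * pi) * exp (- r * cosh s)" for s
  proof -
    have "- l * (c * exp s) + - (norm x)\<^sup>2 / (4 * (c * exp s)) = - (l * c) * exp s - ((norm x)\<^sup>2 / (4 * c)) * exp (- s)"
      by (simp add: exp_minus field_simps)
    also have "\<dots> = - r * cosh s" unfolding lc xc by (simp add: cosh_def field_simps)
    finally have "exp (- l * (c * exp s)) * exp (- (norm x)\<^sup>2 / (4 * (c * exp s))) = exp (- r * cosh s)"
      unfolding exp_add[symmetric] by (rule arg_cong)
    then show ?thesis using c by (simp add: heat_kernel_R2)
  qed
  then have "(\<integral>\<^sup>+ s. ennreal (exp (- l * s) * heat_kernel s x) * indicator {0<..} s \<partial>lborel)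
     = (\<integral>\<^sup>+ s. ennreal (1 / (4 * pi)) * ennreal (exp (- r * cosh s)) \<partial>lborel)"
    using c by (subst nn_integral_exp_substitution[where c = c]) (simp_all add: ennreal_mult'[symmetric])
  also have "\<dots> = ennreal (1 / (4 * pi)) * ennreal (2 * K0 r)"
    unfolding nn_integral_exp_cosh[OF r, symmetric] by (rule nn_integral_cmult) (simp add: cosh_def)
  also have "\<dots> = ennreal (Gk l x)"
    by (simp add: Gk_def r_def ennreal_mult'[symmetric])
  also have "(\<integral>\<^sup>+ s. ennreal (exp (- l * s) * heat_kernel s x) * indicator {0<..} s \<partial>lborel)
       = (\<integral>\<^sup>+ s. ennreal (exp (- l * s) * heat_kernel s x) \<partial>lborel)"
    by (intro nn_integral_cong) (auto split: split_indicator)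
  finally show ?thesis .
qed

lemma laplace_class_heat_kernel: "x \<noteq> 0 \<Longrightarrow> laplace_class (\<lambda>s. heat_kernel s (x :: R2))"
  using nn_integral_exp_heat_kernel[of _ x] by (auto simp: laplace_class_def)

lemma laplace_heat_kernel: "0 < l \<Longrightarrow> x \<noteq> 0 \<Longrightarrow> laplace (\<lambda>s. heat_kernel s x) l = Gk l x"
  using nn_integral_exp_heat_kernel by (intro laplace_eqI) auto

lemma Gk_antimono: "0 < l \<Longrightarrow> l \<le> m \<Longrightarrow> x \<noteq> 0 \<Longrightarrow> Gk m x \<le> Gk l x"
  using laplace_antimono[OF laplace_class_heat_kernel[of x], of l m] by (simp add: laplace_heat_kernel)

lemma
  fixes v :: "real \<Rightarrow> real"
  assumes v: "laplace_class v" and nonneg: "\<And>s. 0 \<le> v s" and lm: "0 < l" "0 < m" "l \<noteq> m"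
  shows nn_integral_exp_diff_kernel: "(\<integral>\<^sup>+ x. ennreal (exp_diff_kernel l m x * v x) \<partial>lborel)
       = ennreal ((laplace v l - laplace v m) / (m - l))"
    and laplace_difference_quotient_nonneg: "0 \<le> (laplace v l - laplace v m) / (m - l)"
proof -
  have "has_bochner_integral lborel (\<lambda>x. exp_diff_kernel l m x *\<^sub>R v x) ((laplace v l - laplace v m) /\<^sub>R (m - l))"
    unfolding exp_diff_kernel_scaleR[OF v] laplace_def using lm
    by (intro has_bochner_integral_scaleR_right has_bochner_integral_diff
      has_bochner_integral_integrable laplace_class_integrable v)
  then have int: "has_bochner_integral lborel (\<lambda>x. exp_diff_kernel l m x * v x) ((laplace v l - laplace v m) / (m - l))"
    by (simp add: divide_inverse_commute)
  then show "(\<integral>\<^sup>+ x. ennreal (exp_diff_kernel l m x * v x) \<partial>lborel) = ennreal ((laplace v l - laplace v m) / (m - l))"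
    using nonneg by (subst nn_integral_eq_integral) (auto simp: has_bochner_integral_iff)
  show "0 \<le> (laplace v l - laplace v m) / (m - l)"
    using int nonneg Bochner_Integration.integral_nonneg[of lborel "\<lambda>x. exp_diff_kernel l m x * v x"]
    by (simp add: has_bochner_integral_iff)
qed

lemma Frullani_exp:
  assumes lm: "0 < l" "l < m"
  shows "(\<integral>\<^sup>+ v. ennreal (exp_diff_kernel l m v / v) \<partial>lborel) = ennreal (ln (m / l) / (m - l))"
proof -
  have "(\<integral>\<^sup>+ v. ennreal (exp_diff_kernel l m v / v) \<partial>lborel)
     = (\<integral>\<^sup>+ v. \<integral>\<^sup>+ r. ennreal (1 / (m - l)) * (ennreal (exp_decay r v) * indicator {l..m} r) \<partial>lborel \<partial>lborel)"
  proof (rule nn_integral_cong_AE)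
    show "AE v in lborel. ennreal (exp_diff_kernel l m v / v)
         = (\<integral>\<^sup>+ r. ennreal (1 / (m - l)) * (ennreal (exp_decay r v) * indicator {l..m} r) \<partial>lborel)"
      using AE_lborel_singleton[of 0]
    proof eventually_elim
      case (elim v)
      show ?case
      proof (cases "0 < v")
        case True
        then have "(\<integral>\<^sup>+ r. ennreal (exp_decay r v) * indicator {l..m} r \<partial>lborel)
            = ennreal (- exp (- m * v) / v - (- exp (- l * v) / v))"
          using lm by (simp only: exp_decay_def, intro nn_integral_FTC_Icc) (auto intro!: derivative_eq_intros)
        moreover have "exp_diff_kernel l m v / v = 1 / (m - l) * (- exp (- m * v) / v - (- exp (- l * v) / v))"
          using True by (simp add: exp_diff_kernel_def diff_divide_distrib mult.commute)
        ultimately show ?thesis using lm by (simp add: nn_integral_cmult ennreal_mult'[symmetric])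
      qed (use elim in \<open>simp add: exp_diff_kernel_def\<close>)
    qed
  qed
  also have "\<dots> = (\<integral>\<^sup>+ r. \<integral>\<^sup>+ v. ennreal (1 / (m - l)) * (ennreal (exp_decay r v) * indicator {l..m} r) \<partial>lborel \<partial>lborel)"
    by (rule lborel_Tonelli) measurable
  also have "\<dots> = (\<integral>\<^sup>+ r. ennreal (1 / (m - l)) * (ennreal (1 / r) * indicator {l..m} r) \<partial>lborel)"
  proof (intro nn_integral_cong)
    fix r :: real
    show "(\<integral>\<^sup>+ v. ennreal (1 / (m - l)) * (ennreal (exp_decay r v) * indicator {l..m} r) \<partial>lborel)
         = ennreal (1 / (m - l)) * (ennreal (1 / r) * indicator {l..m} r)"
      using lm by (cases "r \<in> {l..m}") (auto simp: nn_integral_cmult nn_integral_exp_decay)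
  qed
  also have "\<dots> = ennreal (1 / (m - l)) * ennreal (ln m - ln l)"
    using lm by (subst nn_integral_cmult, simp, subst nn_integral_FTC_Icc[where F = ln])
      (auto intro!: derivative_eq_intros)
  also have "\<dots> = ennreal (ln (m / l) / (m - l))" using lm by (simp add: ennreal_mult'[symmetric] ln_div)
  finally show ?thesis .
qed

lemma cc_difference_quotient:
  assumes "0 < l" "0 < m"
  shows "(cc m - cc l) / (m - l) = 1 / (4 * pi) * (ln (m / l) / (m - l))"
  using assms by (simp add: cc_def ln_sqrt ln_div diff_divide_distrib mult.commute)

lemma cc_difference_quotient_pos:
  assumes "0 < l" "0 < m" "l \<noteq> m"
  shows "0 < (cc m - cc l) / (m - l)"
proof -
  have "0 < ln (m / l) / (m - l)"
    using assms by (cases "l < m") (auto simp: zero_less_divide_iff ln_div)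
  then show ?thesis unfolding cc_difference_quotient[OF assms(1,2)] by (intro mult_pos_pos) auto
qed

lemma nn_integral_exp_diff_heat_kernel_0:
  assumes lm: "0 < l" "0 < m" "l \<noteq> m"
  shows "(\<integral>\<^sup>+ v. ennreal (exp_diff_kernel l m v * heat_kernel v (0 :: R2)) \<partial>lborel) = ennreal ((cc m - cc l) / (m - l))"
proof -
  have Frullani: "(\<integral>\<^sup>+ v. ennreal (exp_diff_kernel l m v / v) \<partial>lborel) = ennreal (ln (m / l) / (m - l))"
  proof (cases "l < m")
    case False
    then have "(\<integral>\<^sup>+ v. ennreal (exp_diff_kernel m l v / v) \<partial>lborel) = ennreal (ln (l / m) / (l - m))"
      using lm by (intro Frullani_exp) auto
    moreover have "ln (l / m) / (l - m) = ln (m / l) / (m - l)"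
      using lm by (simp add: ln_div) (metis minus_diff_eq minus_divide_divide)
    ultimately show ?thesis by (simp add: exp_diff_kernel_commute)
  qed (use lm in \<open>simp add: Frullani_exp\<close>)
  have scaled: "exp_diff_kernel l m v * heat_kernel v (0 :: R2) = 1 / (4 * pi) * (exp_diff_kernel l m v / v)" for v
    by (auto simp: heat_kernel_R2 exp_diff_kernel_def split: split_indicator)
  have "(\<integral>\<^sup>+ v. ennreal (exp_diff_kernel l m v * heat_kernel v (0 :: R2)) \<partial>lborel)
     = (\<integral>\<^sup>+ v. ennreal (1 / (4 * pi)) * ennreal (exp_diff_kernel l m v / v) \<partial>lborel)"
    unfolding scaled by (intro nn_integral_cong ennreal_mult') simp
  also have "\<dots> = ennreal (1 / (4 * pi)) * ennreal (ln (m / l) / (m - l))"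
    by (simp add: nn_integral_cmult Frullani)
  finally show ?thesis
    unfolding cc_difference_quotient[OF lm(1,2)]
    by (simp only: ennreal_mult'[symmetric] divide_nonneg_nonneg) (simp add: ennreal_mult'[symmetric])
qed

lemma nn_integral_Gk_mult_eq_exp_diff_heat_kernel:
  assumes lm: "0 < l" "0 < m" "l \<noteq> m"
  shows "(\<integral>\<^sup>+ y. ennreal (Gk m (z - y) * Gk l y) \<partial>lborel)
       = (\<integral>\<^sup>+ v. ennreal (exp_diff_kernel l m v * heat_kernel v z) \<partial>lborel)"
proof -
  let ?e = "\<lambda>l s. ennreal (exp_decay l s)"
  let ?h = "\<lambda>s y :: R2. ennreal (heat_kernel s y)"
  have Gk: "ennreal (Gk l x) = (\<integral>\<^sup>+ s. ?e l s * ?h s x \<partial>lborel)" if "0 < l" "x \<noteq> 0" for l x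
    unfolding nn_integral_exp_heat_kernel[OF that, symmetric]
    by (intro nn_integral_cong) (simp add: exp_decay_def ennreal_mult'[symmetric] split: split_indicator)
  have "AE y in lborel. ennreal (Gk m (z - y) * Gk l y)
       = (\<integral>\<^sup>+ s. ?e l s * ?h s y \<partial>lborel) * (\<integral>\<^sup>+ r. ?e m r * ?h r (z - y) \<partial>lborel)"
    using AE_lborel_singleton[of 0] AE_lborel_singleton[of z]
    by eventually_elim (use lm in \<open>simp add: Gk[symmetric] ennreal_mult' mult.commute\<close>)
  then have "(\<integral>\<^sup>+ y. ennreal (Gk m (z - y) * Gk l y) \<partial>lborel)
     = (\<integral>\<^sup>+ y. (\<integral>\<^sup>+ s. ?e l s * ?h s y \<partial>lborel) * (\<integral>\<^sup>+ r. ?e m r * ?h r (z - y) \<partial>lborel) \<partial>lborel)"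
    by (rule nn_integral_cong_AE)
  also have "\<dots> = (\<integral>\<^sup>+ s. \<integral>\<^sup>+ r. \<integral>\<^sup>+ y. (?e l s * ?h s y) * (?e m r * ?h r (z - y)) \<partial>lborel \<partial>lborel \<partial>lborel)"
    by (rule nn_integral_mult_nn_integral) measurable
  also have "\<dots> = (\<integral>\<^sup>+ s. \<integral>\<^sup>+ r. ?e l s * (?e m r * ?h (s + r) z) \<partial>lborel \<partial>lborel)"
  proof -
    have pair: "(\<integral>\<^sup>+ y. (?e l s * ?h s y) * (?e m r * ?h r (z - y)) \<partial>lborel)
         = ?e l s * (?e m r * ?h (s + r) z)" if "s \<noteq> 0" "r \<noteq> 0" for s r
    proof (cases "0 < s \<and> 0 < r")
      case True
      have "(\<integral>\<^sup>+ y. (?e l s * ?h s y) * (?e m r * ?h r (z - y)) \<partial>lborel)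
           = (?e l s * ?e m r) * (\<integral>\<^sup>+ y. ?h r (z - y) * ?h s y \<partial>lborel)"
        by (subst nn_integral_cmult[symmetric]) (simp_all add: mult_ac)
      then show ?thesis using True by (simp add: nn_integral_heat_kernel_mult add.commute mult.assoc)
    qed (use that in auto)
    have "AE s in lborel. (\<integral>\<^sup>+ r. \<integral>\<^sup>+ y. (?e l s * ?h s y) * (?e m r * ?h r (z - y)) \<partial>lborel \<partial>lborel)
         = (\<integral>\<^sup>+ r. ?e l s * (?e m r * ?h (s + r) z) \<partial>lborel)"
      using AE_lborel_singleton[of 0] by eventually_elim
        (intro nn_integral_cong_AE, use AE_lborel_singleton[of 0] in \<open>auto elim!: eventually_mono simp: pair\<close>)
    then show ?thesis by (rule nn_integral_cong_AE)
  qed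
  also have "\<dots> = (\<integral>\<^sup>+ s. ?e l s * (\<integral>\<^sup>+ r. ?e m r * ?h (s + r) z \<partial>lborel) \<partial>lborel)"
    by (simp add: nn_integral_cmult)
  also have "\<dots> = (\<integral>\<^sup>+ x. (\<integral>\<^sup>+ s. ?e l s * ?e m (x - s) \<partial>lborel) * ?h x z \<partial>lborel)"
    by (rule nn_integral_shift_pairing) measurable
  also have "\<dots> = (\<integral>\<^sup>+ v. ennreal (exp_diff_kernel l m v * heat_kernel v z) \<partial>lborel)"
    using nn_integral_exp_decay_convolution[OF lm(3)] by (simp add: ennreal_mult')
  finally show ?thesis .
qed

lemma
  assumes lm: "0 < l" "0 < m" "l \<noteq> m" and z: "z \<noteq> 0"
  shows nn_integral_Gk_mult: "(\<integral>\<^sup>+ y. ennreal (Gk m (z - y) * Gk l y) \<partial>lborel) = ennreal ((Gk l z - Gk m z) / (m - l))"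
    and Gk_difference_quotient_nonneg: "0 \<le> (Gk l z - Gk m z) / (m - l)"
  using nn_integral_exp_diff_kernel[OF laplace_class_heat_kernel[OF z] _ lm]
    laplace_difference_quotient_nonneg[OF laplace_class_heat_kernel[OF z] _ lm]
    laplace_heat_kernel[OF _ z] lm
  by (simp_all add: nn_integral_Gk_mult_eq_exp_diff_heat_kernel)

lemma nn_integral_Gk_mult_0:
  assumes "0 < l" "0 < m" "l \<noteq> m"
  shows "(\<integral>\<^sup>+ y. ennreal (Gk m y * Gk l y) \<partial>lborel) = ennreal ((cc m - cc l) / (m - l))"
  using nn_integral_Gk_mult_eq_exp_diff_heat_kernel[OF assms, of 0] nn_integral_exp_diff_heat_kernel_0[OF assms] by simp

lemma nn_integral_Gk_le:
  assumes l: "0 < l"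
  shows "(\<integral>\<^sup>+ x. ennreal (Gk l x) \<partial>lborel) \<le> ennreal (1 / l)"
proof -
  have "(\<integral>\<^sup>+ x. ennreal (Gk l x) \<partial>lborel)
       = (\<integral>\<^sup>+ x. \<integral>\<^sup>+ s. ennreal (exp (- l * s) * heat_kernel s (x :: R2)) \<partial>lborel \<partial>lborel)"
    using AE_lborel_singleton[of 0]
    by (intro nn_integral_cong_AE) (auto elim!: eventually_mono simp: nn_integral_exp_heat_kernel[OF l, simplified])
  also have "\<dots> = (\<integral>\<^sup>+ s. \<integral>\<^sup>+ x. ennreal (exp (- l * s) * heat_kernel s (x :: R2)) \<partial>lborel \<partial>lborel)"
    by (rule lborel_Tonelli) measurable
  also have "\<dots> \<le> (\<integral>\<^sup>+ s. ennreal (exp_decay l s) \<partial>lborel)"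
  proof (rule nn_integral_mono)
    fix s
    show "(\<integral>\<^sup>+ x. ennreal (exp (- l * s) * heat_kernel s (x :: R2)) \<partial>lborel) \<le> ennreal (exp_decay l s)"
      by (cases "0 < s") (simp_all add: ennreal_mult' nn_integral_cmult nn_integral_heat_kernel exp_decay_def)
  qed
  finally show ?thesis by (simp add: nn_integral_exp_decay l)
qed

lemma Lp_mem_Gk:
  assumes l: "0 < l" and p: "1 \<le> p" "p \<le> 2"
  shows "Lp_mem p (Gk l)"
proof (rule Lp_mem_between)
  show "Lp_mem 1 (Gk l)"
    using le_less_trans[OF nn_integral_Gk_le[OF l]] by (simp add: Lp_mem_def)
  have "(\<integral>\<^sup>+ x. ennreal (norm (Gk l x) powr 2) \<partial>lborel) \<le> (\<integral>\<^sup>+ x. ennreal (Gk l x * Gk (l / 2) x) \<partial>lborel)"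
  proof (rule nn_integral_mono_AE)
    show "AE x in lborel. ennreal (norm (Gk l x) powr 2) \<le> ennreal (Gk l x * Gk (l / 2) x)"
      using AE_lborel_singleton[of 0]
      by eventually_elim (use l in \<open>auto simp: power2_eq_square intro!: ennreal_leI mult_left_mono Gk_antimono\<close>)
  qed
  also have "\<dots> < \<infinity>" using l by (simp add: nn_integral_Gk_mult_0)
  finally show "Lp_mem 2 (Gk l)" by (simp add: Lp_mem_def)
qed (use p in auto)

lemma Lp_norm_Gk_pos:
  assumes l: "0 < l"
  shows "0 < Lp_norm 2 (Gk l)"
proof (rule ccontr)
  assume "\<not> 0 < Lp_norm 2 (Gk l)"
  then have "Lp_norm 2 (Gk l) = 0" using Lp_norm_nonneg[of 2 "Gk l"] by linarith
  then have "(\<integral>\<^sup>+ x. ennreal (norm (Gk l x) powr 2) \<partial>lborel) = 0"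
    using nn_integral_Lp_norm[of 2 "Gk l"] Lp_mem_Gk[OF l, of 2] by simp
  then have "AE x in lborel. Gk l x = 0"
    by (subst (asm) nn_integral_0_iff_AE) (auto elim: eventually_mono)
  then have "(\<integral>\<^sup>+ y. ennreal (Gk (2 * l) y * Gk l y) \<partial>lborel) = 0"
    by (subst nn_integral_0_iff_AE) (auto elim!: eventually_mono)
  then show False
    using nn_integral_Gk_mult_0[of l "2 * l"] cc_difference_quotient_pos[of l "2 * l"] l by (simp add: ennreal_eq_0_iff)
qed

lemma has_bochner_integral_Gk_mult_0:
  assumes "0 < l" "0 < m" "l \<noteq> m"
  shows "has_bochner_integral lborel (\<lambda>y. Gk m y * Gk l y) ((cc m - cc l) / (m - l))"
  using nn_integral_Gk_mult_0[OF assms] cc_difference_quotient_pos[OF assms]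
  by (intro has_bochner_integral_nn_integral) auto

lemma has_bochner_integral_Gk_mult:
  assumes "0 < l" "0 < m" "l \<noteq> m" "z \<noteq> 0"
  shows "has_bochner_integral lborel (\<lambda>y. Gk m (z - y) * Gk l y) ((Gk l z - Gk m z) / (m - l))"
  using nn_integral_Gk_mult[OF assms] Gk_difference_quotient_nonneg[OF assms]
  by (intro has_bochner_integral_nn_integral) auto

section \<open>Time integrals of heat kernels\<close>

definition pos_powr :: "real \<Rightarrow> real \<Rightarrow> real" where
  "pos_powr b s = indicator {0<..} s * s powr (- b)"

lemma pos_powr_nonneg [simp]: "0 \<le> pos_powr b s"
  by (simp add: pos_powr_def)

lemma pos_powr_pos [simp]: "0 < s \<Longrightarrow> pos_powr b s = s powr (- b)"
  by (simp add: pos_powr_def)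

lemma pos_powr_nonpos [simp]: "s \<le> 0 \<Longrightarrow> pos_powr b s = 0"
  by (simp add: pos_powr_def)

lemma pos_powr_measurable [measurable]: "pos_powr b \<in> borel_measurable borel"
  unfolding pos_powr_def[abs_def] by measurable

lemma pos_powr_mult_scaled_powr:
  assumes "0 < c"
  shows "pos_powr k s * (c * s) powr d = c powr d * pos_powr (k - d) s"
proof (cases "0 < s")
  case True
  then show ?thesis using assms by (simp add: powr_mult powr_diff powr_minus_divide mult_ac)
qed simp

lemma pos_powr_le_scaled:
  assumes "0 \<le> b" "b \<le> 1" "1 \<le> c" "0 < s" and x: "s \<le> c * x"
  shows "pos_powr b x \<le> c * pos_powr b s"
proof -
  have "0 < x" using zero_less_mult_pos[of c x] assms by linarith
  have "x powr (- b) \<le> (s / c) powr (- b)" using assms by (intro powr_mono2') (auto simp: pos_divide_le_eq mult.commute)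
  also have "\<dots> = c powr b * s powr (- b)" using assms by (simp add: powr_divide powr_minus_divide)
  also have "\<dots> \<le> c powr 1 * s powr (- b)" using assms by (intro mult_right_mono powr_mono) auto
  finally show ?thesis using assms \<open>0 < x\<close> by simp
qed

lemma laplace_class_pos_powr_bound:
  assumes "v \<in> borel_measurable borel" and bound: "\<And>s. norm (v s) \<le> A * pos_powr b s" and "b < 1"
  shows "laplace_class v"
proof (rule laplace_class_powr_bound[where A = A and b = b])
  show "v s = 0" if "s \<le> 0" for s using bound[of s] that by simp
  show "norm (v s) \<le> A * s powr (- b)" if "0 < s" for s using bound[of s] that by simp
qed (use assms in auto)

lemma nn_integral_pos_powr:
  assumes "b < 1" "0 < s"
  shows "(\<integral>\<^sup>+ x. ennreal (pos_powr b x) * indicator {..<s} x \<partial>lborel) = ennreal (s powr (1 - b) / (1 - b))"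
proof -
  have "(\<integral>\<^sup>+ x. ennreal (pos_powr b x) * indicator {..<s} x \<partial>lborel)
       = (\<integral>\<^sup>+ x. ennreal (x powr (- b)) * indicator {0..s} x \<partial>lborel)"
    using AE_lborel_singleton[of s]
    by (intro nn_integral_cong_AE) (auto elim!: eventually_mono simp: pos_powr_def split: split_indicator)
  also have "\<dots> = ennreal (s powr (- b + 1) / (- b + 1))"
    using assms by (intro nn_integral_has_integral_lebesgue' has_integral_powr_from_0) auto
  finally show ?thesis by simp
qed

lemma nn_integral_convolution_halves_le:
  fixes k h :: "real \<Rightarrow> real"
  assumes [measurable]: "k \<in> borel_measurable borel" "h \<in> borel_measurable borel"
    and k: "\<And>r. 0 \<le> k r" "\<And>r. r \<le> 0 \<Longrightarrow> k r = 0" "\<And>r. s / 2 \<le> r \<Longrightarrow> k r \<le> K"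
    and h: "\<And>r. 0 \<le> h r" "\<And>r. r \<le> 0 \<Longrightarrow> h r = 0" "\<And>r. s / 2 \<le> r \<Longrightarrow> h r \<le> H"
    and K: "0 \<le> K" "(\<integral>\<^sup>+ r. ennreal (k r) * indicator {..<s} r \<partial>lborel) \<le> ennreal A" "0 \<le> A"
    and H: "0 \<le> H" "(\<integral>\<^sup>+ r. ennreal (h r) * indicator {..<s} r \<partial>lborel) \<le> ennreal B" "0 \<le> B"
  shows "(\<integral>\<^sup>+ r. ennreal (k (s - r) * h r) \<partial>lborel) \<le> ennreal (K * B + H * A)"
proof -
  let ?k = "\<lambda>r. ennreal (k r) * indicator {..<s} r" and ?h = "\<lambda>r. ennreal (h r) * indicator {..<s} r"
  have "(\<integral>\<^sup>+ r. ennreal (k (s - r) * h r) \<partial>lborel) \<le> (\<integral>\<^sup>+ r. ennreal K * ?h r + ennreal H * ?k (s - r) \<partial>lborel)"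
  proof (rule nn_integral_mono)
    fix r :: real
    consider "r \<le> 0 \<or> s \<le> r" | "0 < r" "r < s" "s / 2 \<le> s - r" | "0 < r" "r < s" "s / 2 \<le> r" by linarith
    then show "ennreal (k (s - r) * h r) \<le> ennreal K * ?h r + ennreal H * ?k (s - r)"
    proof cases
      case 2
      then have "ennreal (k (s - r) * h r) \<le> ennreal K * ?h r"
        using mult_right_mono[OF k(3)[OF 2(3)] h(1)] K by (simp add: ennreal_mult'[symmetric] ennreal_leI)
      then show ?thesis by (rule order_trans) simp
    next
      case 3
      then have "ennreal (k (s - r) * h r) \<le> ennreal H * ?k (s - r)"
        using mult_right_mono[OF h(3)[OF 3(3)] k(1)] H by (simp add: ennreal_mult'[symmetric] mult.commute ennreal_leI)
      then show ?thesis by (rule order_trans) simp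
    qed (auto simp: k h)
  qed
  also have "\<dots> = ennreal K * (\<integral>\<^sup>+ r. ?h r \<partial>lborel) + ennreal H * (\<integral>\<^sup>+ r. ?k (s - r) \<partial>lborel)"
    by (subst nn_integral_add) (auto intro!: arg_cong2[where f = plus] nn_integral_cmult)
  also have "(\<integral>\<^sup>+ r. ?k (s - r) \<partial>lborel) = (\<integral>\<^sup>+ r. ?k r \<partial>lborel)"
    by (rule nn_integral_lborel_reflect[of ?k]) measurable
  also have "ennreal K * (\<integral>\<^sup>+ r. ?h r \<partial>lborel) + ennreal H * (\<integral>\<^sup>+ r. ?k r \<partial>lborel) \<le> ennreal K * ennreal B + ennreal H * ennreal A"
    by (intro add_mono mult_left_mono K H) simp_all
  also have "\<dots> = ennreal (K * B + H * A)"
    using K H by (simp add: ennreal_mult'[symmetric] ennreal_plus[symmetric] del: ennreal_plus)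
  finally show ?thesis .
qed

lemma nn_integral_pos_powr_mult_le:
  assumes a: "0 \<le> a" "a < 1" and b: "0 \<le> b" "b < 1" and t: "0 < t"
  shows "(\<integral>\<^sup>+ x. ennreal (pos_powr a (t - x) * pos_powr b x) \<partial>lborel)
       \<le> ennreal ((2 / (1 - a) + 2 / (1 - b)) * t powr (1 - a - b))"
proof -
  have half: "pos_powr c r \<le> 2 * pos_powr c t" if "0 \<le> c" "c < 1" "t / 2 \<le> r" for c r
    using that t by (intro pos_powr_le_scaled) auto
  have "(\<integral>\<^sup>+ x. ennreal (pos_powr a (t - x) * pos_powr b x) \<partial>lborel)
     \<le> ennreal (2 * pos_powr a t * (t powr (1 - b) / (1 - b)) + 2 * pos_powr b t * (t powr (1 - a) / (1 - a)))"
    using a b t by (intro nn_integral_convolution_halves_le half) (simp_all add: nn_integral_pos_powr)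
  also have "2 * pos_powr a t * (t powr (1 - b) / (1 - b)) + 2 * pos_powr b t * (t powr (1 - a) / (1 - a))
     = (2 / (1 - a) + 2 / (1 - b)) * t powr (1 - a - b)"
  proof -
    have "pos_powr a t * t powr (1 - b) = t powr (1 - a - b)" "pos_powr b t * t powr (1 - a) = t powr (1 - a - b)"
      using t by (simp_all add: powr_add[symmetric] algebra_simps)
    then show ?thesis by (simp add: distrib_right mult.assoc)
  qed
  finally show ?thesis .
qed

definition heat_kernel_Lp_const :: "real \<Rightarrow> real" where
  "heat_kernel_Lp_const p = ((4 * pi) powr (1 - p) / p) powr (1 / p)"

lemma
  assumes s: "0 < s" and p: "0 < p"
  shows Lp_mem_heat_kernel: "Lp_mem p (heat_kernel s)"
    and Lp_norm_heat_kernel_le: "Lp_norm p (heat_kernel s) \<le> heat_kernel_Lp_const p * s powr (1 / p - 1)"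
proof -
  have "(1 / p - 1) * p = 1 - p" using p by (simp add: field_simps)
  then have "(heat_kernel_Lp_const p * s powr (1 / p - 1)) powr p = (4 * pi) powr (1 - p) / p * s powr (1 - p)"
    using p by (simp add: heat_kernel_Lp_const_def powr_mult powr_powr)
  also have "\<dots> = (4 * pi * s) powr (1 - p) / p" using s by (simp add: powr_mult)
  finally have "(\<integral>\<^sup>+ x. ennreal (norm (heat_kernel s (x :: R2)) powr p) \<partial>lborel)
       \<le> ennreal ((heat_kernel_Lp_const p * s powr (1 / p - 1)) powr p)"
    using nn_integral_heat_kernel_powr[where 'a = R2, OF s p] s p by simp
  moreover have "0 \<le> heat_kernel_Lp_const p * s powr (1 / p - 1)" by (simp add: heat_kernel_Lp_const_def)
  ultimately show "Lp_mem p (heat_kernel s)" "Lp_norm p (heat_kernel s) \<le> heat_kernel_Lp_const p * s powr (1 / p - 1)"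
    using p Lp_boundI[of "heat_kernel s" "heat_kernel_Lp_const p * s powr (1 / p - 1)" p] by simp_all
qed

definition heat_convolution_const :: "real \<Rightarrow> real \<Rightarrow> real \<Rightarrow> real \<Rightarrow> real" where
  "heat_convolution_const p k b c = heat_kernel_Lp_const p * c powr (1 / p - 1) * (2 / (1 / p - k) + 2 / (1 - b))"

lemma heat_convolution_const_pos:
  assumes "1 < p" "p * k < 1" "b < 1" "0 < c"
  shows "0 < heat_convolution_const p k b c"
proof -
  have "0 < 1 / p - k" using assms by (simp add: field_simps)
  then show ?thesis
    using assms by (simp add: heat_convolution_const_def heat_kernel_Lp_const_def add_pos_pos)
qed

text \<open>The condition \<open>p * k < 1\<close> makes the \<open>L\<^sup>p\<close> norm of \<open>s powr (- k) * heat_kernel s\<close>, a multiple of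
  \<open>s powr (1 / p - 1 - k)\<close>, integrable in \<open>s\<close> near 0.\<close>
lemma Lp_heat_kernel_time_integral:
  fixes g :: "real \<Rightarrow> R2 \<Rightarrow> 'b::{banach, second_countable_topology}"
  assumes [measurable]: "case_prod g \<in> borel_measurable (lborel \<Otimes>\<^sub>M lborel)"
    and p: "1 < p" and k: "0 \<le> k" "p * k < 1" and b: "0 \<le> b" "b < 1" and c: "0 < c" and t: "0 < t" and M: "0 \<le> M"
    and g: "\<And>\<tau> x. norm (g \<tau> x) \<le> M * (pos_powr k (t - \<tau>) * heat_kernel (c * (t - \<tau>)) x * pos_powr b \<tau>)"
  shows "Lp_mem p (\<lambda>x. \<integral>\<tau>. g \<tau> x \<partial>lborel)"
    and "Lp_norm p (\<lambda>x. \<integral>\<tau>. g \<tau> x \<partial>lborel) \<le> heat_convolution_const p k b c * M * t powr (1 / p - k - b)"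
proof -
  define a where "a = k + 1 - 1 / p"
  have "k < 1 / p" "1 / p < 1" using p k by (auto simp: field_simps)
  then have a: "0 \<le> a" "a < 1" using k by (auto simp: a_def)
  define w N where "w \<tau> = M * (pos_powr k (t - \<tau>) * pos_powr b \<tau>)"
    and "N \<tau> = heat_kernel_Lp_const p * (c * (t - \<tau>)) powr (1 / p - 1)" for \<tau>
  define A where "A = M * (heat_kernel_Lp_const p * c powr (1 / p - 1))"
  define W where "W = heat_convolution_const p k b c * M * t powr (1 / p - k - b)"
  have A: "0 \<le> A" using M p by (simp add: A_def heat_kernel_Lp_const_def)
  have w: "0 \<le> w \<tau>" "0 \<le> N \<tau>" for \<tau> using M p by (simp_all add: w_def N_def heat_kernel_Lp_const_def)
  have before: "\<tau> < t" if "0 < w \<tau>" for \<tau> using that by (cases "\<tau> < t") (auto simp: w_def)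
  have [measurable]: "w \<in> borel_measurable borel" "N \<in> borel_measurable borel"
    unfolding w_def[abs_def] N_def[abs_def] by measurable
  have "k - (1 / p - 1) = a" by (simp add: a_def)
  then have "w \<tau> * N \<tau> = A * (pos_powr a (t - \<tau>) * pos_powr b \<tau>)" for \<tau>
    using pos_powr_mult_scaled_powr[OF c, of k "t - \<tau>" "1 / p - 1"] by (simp add: w_def N_def A_def mult_ac)
  then have "(\<integral>\<^sup>+ \<tau>. ennreal (w \<tau> * N \<tau>) \<partial>lborel)
      = ennreal A * (\<integral>\<^sup>+ \<tau>. ennreal (pos_powr a (t - \<tau>) * pos_powr b \<tau>) \<partial>lborel)"
    using A by (simp add: ennreal_mult' nn_integral_cmult)
  also have "\<dots> \<le> ennreal A * ennreal ((2 / (1 - a) + 2 / (1 - b)) * t powr (1 - a - b))"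
    by (intro mult_left_mono nn_integral_pos_powr_mult_le a b t) simp
  also have "\<dots> = ennreal W"
    using A by (simp add: ennreal_mult'[symmetric] W_def A_def a_def heat_convolution_const_def mult_ac)
  finally have wN: "(\<integral>\<^sup>+ \<tau>. ennreal (w \<tau> * N \<tau>) \<partial>lborel) \<le> ennreal W" .
  have "Lp_mem p (\<lambda>x. \<integral>\<tau>. g \<tau> x \<partial>lborel) \<and> Lp_norm p (\<lambda>x. \<integral>\<tau>. g \<tau> x \<partial>lborel) \<le> W"
  proof (cases "M = 0")
    case True
    then have "g \<tau> x = 0" for \<tau> x using g[of \<tau> x] by simp
    then show ?thesis using p by (auto intro!: Lp_boundI simp: W_def True)
  next
    case False
    then have "0 < W" using M t heat_convolution_const_pos[OF p k(2) b(2) c] by (simp add: W_def)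
    moreover have "0 < N \<tau>" "Lp_mem p (heat_kernel (c * (t - \<tau>)))"
        "Lp_norm p (heat_kernel (c * (t - \<tau>))) \<le> N \<tau>" if "0 < w \<tau>" for \<tau>
      using before[OF that] c p Lp_mem_heat_kernel[of "c * (t - \<tau>)" p] Lp_norm_heat_kernel_le[of "c * (t - \<tau>)" p]
      by (simp_all add: N_def heat_kernel_Lp_const_def)
    moreover have "norm (g \<tau> x) \<le> w \<tau> * norm (heat_kernel (c * (t - \<tau>)) x)" for \<tau> x
      using g[of \<tau> x] by (simp add: w_def mult_ac)
    ultimately show ?thesis
      using p w wN Minkowski_integral_inequality[of g w N "\<lambda>\<tau>. heat_kernel (c * (t - \<tau>))" p W] by simp
  qed
  then show "Lp_mem p (\<lambda>x. \<integral>\<tau>. g \<tau> x \<partial>lborel)"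
    "Lp_norm p (\<lambda>x. \<integral>\<tau>. g \<tau> x \<partial>lborel) \<le> heat_convolution_const p k b c * M * t powr (1 / p - k - b)"
    by (auto simp: W_def)
qed

section \<open>Heat flow and free resolvent\<close>

lemma nn_integral_heat_kernel_mult_le:
  fixes f :: "R2 \<Rightarrow> 'b::real_normed_vector"
  assumes f: "Lp_mem p f" and p: "1 < p" and s: "0 < s"
  shows "(\<integral>\<^sup>+ y. ennreal (heat_kernel s (x - y) * norm (f y)) \<partial>lborel) \<le> ennreal (Lp_norm p f * s powr (- (1 / p)))"
proof -
  have "(\<integral>\<^sup>+ y. ennreal (heat_kernel s (x - y) * norm (f y)) \<partial>lborel)
     \<le> ennreal (1 powr (1 - 1 / p) * (1 / (4 * pi * s)) powr (1 / p) * Lp_norm p f)"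
    by (rule nn_integral_convolve_le_Lp[OF _ f p])
      (use s heat_kernel_le[of s "_ :: R2"] in \<open>auto simp: nn_integral_heat_kernel\<close>)
  also have "\<dots> \<le> ennreal (Lp_norm p f * s powr (- (1 / p)))"
  proof (rule ennreal_leI)
    have "1 / (4 * pi * s) \<le> 1 / s" using s pi_gt3 by (intro divide_left_mono) auto
    then have "(1 / (4 * pi * s)) powr (1 / p) \<le> (1 / s) powr (1 / p)" using s p by (intro powr_mono2) auto
    also have "\<dots> = s powr (- (1 / p))" using s by (simp add: powr_divide powr_minus_divide)
    finally show "1 powr (1 - 1 / p) * (1 / (4 * pi * s)) powr (1 / p) * Lp_norm p f \<le> Lp_norm p f * s powr (- (1 / p))"
      by (simp add: mult.commute mult_left_mono)
  qed
  finally show ?thesis .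
qed

lemma heat_integrable:
  fixes f :: "R2 \<Rightarrow> 'b::{banach, second_countable_topology}"
  assumes f [measurable]: "Lp_mem p f" and "1 < p" "0 < s"
  shows "integrable lborel (\<lambda>y. heat_kernel s (x - y) *\<^sub>R f y)"
  using le_less_trans[OF nn_integral_heat_kernel_mult_le[OF assms, of x]]
  by (intro integrableI_bounded) (auto simp: ennreal_less_top)

lemma heat_nonpos [simp]: "s \<le> 0 \<Longrightarrow> convolve (heat_kernel s) f x = 0"
  by (simp add: convolve_def)

lemma norm_heat_le:
  assumes f: "Lp_mem p f" and p: "1 < p"
  shows "norm (convolve (heat_kernel s) f x) \<le> Lp_norm p f * pos_powr (1 / p) s"
proof (cases "0 < s")
  case True
  have "ennreal (norm (convolve (heat_kernel s) f x)) \<le> (\<integral>\<^sup>+ y. ennreal (heat_kernel s (x - y) * norm (f y)) \<partial>lborel)"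
    using norm_convolve_le[of "heat_kernel s" f x] by simp
  also have "\<dots> \<le> ennreal (Lp_norm p f * pos_powr (1 / p) s)"
    using nn_integral_heat_kernel_mult_le[OF f p True] True by simp
  finally show ?thesis by simp
qed simp

lemma
  fixes f :: "R2 \<Rightarrow> 'b::{banach, second_countable_topology}"
  assumes "Lp_mem p f" "1 < p" "0 < s"
  shows Lp_mem_heat: "Lp_mem p (convolve (heat_kernel s) f)"
    and Lp_norm_heat_le: "Lp_norm p (convolve (heat_kernel s) f) \<le> Lp_norm p f"
  using Lp_convolve[of "heat_kernel s" p f 1] assms by (simp_all add: nn_integral_heat_kernel)

lemma laplace_class_heat:
  fixes f :: "R2 \<Rightarrow> 'b::{banach, second_countable_topology}"
  assumes f [measurable]: "Lp_mem p f" and p: "1 < p"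
  shows "laplace_class (\<lambda>s. convolve (heat_kernel s) f x)"
  by (rule laplace_class_pos_powr_bound[OF _ norm_heat_le[OF f p]]) (use p in auto)

lemma
  fixes f :: "R2 \<Rightarrow> 'b::{banach, second_countable_topology}"
  assumes f [measurable]: "Lp_mem p f" and p: "1 < p" and l: "0 < l"
  shows integrable_Gk_scaleR: "integrable lborel (\<lambda>y. Gk l (x - y) *\<^sub>R f y)"
    and laplace_heat: "laplace (\<lambda>s. convolve (heat_kernel s) f x) l = convolve (Gk l) f x"
proof -
  have fin: "(\<integral>\<^sup>+ s. \<integral>\<^sup>+ y. ennreal (\<bar>exp (- l * s)\<bar> * (\<bar>heat_kernel s (x - y)\<bar> * norm (f y))) \<partial>lborel \<partial>lborel) < \<infinity>"
  proof -
    have "(\<integral>\<^sup>+ s. \<integral>\<^sup>+ y. ennreal (\<bar>exp (- l * s)\<bar> * (\<bar>heat_kernel s (x - y)\<bar> * norm (f y))) \<partial>lborel \<partial>lborel)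
       \<le> (\<integral>\<^sup>+ s. ennreal (Lp_norm p f) * ennreal (s powr ((1 - 1 / p) - 1) * exp_decay l s) \<partial>lborel)"
    proof (rule nn_integral_mono)
      fix s :: real
      show "(\<integral>\<^sup>+ y. ennreal (\<bar>exp (- l * s)\<bar> * (\<bar>heat_kernel s (x - y)\<bar> * norm (f y))) \<partial>lborel)
         \<le> ennreal (Lp_norm p f) * ennreal (s powr ((1 - 1 / p) - 1) * exp_decay l s)"
      proof (cases "0 < s")
        case True
        have "(\<integral>\<^sup>+ y. ennreal (\<bar>exp (- l * s)\<bar> * (\<bar>heat_kernel s (x - y)\<bar> * norm (f y))) \<partial>lborel)
            = ennreal (exp (- l * s)) * (\<integral>\<^sup>+ y. ennreal (heat_kernel s (x - y) * norm (f y)) \<partial>lborel)"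
          by (simp add: ennreal_mult' nn_integral_cmult)
        also have "\<dots> \<le> ennreal (exp (- l * s)) * ennreal (Lp_norm p f * s powr (- (1 / p)))"
          by (intro mult_left_mono nn_integral_heat_kernel_mult_le[OF f p True]) simp
        finally show ?thesis using True by (simp add: exp_decay_def ennreal_mult'[symmetric] mult_ac)
      qed simp
    qed
    also have "\<dots> = ennreal (Lp_norm p f) * ennreal (Gamma (1 - 1 / p) / l powr (1 - 1 / p))"
      using p l by (subst nn_integral_cmult)
        (simp_all only: nn_integral_powr_exp_decay diff_gt_0_iff_gt divide_less_eq_1_pos, measurable)
    also have "\<dots> < \<infinity>" by (simp add: ennreal_mult_less_top)
    finally show ?thesis .
  qed
  have Gk_average: "AE y in lborel. has_bochner_integral lborel (\<lambda>s. exp (- l * s) * heat_kernel s (x - y)) (Gk l (x - y))"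
    using AE_lborel_singleton[of x]
  proof eventually_elim
    case (elim y)
    then show ?case using l nn_integral_exp_heat_kernel[of l "x - y"] by (intro has_bochner_integral_nn_integral) auto
  qed
  show "integrable lborel (\<lambda>y. Gk l (x - y) *\<^sub>R f y)"
    by (rule convolve_kernel_average(1)[OF _ _ _ _ fin Gk_average]) measurable
  show "laplace (\<lambda>s. convolve (heat_kernel s) f x) l = convolve (Gk l) f x"
    unfolding laplace_def by (rule convolve_kernel_average(2)[OF _ _ _ _ fin Gk_average]) measurable
qed

lemma
  fixes f :: "R2 \<Rightarrow> 'b::{banach, second_countable_topology}"
  assumes f [measurable]: "Lp_mem p f" and p: "1 < p" and lm: "0 < l" "0 < m" "l \<noteq> m"
  shows integrable_Gk_scaleR_convolve_Gk: "integrable lborel (\<lambda>y. Gk m (x - y) *\<^sub>R convolve (Gk l) f y)"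
    and convolve_Gk_Gk: "convolve (Gk m) (convolve (Gk l) f) x
        = (convolve (Gk l) f x - convolve (Gk m) f x) /\<^sub>R (m - l)"
proof -
  define H where "H z = (Gk l z - Gk m z) / (m - l)" for z
  have [measurable]: "H \<in> borel_measurable borel" unfolding H_def[abs_def] by measurable
  have H: "AE z in lborel. 0 \<le> H (x - z) \<and> (\<integral>\<^sup>+ y. ennreal (Gk m (x - y) * Gk l (y - z)) \<partial>lborel) = ennreal (H (x - z))"
    using AE_lborel_singleton[of x]
  proof eventually_elim
    case (elim z)
    have "(\<integral>\<^sup>+ y. ennreal (Gk m (x - y) * Gk l (y - z)) \<partial>lborel) = (\<integral>\<^sup>+ y. ennreal (Gk m (x - z - y) * Gk l y) \<partial>lborel)"
      using nn_integral_lborel_shift[of "\<lambda>y. ennreal (Gk m (x - z - y) * Gk l y)" "- z"] by simp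
    then show ?case
      using elim nn_integral_Gk_mult[OF lm, of "x - z"] Gk_difference_quotient_nonneg[OF lm, of "x - z"]
      by (simp add: H_def)
  qed
  have H_scaleR: "H (x - z) *\<^sub>R f z = (Gk l (x - z) *\<^sub>R f z - Gk m (x - z) *\<^sub>R f z) /\<^sub>R (m - l)" for z
    by (simp add: H_def divide_inverse_commute scaleR_diff_left[symmetric] scaleR_diff_right[symmetric])
  note int = integrable_Gk_scaleR[OF f p lm(1), of x] integrable_Gk_scaleR[OF f p lm(2), of x]
  have H_int: "integrable lborel (\<lambda>z. H (x - z) *\<^sub>R f z)"
    unfolding H_scaleR using int by (intro integrable_scaleR_right impI Bochner_Integration.integrable_diff)
  show "integrable lborel (\<lambda>y. Gk m (x - y) *\<^sub>R convolve (Gk l) f y)"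
    by (rule convolve_convolve(1)[OF _ _ _ _ _ _ H H_int]) auto
  have "convolve (Gk m) (convolve (Gk l) f) x = convolve H f x"
    by (rule convolve_convolve(2)[OF _ _ _ _ _ _ H H_int]) auto
  also have "\<dots> = (convolve (Gk l) f x - convolve (Gk m) f x) /\<^sub>R (m - l)"
    unfolding convolve_def H_scaleR integral_scaleR_right using int by simp
  finally show "convolve (Gk m) (convolve (Gk l) f) x = (convolve (Gk l) f x - convolve (Gk m) f x) /\<^sub>R (m - l)" .
qed

lemma eventually_within_factor_2:
  fixes t :: real
  assumes "0 < t"
  shows "\<forall>\<^sub>F s in at t. t / 2 \<le> s \<and> s \<le> 2 * t"
  using eventually_at_in_open'[of "{t / 2 <..< 2 * t}" t] assms by (auto elim: eventually_mono)

lemma heat_isCont: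
  fixes f :: "R2 \<Rightarrow> 'b::{banach, second_countable_topology}"
  assumes f [measurable]: "Lp_mem p f" and p: "1 < p" and t: "0 < t"
  shows "isCont (\<lambda>s. convolve (heat_kernel s) f x) t"
  unfolding convolve_def
proof (rule isCont_integral_dominated)
  show "integrable lborel (\<lambda>y. 4 * norm (heat_kernel (2 * t) (x - y) *\<^sub>R f y))"
    using t by (intro integrable_mult_right integrable_norm heat_integrable[OF f p]) auto
  show "AE y in lborel. isCont (\<lambda>s. heat_kernel s (x - y) *\<^sub>R f y) t"
    using heat_kernel_isCont[OF t] by (intro AE_I2 continuous_intros) auto
  show "\<forall>\<^sub>F s in at t. AE y in lborel. norm (heat_kernel s (x - y) *\<^sub>R f y)
       \<le> 4 * norm (heat_kernel (2 * t) (x - y) *\<^sub>R f y)"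
    using eventually_within_factor_2[OF t]
  proof eventually_elim
    case (elim s)
    then have "heat_kernel s (x - y) \<le> 4 * heat_kernel (2 * t) (x - y)" for y
      using heat_kernel_le_dilated[OF t, of s "x - y"] by simp
    then show ?case by (intro AE_I2) (simp add: mult.assoc[symmetric] mult_right_mono)
  qed
qed measurable

section \<open>The point-interaction evolution\<close>

definition charge :: "real \<Rightarrow> (real \<Rightarrow> 'b::{banach, second_countable_topology}) \<Rightarrow> real \<Rightarrow> 'b" where
  "charge E a s = convolve (memory_kernel E) a s - (4 * pi * E) *\<^sub>R shift_resolvent E a s"

lemma charge_measurable [measurable]:
  assumes [measurable]: "a \<in> borel_measurable borel"
  shows "charge E a \<in> borel_measurable borel"
  unfolding charge_def[abs_def] by measurable

lemma laplace_class_charge: "laplace_class a \<Longrightarrow> 0 < E \<Longrightarrow> laplace_class (charge E a)"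
  unfolding charge_def[abs_def]
  by (intro laplace_class_diff laplace_class_scaleR laplace_class_shift_resolvent
    laplace_class_convolve laplace_class_memory_kernel)

lemma laplace_charge:
  assumes a: "laplace_class a" and E: "0 < E" and aE: "laplace a E = 0" and l: "0 < l" "l \<noteq> E"
  shows "laplace (charge E a) l = (4 * pi / ln (l / E)) *\<^sub>R laplace a l"
proof -
  note K = laplace_class_memory_kernel[OF E]
  have "laplace (charge E a) l
       = laplace (convolve (memory_kernel E) a) l - (4 * pi * E) *\<^sub>R laplace (shift_resolvent E a) l"
    unfolding charge_def[abs_def] laplace_scaleR[symmetric]
    by (intro laplace_diff laplace_class_scaleR laplace_class_shift_resolvent laplace_class_convolve a E l K)
  also have "laplace (convolve (memory_kernel E) a) l = (4 * pi * (1 / ln (l / E) - E / (l - E))) *\<^sub>R laplace a l"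
    using laplace_convolve[OF K a l(1)] laplace_memory_kernel[OF E l] by simp
  also have "laplace (shift_resolvent E a) l = (- 1 / (l - E)) *\<^sub>R laplace a l"
    using laplace_shift_resolvent[OF a E l] aE minus_divide_right[of 1 "l - E"] by (simp add: inverse_eq_divide)
  finally show ?thesis
    by (simp add: scaleR_diff_left[symmetric] scaleR_add_left[symmetric] right_diff_distrib)
qed

lemma norm_shift_resolvent_le:
  assumes E: "0 < E" and b: "0 \<le> b" and A: "0 \<le> A" and bound: "\<And>s. norm (a s) \<le> A * pos_powr b s"
  shows "norm (shift_resolvent E a s) \<le> A * pos_powr b s / E"
proof (cases "0 < s")
  case True
  have "shift_resolvent E a s = laplace (\<lambda>r. indicator {0..} r *\<^sub>R a (s + r)) E"
    using True by (simp add: shift_resolvent_def laplace_def exp_decay_def mult.commute)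
  also have "norm \<dots> \<le> A * pos_powr b s / E"
  proof (rule norm_laplace_le[OF E])
    fix r :: real assume r: "0 \<le> r"
    then have "(s + r) powr (- b) \<le> s powr (- b)" using True b by (intro powr_mono2') auto
    then have "A * pos_powr b (s + r) \<le> A * pos_powr b s" using A r True by (intro mult_left_mono) simp_all
    then show "norm (indicator {0..} r *\<^sub>R a (s + r)) \<le> A * pos_powr b s" using bound[of "s + r"] r by simp
  qed simp
  finally show ?thesis .
qed simp

lemma nn_integral_memory_kernel_pos_powr_le:
  assumes E: "0 < E" and b: "0 \<le> b" "b < 1" and s: "0 < s"
  shows "(\<integral>\<^sup>+ r. ennreal (memory_kernel E (s - r) * pos_powr b r) \<partial>lborel)
       \<le> ennreal ((8 * pi + 8 / (pi * (1 - b))) * pos_powr b s)"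
proof -
  have "memory_kernel E r \<le> 8 / (pi * s)" if "s / 2 \<le> r" for r
    using memory_kernel_antimono[of "s / 2" r E] memory_kernel_le[of "s / 2" E] that s by simp
  moreover have "pos_powr b r \<le> 2 * pos_powr b s" if "s / 2 \<le> r" for r
    using that b s by (intro pos_powr_le_scaled) auto
  moreover have "(\<integral>\<^sup>+ r. ennreal (memory_kernel E r) * indicator {..<s} r \<partial>lborel) \<le> ennreal (4 * pi)"
    unfolding nn_integral_memory_kernel[OF E, symmetric] by (intro nn_integral_mono) (simp split: split_indicator)
  ultimately have "(\<integral>\<^sup>+ r. ennreal (memory_kernel E (s - r) * pos_powr b r) \<partial>lborel)
     \<le> ennreal (8 / (pi * s) * (s powr (1 - b) / (1 - b)) + 2 * pos_powr b s * (4 * pi))"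
    using b s by (intro nn_integral_convolution_halves_le) (simp_all add: nn_integral_pos_powr)
  also have "8 / (pi * s) * (s powr (1 - b) / (1 - b)) + 2 * pos_powr b s * (4 * pi)
       = (8 * pi + 8 / (pi * (1 - b))) * pos_powr b s"
  proof -
    have "s powr (1 - b) = s * pos_powr b s" using s by (simp add: powr_diff powr_minus_divide)
    then show ?thesis using s by (simp add: distrib_right)
  qed
  finally show ?thesis .
qed

lemma norm_convolve_memory_kernel_le:
  assumes E: "0 < E" and b: "0 \<le> b" "b < 1" and A: "0 \<le> A" and bound: "\<And>s. norm (a s) \<le> A * pos_powr b s"
  shows "norm (convolve (memory_kernel E) a s) \<le> (8 * pi + 8 / (pi * (1 - b))) * (A * pos_powr b s)"
proof (cases "0 < s")
  case True
  have "ennreal (norm (convolve (memory_kernel E) a s))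
       \<le> (\<integral>\<^sup>+ r. ennreal (\<bar>memory_kernel E (s - r)\<bar> * norm (a r)) \<partial>lborel)"
    by (rule norm_convolve_le)
  also have "\<dots> \<le> (\<integral>\<^sup>+ r. ennreal A * ennreal (memory_kernel E (s - r) * pos_powr b r) \<partial>lborel)"
    using mult_left_mono[OF bound] A
    by (intro nn_integral_mono) (simp add: ennreal_mult'[symmetric] ennreal_leI mult.left_commute[of A])
  also have "\<dots> = ennreal A * (\<integral>\<^sup>+ r. ennreal (memory_kernel E (s - r) * pos_powr b r) \<partial>lborel)"
    by (simp add: nn_integral_cmult)
  also have "\<dots> \<le> ennreal A * ennreal ((8 * pi + 8 / (pi * (1 - b))) * pos_powr b s)"
    by (intro mult_left_mono nn_integral_memory_kernel_pos_powr_le E b True) simp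
  also have "\<dots> = ennreal ((8 * pi + 8 / (pi * (1 - b))) * (A * pos_powr b s))"
    using A by (simp add: ennreal_mult'[symmetric] mult.left_commute)
  finally show ?thesis using A b by (simp add: ennreal_le_iff)
next
  case False
  have "a r = 0" if "r \<le> 0" for r using bound[of r] that by simp
  then show ?thesis using False by (simp add: convolve_eq_0_nonpos)
qed

definition charge_const :: "real \<Rightarrow> real" where
  "charge_const b = 12 * pi + 8 / (pi * (1 - b))"

lemma norm_charge_le:
  assumes E: "0 < E" and b: "0 \<le> b" "b < 1" and A: "0 \<le> A" and bound: "\<And>s. norm (a s) \<le> A * pos_powr b s"
  shows "norm (charge E a s) \<le> charge_const b * A * pos_powr b s"
proof -
  have "norm ((4 * pi * E) *\<^sub>R shift_resolvent E a s) \<le> 4 * pi * E * (A * pos_powr b s / E)"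
    unfolding norm_scaleR using E by (simp only: abs_of_pos mult_pos_pos pi_gt_zero zero_less_numeral)
      (intro mult_left_mono norm_shift_resolvent_le[OF E b(1) A bound], simp)
  also have "\<dots> = 4 * pi * (A * pos_powr b s)" using E by simp
  finally have "norm (charge E a s) \<le> (8 * pi + 8 / (pi * (1 - b))) * (A * pos_powr b s) + 4 * pi * (A * pos_powr b s)"
    unfolding charge_def using norm_convolve_memory_kernel_le[OF E b A bound]
    by (intro order_trans[OF norm_triangle_ineq4] add_mono)
  then show ?thesis by (simp add: charge_const_def algebra_simps)
qed

lemma shift_resolvent_isCont:
  assumes a: "laplace_class a" and E: "0 < E" and t: "0 < t"
  shows "isCont (shift_resolvent E a) t"
proof -
  have [measurable]: "a \<in> borel_measurable borel" using a by measurable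
  define J where "J s = (\<integral>r. indicator {s..} r *\<^sub>R exp (- E * r) *\<^sub>R a r \<partial>lborel)" for s
  have shift_eq: "shift_resolvent E a s = exp (E * s) *\<^sub>R J s" if "0 < s" for s
  proof -
    have "shift_resolvent E a s = (\<integral>r. exp_decay E (r - s) *\<^sub>R a r \<partial>lborel)"
      using that integral_lborel_shift[of "\<lambda>r. exp_decay E (r - s) *\<^sub>R a r" s] by (simp add: shift_resolvent_def)
    also have "\<dots> = (\<integral>r. exp (E * s) *\<^sub>R indicator {s..} r *\<^sub>R exp (- E * r) *\<^sub>R a r \<partial>lborel)"
      by (intro Bochner_Integration.integral_cong refl)
        (simp add: exp_decay_def exp_add[symmetric] algebra_simps split: split_indicator)
    finally show ?thesis unfolding J_def by (simp only: integral_scaleR_right)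
  qed
  have "isCont J t"
    unfolding J_def
  proof (rule isCont_integral_dominated)
    show "integrable lborel (\<lambda>r. norm (exp (- E * r) *\<^sub>R a r))"
      by (intro integrable_norm laplace_class_integrable a E)
    show "AE r in lborel. isCont (\<lambda>s. indicator {s..} r *\<^sub>R exp (- E * r) *\<^sub>R a r) t"
      using AE_lborel_singleton[of t]
    proof eventually_elim
      case (elim r)
      have "\<forall>\<^sub>F s in nhds t. s \<in> (if r < t then {r<..} else {..<r})"
        using elim by (intro eventually_nhds_in_open) auto
      then have "\<forall>\<^sub>F s in nhds t. indicator {s..} r *\<^sub>R exp (- E * r) *\<^sub>R a r
          = indicator {t..} r *\<^sub>R exp (- E * r) *\<^sub>R a r"
        by eventually_elim (use elim in \<open>auto split: split_indicator if_splits\<close>)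
      then show ?case by (subst isCont_cong[where g = "\<lambda>_. indicator {t..} r *\<^sub>R exp (- E * r) *\<^sub>R a r"]) simp_all
    qed
    show "\<forall>\<^sub>F s in at t. AE r in lborel. norm (indicator {s..} r *\<^sub>R exp (- E * r) *\<^sub>R a r)
         \<le> norm (exp (- E * r) *\<^sub>R a r)"
      by (intro always_eventually allI AE_I2) (simp split: split_indicator)
  qed measurable
  then have "isCont (\<lambda>s. exp (E * s) *\<^sub>R J s) t" by (intro continuous_intros)
  moreover have "\<forall>\<^sub>F s in nhds t. shift_resolvent E a s = exp (E * s) *\<^sub>R J s"
    using eventually_nhds_in_open[of "{0<..}" t] t by (auto elim!: eventually_mono simp: shift_eq)
  ultimately show ?thesis by (simp add: isCont_cong)
qed

lemma convolve_real_scaled: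
  assumes "0 < s"
  shows "convolve v w s = s *\<^sub>R (\<integral>\<theta>. v (s * (1 - \<theta>)) *\<^sub>R w (s * \<theta>) \<partial>lborel)"
  using lborel_integral_real_affine[of s "\<lambda>r. v (s - r) *\<^sub>R w r" 0] assms by (simp add: convolve_def right_diff_distrib)

lemma
  fixes w :: "real \<Rightarrow> 'b::{banach, second_countable_topology}"
  assumes [measurable]: "v \<in> borel_measurable borel" "w \<in> borel_measurable borel" and t: "0 < t" and \<sigma>: "0 < \<sigma>"
    and int: "integrable lborel (\<lambda>r. k (\<sigma> - r) * h r)"
    and v: "\<And>s r. t / 2 \<le> s \<Longrightarrow> s \<le> 2 * t \<Longrightarrow> \<bar>v (s * r)\<bar> \<le> k (\<sigma> * r)"
    and w: "\<And>s r. t / 2 \<le> s \<Longrightarrow> s \<le> 2 * t \<Longrightarrow> norm (w (s * r)) \<le> c * h (\<sigma> * r)"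
  shows norm_convolve_real_le: "t / 2 \<le> s \<Longrightarrow> s \<le> 2 * t
       \<Longrightarrow> norm (convolve v w s) \<le> s / \<sigma> * (c * (\<integral>r. k (\<sigma> - r) * h r \<partial>lborel))"
    and convolve_real_isCont: "(\<And>s. s \<noteq> 0 \<Longrightarrow> isCont v s) \<Longrightarrow> (\<And>s. s \<noteq> 0 \<Longrightarrow> isCont w s) \<Longrightarrow> isCont (convolve v w) t"
proof -
  let ?d = "\<lambda>\<theta>. c * (k (\<sigma> * (1 - \<theta>)) * h (\<sigma> * \<theta>))"
  have d_int: "integrable lborel ?d"
    using lborel_integrable_real_affine[OF int, of \<sigma> 0] \<sigma>
    by (intro integrable_mult_right) (simp add: right_diff_distrib)
  have d: "(\<integral>\<theta>. ?d \<theta> \<partial>lborel) = c * (\<integral>r. k (\<sigma> - r) * h r \<partial>lborel) / \<sigma>"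
    using lborel_integral_real_affine[of \<sigma> "\<lambda>r. k (\<sigma> - r) * h r" 0] \<sigma> by (simp add: right_diff_distrib)
  have bound: "norm (v (s * (1 - \<theta>)) *\<^sub>R w (s * \<theta>)) \<le> ?d \<theta>" if "t / 2 \<le> s" "s \<le> 2 * t" for s \<theta>
  proof -
    have "\<bar>v (s * (1 - \<theta>))\<bar> * norm (w (s * \<theta>)) \<le> k (\<sigma> * (1 - \<theta>)) * (c * h (\<sigma> * \<theta>))"
      using v[OF that] w[OF that] by (intro mult_mono order_trans[OF abs_ge_zero v[OF that]]) auto
    then show ?thesis by (simp add: mult.left_commute)
  qed
  show "norm (convolve v w s) \<le> s / \<sigma> * (c * (\<integral>r. k (\<sigma> - r) * h r \<partial>lborel))" if s: "t / 2 \<le> s" "s \<le> 2 * t"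
  proof -
    have "norm (convolve v w s) = s * norm (\<integral>\<theta>. v (s * (1 - \<theta>)) *\<^sub>R w (s * \<theta>) \<partial>lborel)"
      using s t by (simp add: convolve_real_scaled)
    also have "\<dots> \<le> s * (\<integral>\<theta>. ?d \<theta> \<partial>lborel)"
      using s t by (intro mult_left_mono norm_integral_le d_int bound) auto
    finally show ?thesis by (simp only: d) simp
  qed
  assume v_cont: "\<And>s. s \<noteq> 0 \<Longrightarrow> isCont v s" and w_cont: "\<And>s. s \<noteq> 0 \<Longrightarrow> isCont w s"
  have "isCont (\<lambda>s. \<integral>\<theta>. v (s * (1 - \<theta>)) *\<^sub>R w (s * \<theta>) \<partial>lborel) t"
  proof (rule isCont_integral_dominated[OF _ d_int])
    show "AE \<theta> in lborel. isCont (\<lambda>s. v (s * (1 - \<theta>)) *\<^sub>R w (s * \<theta>)) t"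
      using AE_lborel_singleton[of 0] AE_lborel_singleton[of 1]
    proof eventually_elim
      case (elim \<theta>)
      show ?case
        by (intro continuous_scaleR isCont_o2[OF _ v_cont] isCont_o2[OF _ w_cont] continuous_intros)
          (use t elim in auto)
    qed
    show "\<forall>\<^sub>F s in at t. AE \<theta> in lborel. norm (v (s * (1 - \<theta>)) *\<^sub>R w (s * \<theta>)) \<le> ?d \<theta>"
      using eventually_within_factor_2[OF t] by (rule eventually_mono) (intro AE_I2 bound, auto)
  qed measurable
  then have "isCont (\<lambda>s. s *\<^sub>R (\<integral>\<theta>. v (s * (1 - \<theta>)) *\<^sub>R w (s * \<theta>) \<partial>lborel)) t" by (intro continuous_intros)
  moreover have "\<forall>\<^sub>F s in nhds t. convolve v w s = s *\<^sub>R (\<integral>\<theta>. v (s * (1 - \<theta>)) *\<^sub>R w (s * \<theta>) \<partial>lborel)"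
    using eventually_nhds_in_open[of "{0<..}" t] t by (auto elim!: eventually_mono simp: convolve_real_scaled)
  ultimately show "isCont (convolve v w) t" by (simp add: isCont_cong)
qed

lemma isCont_nonzero_if_pos:
  fixes v :: "real \<Rightarrow> 'b::real_normed_vector"
  assumes "\<And>s. s \<le> 0 \<Longrightarrow> v s = 0" "\<And>s. 0 < s \<Longrightarrow> isCont v s" "s \<noteq> 0"
  shows "isCont v s"
proof (cases "0 < s")
  case False
  then have "\<forall>\<^sub>F s in nhds s. v s = 0"
    using eventually_nhds_in_open[of "{..<0}" s] assms(1,3) by (auto elim!: eventually_mono)
  then show ?thesis by (subst isCont_cong) auto
qed (use assms in auto)

lemma charge_isCont:
  assumes E: "0 < E" and b: "0 \<le> b" "b < 1" and t: "0 < t" and A: "0 \<le> A"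
    and [measurable]: "a \<in> borel_measurable borel" and bound: "\<And>s. norm (a s) \<le> A * pos_powr b s"
    and cont: "\<And>s. 0 < s \<Longrightarrow> isCont a s"
  shows "isCont (charge E a) t"
proof -
  have a0: "a s = 0" if "s \<le> 0" for s using bound[of s] that by simp
  have int: "integrable lborel (\<lambda>r. memory_kernel E (t / 2 - r) * pos_powr b r)"
    using le_less_trans[OF nn_integral_memory_kernel_pos_powr_le[OF E b, of "t / 2"]] t
    by (intro integrableI_nonneg) (auto simp: ennreal_less_top)
  have "isCont (convolve (memory_kernel E) a) t"
  proof (rule convolve_real_isCont[OF _ _ t _ int])
    fix s r assume s: "t / 2 \<le> s" "s \<le> 2 * t"
    show "\<bar>memory_kernel E (s * r)\<bar> \<le> memory_kernel E (t / 2 * r)"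
      using s t by (cases "0 < r") (auto intro!: memory_kernel_antimono mult_right_mono simp: mult_nonneg_nonpos)
    have "pos_powr b (s * r) \<le> pos_powr b (t / 2 * r)"
      using s t b by (cases "0 < r") (auto intro!: powr_mono2' mult_right_mono simp: mult_nonneg_nonpos)
    then show "norm (a (s * r)) \<le> A * pos_powr b (t / 2 * r)"
      using bound[of "s * r"] A by (meson mult_left_mono order_trans)
  next
    show "isCont (memory_kernel E) s" if "s \<noteq> 0" for s
      by (rule isCont_nonzero_if_pos[OF memory_kernel_nonpos memory_kernel_isCont that])
    show "isCont a s" if "s \<noteq> 0" for s
      by (rule isCont_nonzero_if_pos[OF a0 cont that])
  qed (use t in auto)
  moreover have "isCont (shift_resolvent E a) t"
    using b by (intro shift_resolvent_isCont laplace_class_pos_powr_bound[OF _ bound] E t) auto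
  ultimately show ?thesis unfolding charge_def[abs_def] by (intro continuous_intros)
qed

definition heat_charge :: "real \<Rightarrow> (R2 \<Rightarrow> 'b::{banach, second_countable_topology}) \<Rightarrow> real \<Rightarrow> 'b" where
  "heat_charge E f = charge E (\<lambda>s. convolve (heat_kernel s) f 0)"

lemma heat_charge_measurable [measurable]:
  assumes [measurable]: "f \<in> borel_measurable borel"
  shows "heat_charge E f \<in> borel_measurable borel"
  unfolding heat_charge_def by measurable

lemma
  assumes f [measurable]: "Lp_mem p f" and p: "1 < p" and E: "0 < E"
  shows norm_heat_charge_le: "norm (heat_charge E f s) \<le> charge_const (1 / p) * Lp_norm p f * pos_powr (1 / p) s"
    and heat_charge_isCont: "0 < t \<Longrightarrow> isCont (heat_charge E f) t"
    and laplace_class_heat_charge: "laplace_class (heat_charge E f)"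
  unfolding heat_charge_def
proof -
  have p': "0 \<le> 1 / p" "1 / p < 1" using p by auto
  have [measurable]: "(\<lambda>s. convolve (heat_kernel s) f 0) \<in> borel_measurable borel" by measurable
  note bound = norm_heat_le[OF f p]
  show "norm (charge E (\<lambda>s. convolve (heat_kernel s) f 0) s) \<le> charge_const (1 / p) * Lp_norm p f * pos_powr (1 / p) s"
    by (rule norm_charge_le[OF E p' _ bound]) simp
  show "isCont (charge E (\<lambda>s. convolve (heat_kernel s) f 0)) t" if "0 < t"
    by (rule charge_isCont[OF E p' that _ _ bound heat_isCont[OF f p]]) simp_all
  show "laplace_class (charge E (\<lambda>s. convolve (heat_kernel s) f 0))"
    by (rule laplace_class_charge[OF laplace_class_heat[OF f p] E])
qed

definition singular_part :: "real \<Rightarrow> (R2 \<Rightarrow> 'b::{banach, second_countable_topology}) \<Rightarrow> real \<Rightarrow> R2 \<Rightarrow> 'b" where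
  "singular_part E f s x = convolve (\<lambda>r. heat_kernel r x) (heat_charge E f) s"

lemma singular_part_measurable [measurable (raw)]:
  assumes [measurable]: "f \<in> borel_measurable borel" "g \<in> borel_measurable M" "h \<in> borel_measurable M"
  shows "(\<lambda>z. singular_part E f (g z) (h z)) \<in> borel_measurable M"
  unfolding singular_part_def by measurable

lemma singular_part_nonpos:
  assumes f: "Lp_mem p f" and p: "1 < p" and E: "0 < E" and "s \<le> 0"
  shows "singular_part E f s x = 0"
  unfolding singular_part_def
  by (intro convolve_eq_0_nonpos laplace_class_nonpos[OF laplace_class_heat_charge[OF f p E]] assms heat_kernel_nonpos)

lemma
  fixes f :: "R2 \<Rightarrow> 'b::{banach, second_countable_topology}"
  assumes f [measurable]: "Lp_mem p f" and p: "1 < p" and E: "0 < E" and s: "0 < s"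
  shows Lp_mem_singular_part: "Lp_mem p (singular_part E f s)"
    and Lp_norm_singular_part_le: "Lp_norm p (singular_part E f s)
        \<le> heat_convolution_const p 0 (1 / p) 1 * (charge_const (1 / p) * Lp_norm p f)"
proof -
  define M where "M = charge_const (1 / p) * Lp_norm p f"
  have M: "0 \<le> M" using p by (simp add: M_def charge_const_def)
  let ?g = "\<lambda>\<tau> x. heat_kernel (s - \<tau>) x *\<^sub>R heat_charge E f \<tau>"
  have g_le: "norm (?g \<tau> x) \<le> M * (pos_powr 0 (s - \<tau>) * heat_kernel (1 * (s - \<tau>)) x * pos_powr (1 / p) \<tau>)" for \<tau> x
  proof (cases "\<tau> < s")
    case True
    then show ?thesis
      using mult_left_mono[OF norm_heat_charge_le[OF f p E, of \<tau>] heat_kernel_nonneg[of "s - \<tau>" x]]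
      by (simp add: M_def mult_ac)
  qed simp
  have "case_prod ?g \<in> borel_measurable (lborel \<Otimes>\<^sub>M lborel)" by measurable
  note time_integral = Lp_heat_kernel_time_integral[OF this p _ _ _ _ _ s M g_le]
  show "Lp_mem p (singular_part E f s)"
    unfolding singular_part_def[abs_def] convolve_def using p by (intro time_integral(1)) auto
  have "Lp_norm p (\<lambda>x. \<integral>\<tau>. ?g \<tau> x \<partial>lborel) \<le> heat_convolution_const p 0 (1 / p) 1 * M * s powr (1 / p - 0 - 1 / p)"
    using p by (intro time_integral(2)) auto
  then show "Lp_norm p (singular_part E f s)
      \<le> heat_convolution_const p 0 (1 / p) 1 * (charge_const (1 / p) * Lp_norm p f)"
    using s by (simp add: singular_part_def[abs_def] convolve_def M_def)
qed

lemma integrable_heat_kernel_pos_powr: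
  assumes b: "b < 1" and s: "0 < s" and x: "x \<noteq> 0"
  shows "integrable lborel (\<lambda>r. heat_kernel (s - r) (x :: R2) * pos_powr b r)"
proof (rule Bochner_Integration.integrable_bound)
  have "(\<integral>\<^sup>+ r. ennreal (pos_powr b r * indicator {..<s} r) \<partial>lborel) = ennreal (s powr (1 - b) / (1 - b))"
    using nn_integral_pos_powr[OF b s] by (simp add: ennreal_mult' ennreal_indicator)
  then have "integrable lborel (\<lambda>r. pos_powr b r * indicator {..<s} r)"
    by (intro integrableI_nonneg) auto
  then show "integrable lborel (\<lambda>r. 1 / (pi * (norm x)\<^sup>2) * (pos_powr b r * indicator {..<s} r))"
    by (rule integrable_mult_right)
  show "AE r in lborel. norm (heat_kernel (s - r) x * pos_powr b r)
       \<le> norm (1 / (pi * (norm x)\<^sup>2) * (pos_powr b r * indicator {..<s} r))"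
    using mult_right_mono[OF heat_kernel_le_inverse_norm[OF x] pos_powr_nonneg]
    by (intro AE_I2) (auto simp: abs_mult split: split_indicator)
qed measurable

lemma
  fixes f :: "R2 \<Rightarrow> 'b::{banach, second_countable_topology}"
  assumes f [measurable]: "Lp_mem p f" and p: "1 < p" and E: "0 < E" and t: "0 < t" and x: "x \<noteq> 0"
  shows norm_singular_part_le: "t / 2 \<le> s \<Longrightarrow> s \<le> 2 * t \<Longrightarrow> norm (singular_part E f s x)
      \<le> 16 * charge_const (1 / p) * Lp_norm p f * (\<integral>r. heat_kernel (2 * t - r) x * pos_powr (1 / p) r \<partial>lborel)"
    and singular_part_isCont: "isCont (\<lambda>s. singular_part E f s x) t"
proof -
  define M where "M = charge_const (1 / p) * Lp_norm p f"
  have M: "0 \<le> M" using p by (simp add: M_def charge_const_def)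
  let ?I = "\<integral>r. heat_kernel (2 * t - r) x * pos_powr (1 / p) r \<partial>lborel"
  have int: "integrable lborel (\<lambda>r. (4 * heat_kernel (2 * t - r) x) * pos_powr (1 / p) r)"
    using integrable_heat_kernel_pos_powr[of "1 / p" "2 * t" x] p t x by (simp add: mult.assoc)
  have I: "(\<integral>r. (4 * heat_kernel (2 * t - r) x) * pos_powr (1 / p) r \<partial>lborel) = 4 * ?I" by (simp add: mult.assoc)
  have v: "\<bar>heat_kernel (s * r) x\<bar> \<le> 4 * heat_kernel (2 * t * r) x" if "t / 2 \<le> s" "s \<le> 2 * t" for s r
    using heat_kernel_mult_le_dilated[OF t that, of r x] by simp
  have w: "norm (heat_charge E f (s * r)) \<le> (4 * M) * pos_powr (1 / p) (2 * t * r)" if "t / 2 \<le> s" "s \<le> 2 * t" for s r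
  proof (cases "0 < r")
    case True
    then have "pos_powr (1 / p) (s * r) \<le> 4 * pos_powr (1 / p) (2 * t * r)"
      using that p t mult_right_mono[OF that(1), of r] by (intro pos_powr_le_scaled) auto
    then have "M * pos_powr (1 / p) (s * r) \<le> M * (4 * pos_powr (1 / p) (2 * t * r))" using M by (rule mult_left_mono)
    then show ?thesis using norm_heat_charge_le[OF f p E, of "s * r"] by (simp add: M_def[symmetric])
  next
    case False
    then show ?thesis
      using norm_heat_charge_le[OF f p E, of "s * r"] that t by (simp add: mult_nonneg_nonpos)
  qed
  show "norm (singular_part E f s x) \<le> 16 * charge_const (1 / p) * Lp_norm p f * ?I" if s: "t / 2 \<le> s" "s \<le> 2 * t"
  proof -
    have "norm (singular_part E f s x) \<le> s / (2 * t) * (16 * M * ?I)"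
      unfolding singular_part_def
      using norm_convolve_real_le[OF _ _ t _ int v w s] t by (simp add: I mult_ac)
    also have "\<dots> \<le> 1 * (16 * M * ?I)" using s t M by (intro mult_right_mono) auto
    finally show ?thesis by (simp add: M_def mult.assoc)
  qed
  show "isCont (\<lambda>s. singular_part E f s x) t"
    unfolding singular_part_def
  proof (rule convolve_real_isCont[OF _ _ t _ int v w])
    show "isCont (\<lambda>r. heat_kernel r x) s" if "s \<noteq> 0" for s
      using that by (intro isCont_nonzero_if_pos[OF _ heat_kernel_isCont]) auto
    show "isCont (heat_charge E f) s" if "s \<noteq> 0" for s
      by (rule isCont_nonzero_if_pos[OF laplace_class_nonpos[OF laplace_class_heat_charge[OF f p E]]
        heat_charge_isCont[OF f p E] that])
  qed (use t in auto)
qed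

definition evol :: "real \<Rightarrow> (R2 \<Rightarrow> 'b::{banach, second_countable_topology}) \<Rightarrow> real \<Rightarrow> R2 \<Rightarrow> 'b" where
  "evol E f s x = convolve (heat_kernel s) f x + singular_part E f s x"

lemma evol_measurable [measurable (raw)]:
  assumes [measurable]: "f \<in> borel_measurable borel" "g \<in> borel_measurable M" "h \<in> borel_measurable M"
  shows "(\<lambda>z. evol E f (g z) (h z)) \<in> borel_measurable M"
  unfolding evol_def by measurable

definition evol_const :: "real \<Rightarrow> real" where
  "evol_const p = 1 + heat_convolution_const p 0 (1 / p) 1 * charge_const (1 / p)"

lemma evol_const_pos: "1 < p \<Longrightarrow> 0 < evol_const p"
  using heat_convolution_const_pos[of p 0 "1 / p" 1] by (simp add: evol_const_def charge_const_def add_pos_nonneg)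

lemma
  fixes f :: "R2 \<Rightarrow> 'b::{banach, second_countable_topology}"
  assumes f: "Lp_mem p f" and p: "1 < p" and E: "0 < E"
  shows laplace_class_evol: "x \<noteq> 0 \<Longrightarrow> laplace_class (\<lambda>s. evol E f s x)"
    and evol_isCont: "0 < t \<Longrightarrow> x \<noteq> 0 \<Longrightarrow> isCont (\<lambda>s. evol E f s x) t"
    and evol_nonpos: "s \<le> 0 \<Longrightarrow> evol E f s x = 0"
proof -
  show "laplace_class (\<lambda>s. evol E f s x)" if "x \<noteq> 0"
    unfolding evol_def singular_part_def using that
    by (intro laplace_class_add laplace_class_heat[OF f p] laplace_class_convolve
      laplace_class_heat_kernel laplace_class_heat_charge[OF f p E])
  show "isCont (\<lambda>s. evol E f s x) t" if "0 < t" "x \<noteq> 0"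
    unfolding evol_def using that heat_isCont[OF f p] singular_part_isCont[OF f p E] by (intro continuous_intros) auto
  show "evol E f s x = 0" if "s \<le> 0"
    using that by (simp add: evol_def singular_part_nonpos[OF f p E])
qed

lemma
  fixes f :: "R2 \<Rightarrow> 'b::{banach, second_countable_topology}"
  assumes f [measurable]: "Lp_mem p f" and p: "1 < p" and E: "0 < E"
  shows Lp_mem_evol: "Lp_mem p (evol E f s)"
    and Lp_norm_evol_le: "Lp_norm p (evol E f s) \<le> evol_const p * Lp_norm p f"
proof -
  have "Lp_mem p (evol E f s) \<and> Lp_norm p (evol E f s) \<le> evol_const p * Lp_norm p f"
  proof (cases "0 < s")
    case True
    have "norm (evol E f s x) \<le> norm (convolve (heat_kernel s) f x) + norm (singular_part E f s x)" for x
      unfolding evol_def by (rule norm_triangle_ineq)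
    then have "Lp_mem p (evol E f s) \<and> Lp_norm p (evol E f s)
        \<le> Lp_norm p (convolve (heat_kernel s) f) + Lp_norm p (singular_part E f s)"
      using p Lp_triangle[OF _ Lp_mem_heat[OF f p True] Lp_mem_singular_part[OF f p E True], of "evol E f s"] by simp
    then show ?thesis
      using Lp_norm_heat_le[OF f p True] Lp_norm_singular_part_le[OF f p E True]
      by (simp add: evol_const_def distrib_right mult.assoc)
  next
    case False
    then have "evol E f s = (\<lambda>_. 0)" using evol_nonpos[OF f p E] by auto
    then show ?thesis using p evol_const_pos[OF p] by (auto simp: Lp_mem_def Lp_norm_def)
  qed
  then show "Lp_mem p (evol E f s)" "Lp_norm p (evol E f s) \<le> evol_const p * Lp_norm p f" by auto
qed

lemma heat_dominated:
  fixes f :: "R2 \<Rightarrow> 'b::{banach, second_countable_topology}"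
  assumes f [measurable]: "Lp_mem p f" and p: "1 < p" and u: "0 < u"
    and le: "\<And>z :: R2. \<bar>k z\<bar> \<le> c * heat_kernel u z"
  shows "norm (convolve k f x) \<le> c * convolve (heat_kernel u) (\<lambda>y. norm (f y)) x"
proof -
  have "norm (convolve k f x) \<le> (\<integral>y. c * (heat_kernel u (x - y) *\<^sub>R norm (f y)) \<partial>lborel)"
    unfolding convolve_def
  proof (rule norm_integral_le)
    show "integrable lborel (\<lambda>y. c * (heat_kernel u (x - y) *\<^sub>R norm (f y)))"
      using integrable_norm[OF heat_integrable[OF f p u, of x]] by simp
    show "norm (k (x - y) *\<^sub>R f y) \<le> c * (heat_kernel u (x - y) *\<^sub>R norm (f y))" for y
      using mult_right_mono[OF le norm_ge_zero[of "f y"]] by (simp add: mult.assoc)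
  qed
  then show ?thesis by (simp add: convolve_def)
qed

lemma evol_dominated:
  fixes f :: "R2 \<Rightarrow> 'b::{banach, second_countable_topology}"
  assumes f [measurable]: "Lp_mem p f" and p: "1 < p" and E: "0 < E" and t: "0 < t"
  obtains D :: "R2 \<Rightarrow> real" where "Lp_mem p D"
    "\<And>s x. t / 2 \<le> s \<Longrightarrow> s \<le> 2 * t \<Longrightarrow> x \<noteq> 0 \<Longrightarrow> norm (evol E f s x) \<le> D x"
proof -
  define H where "H x = 4 * convolve (heat_kernel (2 * t)) (\<lambda>y. norm (f y)) x" for x
  define Q where "Q x = (\<integral>r. heat_kernel (2 * t - r) x * pos_powr (1 / p) r \<partial>lborel)" for x :: R2
  define M where "M = 16 * charge_const (1 / p) * Lp_norm p f"
  have "Lp_mem p (convolve (heat_kernel (2 * t)) (\<lambda>y. norm (f y)))"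
    using t by (intro Lp_mem_heat Lp_mem_norm f p) simp
  then have H: "Lp_mem p H"
    unfolding H_def by (rule Lp_dominated(1)[where c = 4, rotated]) (use p in auto)
  have Q [measurable]: "Lp_mem p Q"
    unfolding Q_def
    by (rule Lp_heat_kernel_time_integral(1)[where k = 0 and b = "1 / p" and c = 1 and M = 1 and t = "2 * t"])
      (use p t in \<open>auto simp: pos_powr_def abs_mult split: split_indicator\<close>)
  have MQ: "Lp_mem p (\<lambda>x. M * Q x)"
    by (rule Lp_dominated(1)[OF _ Q, where c = "\<bar>M\<bar>"]) (use p in \<open>simp_all add: abs_mult\<close>)
  show thesis
  proof
    show "Lp_mem p (\<lambda>x. H x + M * Q x)"
      using p H MQ by (intro Lp_triangle(1)[OF _ H MQ]) auto
    fix s and x :: R2 assume s: "t / 2 \<le> s" "s \<le> 2 * t" and x: "x \<noteq> 0"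
    have "norm (convolve (heat_kernel s) f x) \<le> H x"
      unfolding H_def using heat_kernel_le_dilated[where 'a = R2, OF t s] t by (intro heat_dominated[OF f p]) auto
    then show "norm (evol E f s x) \<le> H x + M * Q x"
      unfolding evol_def M_def Q_def
      by (intro order_trans[OF norm_triangle_ineq] add_mono norm_singular_part_le[OF f p E t x s])
  qed
qed

lemma evol_Lp_continuous:
  fixes f :: "R2 \<Rightarrow> 'b::{banach, second_countable_topology}"
  assumes f [measurable]: "Lp_mem p f" and p: "1 < p" and E: "0 < E" and t: "0 < t"
  shows "((\<lambda>s. Lp_norm p (\<lambda>x. evol E f s x - evol E f t x)) \<longlongrightarrow> 0) (at t)"
proof -
  obtain D :: "R2 \<Rightarrow> real" where D: "Lp_mem p D"
    "\<And>s x. t / 2 \<le> s \<Longrightarrow> s \<le> 2 * t \<Longrightarrow> x \<noteq> 0 \<Longrightarrow> norm (evol E f s x) \<le> D x"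
    using evol_dominated[OF f p E t] by metis
  have D_AE: "AE x in lborel. norm (evol E f s x) \<le> D x" if "t / 2 \<le> s" "s \<le> 2 * t" for s
    using AE_lborel_singleton[of 0] by eventually_elim (use D(2) that in blast)
  show ?thesis
  proof (rule Lp_tendsto_dominated[OF _ _ D(1)])
    show "AE x in lborel. ((\<lambda>s. evol E f s x) \<longlongrightarrow> evol E f t x) (at t)"
      using AE_lborel_singleton[of 0] by eventually_elim (use evol_isCont[OF f p E t] in \<open>simp add: isCont_def\<close>)
    show "\<forall>\<^sub>F s in at t. AE x in lborel. norm (evol E f s x) \<le> D x"
      using eventually_within_factor_2[OF t] by eventually_elim (use D_AE in blast)
    show "AE x in lborel. norm (evol E f t x) \<le> D x" using t by (intro D_AE) auto
  qed (use p in auto)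
qed

section \<open>The resolvent along the evolution\<close>

lemma Ealpha_pos [simp]: "0 < Ealpha alpha"
  by (simp add: Ealpha_def)

lemma alpha_cc:
  assumes l: "0 < l"
  shows "alpha + cc l = ln (l / Ealpha alpha) / (4 * pi)"
proof -
  have "ln (l / Ealpha alpha) = ln l - (ln 4 + (- 4 * pi * alpha - 2 * euler_mascheroni))"
    using l by (simp add: ln_div ln_mult Ealpha_def)
  also have "ln 4 = 2 * ln (2::real)" using ln_realpow[of 2 2] by simp
  finally show ?thesis using l by (simp add: cc_def ln_sqrt field_simps)
qed

lemma alpha_cc_nonzero:
  assumes "0 < l" "l \<noteq> Ealpha alpha"
  shows "alpha + cc l \<noteq> 0"
  unfolding alpha_cc[OF assms(1)] using assms Ealpha_pos[of alpha] by (simp add: ln_eq_zero_iff[of "l / Ealpha alpha"])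

lemma convolve_Gk_0: "convolve (Gk l) f 0 = (\<integral>y. Gk l y *\<^sub>R f y \<partial>lborel)"
  by (simp add: convolve_def)

lemma resolv_eq: "resolv alpha l f x = convolve (Gk l) f x + Gk l x *\<^sub>R convolve (Gk l) f 0 /\<^sub>R (alpha + cc l)"
  by (simp add: resolv_def convolve_def scaleR_conv_of_real divide_inverse mult_ac)

lemma resolv_measurable [measurable (raw)]:
  assumes [measurable]: "case_prod f \<in> borel_measurable (M \<Otimes>\<^sub>M borel)" "h \<in> borel_measurable M"
  shows "(\<lambda>z. resolv alpha l (f z) (h z)) \<in> borel_measurable M"
  unfolding resolv_eq by measurable

lemma resolv_cong_AE:
  assumes "AE y in lborel. f y = g y" "f \<in> borel_measurable borel" "g \<in> borel_measurable borel"
  shows "resolv alpha l f x = resolv alpha l g x"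
proof -
  have "convolve (Gk l) f x = convolve (Gk l) g x" for x
    unfolding convolve_def using assms by (intro integral_cong_AE) auto
  then show ?thesis by (simp add: resolv_eq)
qed

lemma
  fixes u :: "'z::euclidean_space \<Rightarrow> R2 \<Rightarrow> 'b::{banach, second_countable_topology}"
  assumes m: "0 < m" and [measurable]: "\<omega> \<in> borel_measurable borel" "case_prod u \<in> borel_measurable (lborel \<Otimes>\<^sub>M lborel)"
    and \<omega>: "(\<integral>\<^sup>+ s. ennreal \<bar>\<omega> s\<bar> \<partial>lborel) < \<infinity>" and u: "\<And>s. Lp_mem 2 (u s)" "\<And>s. Lp_norm 2 (u s) \<le> B"
  shows integrable_convolve_Gk_average: "integrable lborel (\<lambda>s. \<omega> s *\<^sub>R convolve (Gk m) (u s) x)"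
    and convolve_Gk_average: "convolve (Gk m) (\<lambda>y. \<integral>s. \<omega> s *\<^sub>R u s y \<partial>lborel) x
        = (\<integral>s. \<omega> s *\<^sub>R convolve (Gk m) (u s) x \<partial>lborel)"
proof -
  have B: "0 \<le> B" using Lp_norm_nonneg u(2) by (rule order_trans)
  have G: "(\<integral>\<^sup>+ y. ennreal (Gk m (x - y) powr 2) \<partial>lborel) = ennreal (Lp_norm 2 (Gk m) powr 2)"
    using nn_integral_lborel_reflect[of "\<lambda>y. ennreal (Gk m y powr 2)" x] nn_integral_Lp_norm[OF Lp_mem_Gk[OF m, of 2]]
    by simp
  have Holder: "(\<integral>\<^sup>+ y. ennreal (Gk m (x - y) * norm (u s y)) \<partial>lborel) \<le> ennreal (Lp_norm 2 (Gk m) * B)" for s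
  proof (rule nn_integral_Holder[where p = 2 and q = 2])
    have [measurable]: "Lp_mem 2 (u s)" by (rule u(1))
    show "(\<lambda>y. norm (u s y)) \<in> borel_measurable lborel" by measurable
    show "(\<integral>\<^sup>+ y. ennreal (norm (u s y) powr 2) \<partial>lborel) \<le> ennreal (B powr 2)"
      unfolding nn_integral_Lp_norm[OF u(1) zero_less_numeral] using u(2)[of s] by (intro ennreal_leI powr_mono2) auto
  qed (use G B in auto)
  have "(\<integral>\<^sup>+ s. \<integral>\<^sup>+ y. ennreal (\<bar>\<omega> s\<bar> * (\<bar>Gk m (x - y)\<bar> * norm (u s y))) \<partial>lborel \<partial>lborel)
     \<le> (\<integral>\<^sup>+ s. ennreal \<bar>\<omega> s\<bar> * ennreal (Lp_norm 2 (Gk m) * B) \<partial>lborel)"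
  proof (rule nn_integral_mono)
    fix s
    have [measurable]: "Lp_mem 2 (u s)" by (rule u(1))
    have "(\<integral>\<^sup>+ y. ennreal (\<bar>\<omega> s\<bar> * (\<bar>Gk m (x - y)\<bar> * norm (u s y))) \<partial>lborel)
         = ennreal \<bar>\<omega> s\<bar> * (\<integral>\<^sup>+ y. ennreal (Gk m (x - y) * norm (u s y)) \<partial>lborel)"
      by (simp add: ennreal_mult' nn_integral_cmult)
    also have "\<dots> \<le> ennreal \<bar>\<omega> s\<bar> * ennreal (Lp_norm 2 (Gk m) * B)" by (intro mult_left_mono Holder) simp
    finally show "(\<integral>\<^sup>+ y. ennreal (\<bar>\<omega> s\<bar> * (\<bar>Gk m (x - y)\<bar> * norm (u s y))) \<partial>lborel)
         \<le> ennreal \<bar>\<omega> s\<bar> * ennreal (Lp_norm 2 (Gk m) * B)" .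
  qed
  also have "\<dots> < \<infinity>" using \<omega> by (simp add: nn_integral_multc ennreal_mult_less_top)
  finally have fin: "(\<integral>\<^sup>+ s. \<integral>\<^sup>+ y. ennreal (\<bar>\<omega> s\<bar> * (\<bar>Gk m (x - y)\<bar> * norm (u s y))) \<partial>lborel \<partial>lborel) < \<infinity>" .
  show "integrable lborel (\<lambda>s. \<omega> s *\<^sub>R convolve (Gk m) (u s) x)"
    by (rule convolve_average(1)[OF _ _ _ fin]) measurable
  show "convolve (Gk m) (\<lambda>y. \<integral>s. \<omega> s *\<^sub>R u s y \<partial>lborel) x = (\<integral>s. \<omega> s *\<^sub>R convolve (Gk m) (u s) x \<partial>lborel)"
    by (rule convolve_average(2)[OF _ _ _ fin]) measurable
qed

lemma
  fixes u :: "'z::euclidean_space \<Rightarrow> R2 \<Rightarrow> complex"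
  assumes m: "0 < m" and [measurable]: "\<omega> \<in> borel_measurable borel" "case_prod u \<in> borel_measurable (lborel \<Otimes>\<^sub>M lborel)"
    and \<omega>: "(\<integral>\<^sup>+ s. ennreal \<bar>\<omega> s\<bar> \<partial>lborel) < \<infinity>" and u: "\<And>s. Lp_mem 2 (u s)" "\<And>s. Lp_norm 2 (u s) \<le> B"
  shows integrable_resolv_average: "integrable lborel (\<lambda>s. \<omega> s *\<^sub>R resolv alpha m (u s) x)"
    and resolv_average: "resolv alpha m (\<lambda>y. \<integral>s. \<omega> s *\<^sub>R u s y \<partial>lborel) x
        = (\<integral>s. \<omega> s *\<^sub>R resolv alpha m (u s) x \<partial>lborel)"
proof -
  have int: "integrable lborel (\<lambda>s. \<omega> s *\<^sub>R convolve (Gk m) (u s) x)" for x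
    by (rule integrable_convolve_Gk_average[OF m _ _ \<omega> u]) measurable
  have average: "convolve (Gk m) (\<lambda>y. \<integral>s. \<omega> s *\<^sub>R u s y \<partial>lborel) x
       = (\<integral>s. \<omega> s *\<^sub>R convolve (Gk m) (u s) x \<partial>lborel)" for x
    by (rule convolve_Gk_average[OF m _ _ \<omega> u]) measurable
  have expand: "\<omega> s *\<^sub>R resolv alpha m (u s) x
      = \<omega> s *\<^sub>R convolve (Gk m) (u s) x + (Gk m x * inverse (alpha + cc m)) *\<^sub>R (\<omega> s *\<^sub>R convolve (Gk m) (u s) 0)" for s
    by (simp add: resolv_eq scaleR_add_right mult_ac)
  show "integrable lborel (\<lambda>s. \<omega> s *\<^sub>R resolv alpha m (u s) x)"
    unfolding expand using int by (intro Bochner_Integration.integrable_add integrable_scaleR_right)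
  have "(\<integral>s. \<omega> s *\<^sub>R resolv alpha m (u s) x \<partial>lborel)
     = (\<integral>s. \<omega> s *\<^sub>R convolve (Gk m) (u s) x \<partial>lborel)
       + (\<integral>s. (Gk m x * inverse (alpha + cc m)) *\<^sub>R (\<omega> s *\<^sub>R convolve (Gk m) (u s) 0) \<partial>lborel)"
    unfolding expand using int by (intro Bochner_Integration.integral_add integrable_scaleR_right)
  then show "resolv alpha m (\<lambda>y. \<integral>s. \<omega> s *\<^sub>R u s y \<partial>lborel) x = (\<integral>s. \<omega> s *\<^sub>R resolv alpha m (u s) x \<partial>lborel)"
    unfolding integral_scaleR_right by (simp add: resolv_eq average mult_ac)
qed

lemma convolve_Gk_resolv:
  assumes f: "Lp_mem 2 f" and lm: "0 < l" "0 < m" "l \<noteq> m"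
    and I: "has_bochner_integral lborel (\<lambda>y. Gk m (x - y) * Gk l y) I"
  shows "convolve (Gk m) (resolv alpha l f) x
     = (convolve (Gk l) f x - convolve (Gk m) f x) /\<^sub>R (m - l) + I *\<^sub>R convolve (Gk l) f 0 /\<^sub>R (alpha + cc l)"
proof -
  define c where "c = convolve (Gk l) f 0 /\<^sub>R (alpha + cc l)"
  have "convolve (Gk m) (resolv alpha l f) x
     = (\<integral>y. Gk m (x - y) *\<^sub>R convolve (Gk l) f y + (Gk m (x - y) * Gk l y) *\<^sub>R c \<partial>lborel)"
    by (simp add: convolve_def[of "Gk m"] resolv_eq c_def scaleR_add_right mult_ac)
  also have "\<dots> = convolve (Gk m) (convolve (Gk l) f) x + (\<integral>y. Gk m (x - y) * Gk l y \<partial>lborel) *\<^sub>R c"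
    using integrable_Gk_scaleR_convolve_Gk[OF f _ lm, of x] I
    unfolding convolve_def[of "Gk m"]
    by (subst Bochner_Integration.integral_add) (simp_all add: has_bochner_integral_iff)
  finally show ?thesis
    using convolve_Gk_Gk[OF f _ lm, of x] has_bochner_integral_integral_eq[OF I] by (simp add: c_def)
qed

lemma resolvent_identity:
  assumes f: "Lp_mem 2 f" and lm: "0 < l" "0 < m" "l \<noteq> m" and nz: "alpha + cc l \<noteq> 0" "alpha + cc m \<noteq> 0" and x: "x \<noteq> 0"
  shows "resolv alpha m (resolv alpha l f) x = (resolv alpha l f x - resolv alpha m f x) /\<^sub>R (m - l)"
proof -
  define Dl Dm where "Dl = complex_of_real (alpha + cc l)" and "Dm = complex_of_real (alpha + cc m)"
  define d where "d = complex_of_real (m - l)"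
  define P Q where "P = convolve (Gk l) f" and "Q = convolve (Gk m) f"
  define gl gm where "gl = complex_of_real (Gk l x)" and "gm = complex_of_real (Gk m x)"
  have "Dl \<noteq> 0" "Dm \<noteq> 0" "d \<noteq> 0"
    using nz lm by (simp_all add: Dl_def Dm_def d_def del: of_real_add of_real_diff)
  have "convolve (Gk m) (resolv alpha l f) 0 = (P 0 - Q 0) / d + (Dm - Dl) / d * P 0 / Dl"
    using convolve_Gk_resolv[OF f lm, of 0] has_bochner_integral_Gk_mult_0[OF lm]
    by (simp add: P_def Q_def Dl_def Dm_def d_def scaleR_conv_of_real divide_inverse mult_ac)
  moreover have "convolve (Gk m) (resolv alpha l f) x = (P x - Q x) / d + (gl - gm) / d * P 0 / Dl"
    using convolve_Gk_resolv[OF f lm has_bochner_integral_Gk_mult[OF lm x]]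
    by (simp add: P_def Q_def Dl_def gl_def gm_def d_def scaleR_conv_of_real divide_inverse mult_ac)
  ultimately have "resolv alpha m (resolv alpha l f) x
     = (P x - Q x) / d + (gl - gm) / d * P 0 / Dl + gm * ((P 0 - Q 0) / d + (Dm - Dl) / d * P 0 / Dl) / Dm"
    by (simp add: resolv_eq[of alpha m] gm_def Dm_def scaleR_conv_of_real divide_inverse mult_ac)
  also have "\<dots> = (P x + gl * P 0 / Dl - (Q x + gm * Q 0 / Dm)) / d"
    using \<open>Dl \<noteq> 0\<close> \<open>Dm \<noteq> 0\<close> \<open>d \<noteq> 0\<close> by (simp add: divide_simps) (simp add: algebra_simps)
  also have "\<dots> = (resolv alpha l f x - resolv alpha m f x) /\<^sub>R (m - l)"
    by (simp add: resolv_eq P_def Q_def gl_def gm_def Dl_def Dm_def d_def scaleR_conv_of_real divide_inverse mult_ac)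
  finally show ?thesis .
qed

definition ac_state :: "real \<Rightarrow> (R2 \<Rightarrow> 'b::{banach, second_countable_topology}) \<Rightarrow> bool" where
  "ac_state alpha f \<longleftrightarrow> Lp_mem 2 f \<and> (\<integral>y. Gk (Ealpha alpha) y *\<^sub>R f y \<partial>lborel) = 0"

lemma ac_state_Lp_mem: "ac_state alpha f \<Longrightarrow> Lp_mem 2 f"
  by (simp add: ac_state_def)

lemma ac_state_measurable [measurable_dest]: "ac_state alpha f \<Longrightarrow> f \<in> borel_measurable borel"
  using ac_state_Lp_mem by (rule Lp_mem_measurable)

lemma laplace_heat_charge:
  assumes f: "ac_state alpha f" and l: "0 < l" "l \<noteq> Ealpha alpha"
  shows "laplace (heat_charge (Ealpha alpha) f) l = convolve (Gk l) f 0 /\<^sub>R (alpha + cc l)"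
proof -
  have f_L2: "Lp_mem 2 f" by (rule ac_state_Lp_mem[OF f])
  have heat_0: "laplace (\<lambda>s. convolve (heat_kernel s) f 0) l = convolve (Gk l) f 0" if "0 < l" for l
    by (rule laplace_heat[OF f_L2 _ that]) simp
  then have "laplace (\<lambda>s. convolve (heat_kernel s) f 0) (Ealpha alpha) = 0"
    using f by (simp add: ac_state_def convolve_Gk_0)
  then have "laplace (heat_charge (Ealpha alpha) f) l
      = (4 * pi / ln (l / Ealpha alpha)) *\<^sub>R laplace (\<lambda>s. convolve (heat_kernel s) f 0) l"
    unfolding heat_charge_def using f_L2 l by (intro laplace_charge laplace_class_heat) auto
  then show ?thesis using l by (simp add: heat_0 alpha_cc inverse_eq_divide)
qed

lemma laplace_evol:
  assumes f: "ac_state alpha f" and x: "x \<noteq> 0" and l: "0 < l" "l \<noteq> Ealpha alpha"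
  shows "laplace (\<lambda>s. evol (Ealpha alpha) f s x) l = resolv alpha l f x"
proof -
  have f_L2: "Lp_mem 2 f" by (rule ac_state_Lp_mem[OF f])
  note classes = laplace_class_heat_kernel[OF x] laplace_class_heat_charge[OF f_L2 _ Ealpha_pos, of alpha]
  have "laplace (\<lambda>s. evol (Ealpha alpha) f s x) l
     = laplace (\<lambda>s. convolve (heat_kernel s) f x) l
       + laplace (convolve (\<lambda>r. heat_kernel r x) (heat_charge (Ealpha alpha) f)) l"
    unfolding evol_def singular_part_def
    by (intro laplace_add laplace_class_heat[OF f_L2] laplace_class_convolve classes l) simp_all
  also have "laplace (\<lambda>s. convolve (heat_kernel s) f x) l = convolve (Gk l) f x"
    by (rule laplace_heat[OF f_L2 _ l(1)]) simp
  also have "laplace (convolve (\<lambda>r. heat_kernel r x) (heat_charge (Ealpha alpha) f)) l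
       = Gk l x *\<^sub>R convolve (Gk l) f 0 /\<^sub>R (alpha + cc l)"
    using laplace_convolve[OF classes l(1)] laplace_heat_kernel[OF l(1) x] laplace_heat_charge[OF f l] by simp
  finally show ?thesis by (simp add: resolv_eq)
qed

lemma
  assumes f [measurable]: "ac_state alpha f" and m: "0 < m"
  shows laplace_class_resolv_evol: "laplace_class (\<lambda>s. resolv alpha m (evol (Ealpha alpha) f s) x)"
    and laplace_resolv_evol: "m \<noteq> Ealpha alpha \<Longrightarrow> x \<noteq> 0 \<Longrightarrow> 0 < l \<Longrightarrow> l \<notin> {m, Ealpha alpha} \<Longrightarrow>
      laplace (\<lambda>s. resolv alpha m (evol (Ealpha alpha) f s) x) l
        = laplace (shift_resolvent m (\<lambda>s. evol (Ealpha alpha) f s x)) l"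
proof -
  let ?u = "evol (Ealpha alpha) f"
  have L2 [measurable]: "Lp_mem 2 f" by (rule ac_state_Lp_mem[OF f])
  have u: "Lp_mem 2 (?u s)" "Lp_norm 2 (?u s) \<le> evol_const 2 * Lp_norm 2 f" for s
    using Lp_mem_evol[OF L2] Lp_norm_evol_le[OF L2] by simp_all
  have u_nonpos: "?u s = (\<lambda>_. 0)" if "s \<le> 0" for s using evol_nonpos[OF L2 _ _ that] by auto
  have R_nonpos: "resolv alpha m (?u s) x = 0" if "s \<le> 0" for s
    by (simp add: u_nonpos[OF that] resolv_def)
  have decay: "exp_decay l s *\<^sub>R v = exp (- l * s) *\<^sub>R v" if "s \<le> 0 \<Longrightarrow> v = 0" for l s and v :: complex
    using that by (cases "0 \<le> s") (auto simp: exp_decay_def)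
  have decay_fin: "(\<integral>\<^sup>+ s. ennreal \<bar>exp_decay l s\<bar> \<partial>lborel) < \<infinity>" if "0 < l" for l
    using nn_integral_exp_decay[OF that] by simp
  have int: "integrable lborel (\<lambda>s. exp_decay l s *\<^sub>R resolv alpha m (?u s) x)" if "0 < l" for l
    by (rule integrable_resolv_average[OF m _ _ decay_fin[OF that] u]) measurable
  show "laplace_class (\<lambda>s. resolv alpha m (?u s) x)"
    using int R_nonpos by (intro laplace_class_integrableI) (simp_all add: decay)
  assume m': "m \<noteq> Ealpha alpha" and x: "x \<noteq> 0" and l: "0 < l" "l \<notin> {m, Ealpha alpha}"
  have u_laplace: "(\<integral>s. exp_decay l s *\<^sub>R ?u s y \<partial>lborel) = resolv alpha l f y" if "y \<noteq> 0" for y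
    using laplace_evol[OF f that l(1)] l(2) u_nonpos by (simp add: laplace_def decay)
  have "laplace (\<lambda>s. resolv alpha m (?u s) x) l = (\<integral>s. exp_decay l s *\<^sub>R resolv alpha m (?u s) x \<partial>lborel)"
    by (simp add: laplace_def decay R_nonpos)
  also have "\<dots> = resolv alpha m (\<lambda>y. \<integral>s. exp_decay l s *\<^sub>R ?u s y \<partial>lborel) x"
    by (rule resolv_average[OF m _ _ decay_fin[OF l(1)] u, symmetric]) measurable
  also have "\<dots> = resolv alpha m (resolv alpha l f) x"
  proof (rule resolv_cong_AE)
    show "AE y in lborel. (\<integral>s. exp_decay l s *\<^sub>R ?u s y \<partial>lborel) = resolv alpha l f y"
      using AE_lborel_singleton[of 0] by eventually_elim (rule u_laplace)
  qed measurable
  also have "\<dots> = (resolv alpha l f x - resolv alpha m f x) /\<^sub>R (m - l)"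
    using l m m' x by (intro resolvent_identity L2 alpha_cc_nonzero) auto
  also have "\<dots> = laplace (shift_resolvent m (\<lambda>s. ?u s x)) l"
    using laplace_shift_resolvent[OF laplace_class_evol[OF L2 _ Ealpha_pos x] m l(1)] l m m'
    by (simp add: laplace_evol[OF f x])
  finally show "laplace (\<lambda>s. resolv alpha m (?u s) x) l = laplace (shift_resolvent m (\<lambda>s. ?u s x)) l" .
qed

text \<open>The identity \<open>resolv m (evol s) = shift_resolvent m evol s\<close> is only needed against Erlang densities,
  where it follows from equality of Laplace transforms in \<open>s\<close>, which is the resolvent identity.\<close>
lemma resolv_erlang_average:
  assumes f [measurable]: "ac_state alpha f" and m: "0 < m" "m \<noteq> Ealpha alpha" and x: "x \<noteq> 0"
  shows "m *\<^sub>R resolv alpha m (\<lambda>y. \<integral>s. erlang_density k m s *\<^sub>R evol (Ealpha alpha) f s y \<partial>lborel) x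
     = (\<integral>s. erlang_density (Suc k) m s *\<^sub>R evol (Ealpha alpha) f s x \<partial>lborel)"
proof -
  let ?u = "evol (Ealpha alpha) f"
  have f_L2: "Lp_mem 2 f" by (rule ac_state_Lp_mem[OF f])
  have u: "Lp_mem 2 (?u s)" "Lp_norm 2 (?u s) \<le> evol_const 2 * Lp_norm 2 f" for s
    using Lp_mem_evol[OF f_L2] Lp_norm_evol_le[OF f_L2] by simp_all
  have u_class: "laplace_class (\<lambda>s. ?u s x)" by (rule laplace_class_evol[OF f_L2 _ _ x]) simp_all
  have "(\<integral>\<^sup>+ s. ennreal \<bar>erlang_density k m s\<bar> \<partial>lborel) < \<infinity>"
    using nn_integral_erlang_density_eq_1[OF m(1), of k] m by simp
  then have "resolv alpha m (\<lambda>y. \<integral>s. erlang_density k m s *\<^sub>R ?u s y \<partial>lborel) x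
     = (\<integral>s. erlang_density k m s *\<^sub>R resolv alpha m (?u s) x \<partial>lborel)"
    by (intro resolv_average[OF m(1) _ _ _ u]) measurable
  also have "\<dots> = (\<integral>s. erlang_density k m s *\<^sub>R shift_resolvent m (\<lambda>s. ?u s x) s \<partial>lborel)"
    by (rule integral_erlang_density_eq_if_laplace_eq[where X = "{m, Ealpha alpha}"])
      (use laplace_resolv_evol[OF f m x] m in
        \<open>auto intro!: laplace_class_resolv_evol[OF f] laplace_class_shift_resolvent u_class\<close>)
  finally show ?thesis using integral_erlang_density_shift_resolvent[OF u_class m(1), of k] by simp
qed

section \<open>Convergence of the exponential formula\<close>

definition post_widder :: "real \<Rightarrow> real \<Rightarrow> nat \<Rightarrow> (R2 \<Rightarrow> complex) \<Rightarrow> R2 \<Rightarrow> complex" where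
  "post_widder alpha m n f = ((\<lambda>g y. complex_of_real m * resolv alpha m g y) ^^ n) f"

lemma heat_sg_iff: "heat_sg alpha t g u
    \<longleftrightarrow> Lp_mem 2 u \<and> (\<lambda>n. Lp_norm 2 (\<lambda>x. post_widder alpha (real n / t) n g x - u x)) \<longlonglongrightarrow> 0"
  by (simp add: heat_sg_def post_widder_def)

lemma post_widder_Suc: "post_widder alpha m (Suc n) f x = m *\<^sub>R resolv alpha m (post_widder alpha m n f) x"
  by (simp add: post_widder_def scaleR_conv_of_real)

lemma post_widder_measurable [measurable]:
  assumes [measurable]: "f \<in> borel_measurable borel"
  shows "post_widder alpha m n f \<in> borel_measurable borel"
proof (induction n)
  case (Suc n)
  then have [measurable]: "post_widder alpha m n f \<in> borel_measurable borel" .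
  show ?case unfolding post_widder_Suc[abs_def] by measurable
qed (simp add: post_widder_def)

lemma post_widder_eq_erlang_average:
  assumes f [measurable]: "ac_state alpha f" and m: "0 < m" "m \<noteq> Ealpha alpha" and x: "x \<noteq> 0"
  shows "post_widder alpha m (Suc k) f x = (\<integral>s. erlang_density k m s *\<^sub>R evol (Ealpha alpha) f s x \<partial>lborel)"
  using x
proof (induction k arbitrary: x)
  case 0
  have "(\<integral>s. erlang_density 0 m s *\<^sub>R evol (Ealpha alpha) f s x \<partial>lborel)
       = m *\<^sub>R laplace (\<lambda>s. evol (Ealpha alpha) f s x) m"
    using integral_erlang_density_scaleR[OF laplace_class_evol[OF ac_state_Lp_mem[OF f] _ Ealpha_pos 0], of 0 m] by simp
  then show ?case using laplace_evol[OF f 0 m] by (simp add: post_widder_Suc) (simp add: post_widder_def)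
next
  case (Suc k)
  have "resolv alpha m (post_widder alpha m (Suc k) f) x
     = resolv alpha m (\<lambda>y. \<integral>s. erlang_density k m s *\<^sub>R evol (Ealpha alpha) f s y \<partial>lborel) x"
    using AE_lborel_singleton[of 0] by (intro resolv_cong_AE) (auto elim!: eventually_mono simp: Suc.IH)
  then show ?case using resolv_erlang_average[OF f m Suc.prems] by (simp add: post_widder_Suc[of _ _ "Suc k"])
qed

lemma nn_integral_erlang_density_quadratic:
  assumes t: "0 < t" and e: "0 \<le> e" and L: "0 \<le> L"
  shows "(\<integral>\<^sup>+ s. ennreal (erlang_density k (real (Suc k) / t) s * (e + L * (s - t)\<^sup>2)) \<partial>lborel)
       = ennreal (e + L * t\<^sup>2 / real (Suc k))"
proof -
  define n where "n = real (Suc k)"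
  have n: "0 < n" by (simp add: n_def)
  let ?d = "erlang_density k (n / t)"
  have m: "0 < n / t" using n t by simp
  have "has_bochner_integral lborel (\<lambda>s. (e + L * t\<^sup>2) * (?d s * s ^ 0)
       - 2 * L * t * (?d s * s ^ 1) + L * (?d s * s ^ 2))
     ((e + L * t\<^sup>2) * (fact (k + 0) / (fact k * (n / t) ^ 0)) - 2 * L * t * (fact (k + 1) / (fact k * (n / t) ^ 1))
        + L * (fact (k + 2) / (fact k * (n / t) ^ 2)))"
    by (intro has_bochner_integral_add has_bochner_integral_diff
      has_bochner_integral_mult_right has_bochner_integral_erlang_moment m)
  moreover have "fact (k + 0) / (fact k * (n / t) ^ 0) = 1" "fact (k + 1) / (fact k * (n / t) ^ 1) = t"
    "fact (k + 2) / (fact k * (n / t) ^ 2) = t\<^sup>2 + t\<^sup>2 / n"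
  proof -
    have "fact (k + 1) = n * fact k" "fact (k + 2) = (n + 1) * n * fact k" by (simp_all add: n_def algebra_simps)
    then show "fact (k + 0) / (fact k * (n / t) ^ 0) = 1" "fact (k + 1) / (fact k * (n / t) ^ 1) = t"
      "fact (k + 2) / (fact k * (n / t) ^ 2) = t\<^sup>2 + t\<^sup>2 / n"
      using n t by (simp_all only: add_0_right power_0 power_one_right power_divide)
        (simp_all add: field_simps power2_eq_square)
  qed
  moreover have "(e + L * t\<^sup>2) * (?d s * s ^ 0) - 2 * L * t * (?d s * s ^ 1) + L * (?d s * s ^ 2)
       = ?d s * (e + L * (s - t)\<^sup>2)" for s
    by (simp add: power2_eq_square algebra_simps)
  moreover have "(e + L * t\<^sup>2) * 1 - 2 * L * t * t + L * (t\<^sup>2 + t\<^sup>2 / n) = e + L * t\<^sup>2 / n"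
    by (simp add: power2_eq_square algebra_simps)
  ultimately have "has_bochner_integral lborel (\<lambda>s. ?d s * (e + L * (s - t)\<^sup>2)) (e + L * t\<^sup>2 / n)" by (simp only:)
  then show ?thesis
    using m e L n unfolding n_def[symmetric]
    by (subst nn_integral_eq_integral) (auto simp: has_bochner_integral_iff)
qed

lemma quadratic_modulus:
  fixes N :: "real \<Rightarrow> real"
  assumes lim: "(N \<longlongrightarrow> 0) (at t)" and "N t \<le> 0" and bounded: "\<And>s. N s \<le> B" and e: "0 < e"
  obtains L where "0 \<le> L" "\<And>s. N s \<le> e + L * (s - t)\<^sup>2"
proof -
  obtain d where d: "0 < d" "\<And>s. s \<noteq> t \<Longrightarrow> \<bar>s - t\<bar> < d \<Longrightarrow> N s < e"
    using order_tendstoD(2)[OF lim e] unfolding eventually_at by (auto simp: dist_real_def)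
  show thesis
  proof
    show L: "0 \<le> \<bar>B\<bar> / d\<^sup>2" by simp
    fix s
    show "N s \<le> e + \<bar>B\<bar> / d\<^sup>2 * (s - t)\<^sup>2"
    proof (cases "\<bar>s - t\<bar> < d")
      case True
      then have "N s \<le> e" using d(2)[of s] \<open>N t \<le> 0\<close> e by (cases "s = t") auto
      then show ?thesis using mult_nonneg_nonneg[OF L zero_le_power2[of "s - t"]] by linarith
    next
      case False
      then have "d\<^sup>2 \<le> (s - t)\<^sup>2" using d(1) by (simp add: abs_le_square_iff[symmetric])
      then have "1 \<le> (s - t)\<^sup>2 / d\<^sup>2" using d(1) by simp
      then have "\<bar>B\<bar> * 1 \<le> \<bar>B\<bar> * ((s - t)\<^sup>2 / d\<^sup>2)" by (intro mult_left_mono) auto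
      then show ?thesis using bounded[of s] e by simp
    qed
  qed
qed

lemma
  fixes u :: "real \<Rightarrow> R2 \<Rightarrow> 'b::{banach, second_countable_topology}"
  assumes [measurable]: "case_prod u \<in> borel_measurable (lborel \<Otimes>\<^sub>M lborel)"
    and p: "1 < p" and t: "0 < t" and u: "\<And>s. Lp_mem p (u s)"
    and u_class: "AE x in lborel. laplace_class (\<lambda>s. u s x)"
    and e: "0 < e" and L: "0 \<le> L" and modulus: "\<And>s. Lp_norm p (\<lambda>x. u s x - u t x) \<le> e + L * (s - t)\<^sup>2"
  shows Lp_mem_erlang_average_diff:
    "Lp_mem p (\<lambda>x. (\<integral>s. erlang_density k (real (Suc k) / t) s *\<^sub>R u s x \<partial>lborel) - u t x)"
    and Lp_norm_erlang_average_diff_le: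
      "Lp_norm p (\<lambda>x. (\<integral>s. erlang_density k (real (Suc k) / t) s *\<^sub>R u s x \<partial>lborel) - u t x)
          \<le> e + L * t\<^sup>2 / real (Suc k)"
proof -
  define m where "m = real (Suc k) / t"
  have m: "0 < m" using t by (simp add: m_def)
  let ?d = "erlang_density k m"
  have \<delta>: "0 < e + L * (s - t)\<^sup>2" for s using e L by (simp add: add_pos_nonneg)
  have [measurable]: "u s \<in> borel_measurable borel" for s by (rule Lp_mem_measurable[OF u])
  let ?g = "\<lambda>s x. ?d s *\<^sub>R (u s x - u t x)"
  let ?A = "\<lambda>x. (\<integral>s. ?d s *\<^sub>R u s x \<partial>lborel) - u t x"
  have W: "0 < e + L * t\<^sup>2 / real (Suc k)"
    "(\<integral>\<^sup>+ s. ennreal (?d s * (e + L * (s - t)\<^sup>2)) \<partial>lborel) \<le> ennreal (e + L * t\<^sup>2 / real (Suc k))"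
    using nn_integral_erlang_density_quadratic[OF t less_imp_le[OF e] L, of k] e L
    by (auto intro!: add_pos_nonneg simp: m_def)
  have diff: "Lp_mem p (\<lambda>x. u s x - u t x)" for s
    using p by (intro Lp_triangle(1)[OF _ u[of s] u[of t]]) (auto simp: norm_triangle_ineq4)
  have "case_prod ?g \<in> borel_measurable (lborel \<Otimes>\<^sub>M lborel)"
    "(\<lambda>(s, x). u s x - u t x) \<in> borel_measurable (lborel \<Otimes>\<^sub>M lborel)"
    by measurable
  note bound = Minkowski_integral_inequality[OF this(1) _ _ this(2) p W _ _ _ diff modulus]
  have bound: "Lp_mem p (\<lambda>x. \<integral>s. ?g s x \<partial>lborel)" "Lp_norm p (\<lambda>x. \<integral>s. ?g s x \<partial>lborel) \<le> e + L * t\<^sup>2 / real (Suc k)"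
    by (rule bound; use \<delta> m in \<open>simp add: less_imp_le\<close>)+
  have average_eq: "AE x in lborel. ?A x = (\<integral>s. ?g s x \<partial>lborel)"
    using u_class
  proof eventually_elim
    case (elim x)
    have "has_bochner_integral lborel ?d 1" using has_bochner_integral_erlang_moment[OF m, of k 0] by simp
    then show ?case
      using integrable_erlang_density_scaleR[OF elim m, of k]
      by (simp add: scaleR_diff_right has_bochner_integral_iff)
  qed
  have [measurable]: "?A \<in> borel_measurable borel" by measurable
  have "Lp_mem p ?A \<and> Lp_norm p ?A \<le> 1 * Lp_norm p (\<lambda>x. \<integral>s. ?g s x \<partial>lborel)"
    using p average_eq by (intro conjI Lp_dominated[OF _ bound(1), where c = 1]) (auto elim!: eventually_mono)
  then show "Lp_mem p (\<lambda>x. (\<integral>s. erlang_density k (real (Suc k) / t) s *\<^sub>R u s x \<partial>lborel) - u t x)"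
    "Lp_norm p (\<lambda>x. (\<integral>s. erlang_density k (real (Suc k) / t) s *\<^sub>R u s x \<partial>lborel) - u t x) \<le> e + L * t\<^sup>2 / real (Suc k)"
    using bound(2) by (auto simp: m_def)
qed

lemma evol_quadratic_modulus:
  assumes f [measurable]: "Lp_mem p f" and p: "1 < p" and E: "0 < E" and t: "0 < t" and e: "0 < e"
  obtains L where "0 \<le> L" "\<And>s. Lp_norm p (\<lambda>x. evol E f s x - evol E f t x) \<le> e + L * (s - t)\<^sup>2"
proof (rule quadratic_modulus[OF evol_Lp_continuous[OF f p E t] _ _ e])
  show "Lp_norm p (\<lambda>x. evol E f t x - evol E f t x) \<le> 0" using p by (simp add: Lp_norm_def)
  show "Lp_norm p (\<lambda>x. evol E f s x - evol E f t x) \<le> evol_const p * Lp_norm p f + evol_const p * Lp_norm p f" for s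
  proof -
    note mem = Lp_mem_evol[OF f p E] and bound = Lp_norm_evol_le[OF f p E]
    have "Lp_norm p (\<lambda>x. evol E f s x - evol E f t x) \<le> Lp_norm p (evol E f s) + Lp_norm p (evol E f t)"
      using p by (intro Lp_triangle(2)[OF _ mem mem]) (auto simp: norm_triangle_ineq4)
    then show ?thesis using bound[of s] bound[of t] by linarith
  qed
qed (rule that)

lemma post_widder_eventually_close:
  assumes f [measurable]: "ac_state alpha f" and t: "0 < t" and e: "0 < e"
  obtains L where "\<forall>\<^sub>F n in sequentially. Lp_mem 2 
      (\<lambda>x. post_widder alpha (real n / t) n f x - evol (Ealpha alpha) f t x) \<and>
    Lp_norm 2 (\<lambda>x. post_widder alpha (real n / t) n f x - evol (Ealpha alpha) f t x) \<le> e + L / real n"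
proof -
  let ?u = "evol (Ealpha alpha) f"
  have L2 [measurable]: "Lp_mem 2 f" by (rule ac_state_Lp_mem[OF f])
  have u: "Lp_mem 2 (?u s)" for s by (rule Lp_mem_evol[OF L2]) simp_all
  have u_class: "AE x in lborel. laplace_class (\<lambda>s. ?u s x)"
    using AE_lborel_singleton[of 0] by eventually_elim (rule laplace_class_evol[OF L2], simp_all)
  obtain L where L: "0 \<le> L" "\<And>s. Lp_norm 2 (\<lambda>x. ?u s x - ?u t x) \<le> e + L * (s - t)\<^sup>2"
    using evol_quadratic_modulus[OF L2 _ Ealpha_pos t e] by auto
  have "\<forall>\<^sub>F n in sequentially. Ealpha alpha * t < real n"
    using filterlim_real_sequentially unfolding filterlim_at_top_dense by blast
  then have "\<forall>\<^sub>F n in sequentially. Lp_mem 2 (\<lambda>x. post_widder alpha (real n / t) n f x - ?u t x) \<and>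
    Lp_norm 2 (\<lambda>x. post_widder alpha (real n / t) n f x - ?u t x) \<le> e + L * t\<^sup>2 / real n"
    using eventually_gt_at_top[of 0]
  proof eventually_elim
    case (elim n)
    then obtain k where n: "n = Suc k" by (cases n) auto
    let ?A = "\<lambda>x. (\<integral>s. erlang_density k (real (Suc k) / t) s *\<^sub>R ?u s x \<partial>lborel) - ?u t x"
    have m: "0 < real (Suc k) / t" "real (Suc k) / t \<noteq> Ealpha alpha" using elim t by (auto simp: n field_simps)
    have "AE x in lborel. norm (post_widder alpha (real n / t) n f x - ?u t x) \<le> 1 * norm (?A x)"
      using AE_lborel_singleton[of 0]
      by eventually_elim (simp add: n post_widder_eq_erlang_average[OF f m] del: of_nat_Suc)
    moreover have "Lp_mem 2 ?A"
      by (rule Lp_mem_erlang_average_diff[OF _ _ t u u_class e L]) simp_all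
    moreover have "Lp_norm 2 ?A \<le> e + L * t\<^sup>2 / real n"
      unfolding n by (rule Lp_norm_erlang_average_diff_le[OF _ _ t u u_class e L]) simp_all
    ultimately show ?case using Lp_dominated[of "\<lambda>x. post_widder alpha (real n / t) n f x - ?u t x" 2 ?A 1] by simp
  qed
  then show thesis by (rule that)
qed

lemma
  assumes f [measurable]: "ac_state alpha f" and t: "0 < t"
  shows eventually_Lp_mem_post_widder_diff:
    "\<forall>\<^sub>F n in sequentially. Lp_mem 2 (\<lambda>x. post_widder alpha (real n / t) n f x - evol (Ealpha alpha) f t x)"
    and post_widder_tendsto_evol:
      "(\<lambda>n. Lp_norm 2 (\<lambda>x. post_widder alpha (real n / t) n f x - evol (Ealpha alpha) f t x)) \<longlonglongrightarrow> 0"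
proof -
  let ?P = "\<lambda>n x. post_widder alpha (real n / t) n f x - evol (Ealpha alpha) f t x"
  show "\<forall>\<^sub>F n in sequentially. Lp_mem 2 (?P n)"
    by (rule post_widder_eventually_close[OF f t zero_less_one]) (auto elim: eventually_mono)
  show "(\<lambda>n. Lp_norm 2 (?P n)) \<longlonglongrightarrow> 0"
  proof (rule order_tendstoI)
    fix r :: real assume r: "0 < r"
    obtain L where L: "\<forall>\<^sub>F n in sequentially. Lp_mem 2 (?P n) \<and> Lp_norm 2 (?P n) \<le> r / 2 + L / real n"
      using post_widder_eventually_close[OF f t half_gt_zero[OF r]] .
    have "(\<lambda>n. L / real n) \<longlonglongrightarrow> 0" by (rule lim_const_over_n)
    from order_tendstoD(2)[OF this half_gt_zero[OF r]] L
    show "\<forall>\<^sub>F n in sequentially. Lp_norm 2 (?P n) < r" by eventually_elim (elim conjE, linarith)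
  qed (intro always_eventually allI, erule less_le_trans, rule Lp_norm_nonneg)
qed

lemma heat_sg_evol: "ac_state alpha f \<Longrightarrow> 0 < t \<Longrightarrow> heat_sg alpha t f (evol (Ealpha alpha) f t)"
  by (simp add: heat_sg_iff Lp_mem_evol ac_state_Lp_mem post_widder_tendsto_evol)

lemma heat_sg_unique:
  assumes f [measurable]: "ac_state alpha f" and t: "0 < t" and u: "heat_sg alpha t f u"
  shows "AE x in lborel. u x = evol (Ealpha alpha) f t x"
proof (rule Lp_limit_unique)
  show "\<forall>\<^sub>F n in sequentially. Lp_mem 2 (\<lambda>x. post_widder alpha (real n / t) n f x - evol (Ealpha alpha) f t x)"
    by (rule eventually_Lp_mem_post_widder_diff[OF f t])
  show "(\<lambda>n. Lp_norm 2 (\<lambda>x. post_widder alpha (real n / t) n f x - evol (Ealpha alpha) f t x)) \<longlonglongrightarrow> 0"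
    by (rule post_widder_tendsto_evol[OF f t])
qed (use u in \<open>auto simp: heat_sg_iff Lp_mem_evol ac_state_Lp_mem[OF f]\<close>)

section \<open>Weak derivatives\<close>

lemma
  assumes \<phi>: "test_fun \<phi>"
  shows test_fun_differentiable: "\<phi> differentiable (at x)"
    and test_fun_continuous: "continuous_on UNIV \<phi>"
    and test_fun_partial_continuous: "continuous_on UNIV (partial j \<phi>)"
proof -
  have "iter_partial [] \<phi> differentiable_on UNIV" "iter_partial [j] \<phi> differentiable_on UNIV"
    using \<phi> unfolding test_fun_def by blast+
  then show "\<phi> differentiable (at x)" "continuous_on UNIV \<phi>" "continuous_on UNIV (partial j \<phi>)"
    by (auto simp: differentiable_on_def intro: differentiable_imp_continuous_on)
qed

lemma test_fun_measurable [measurable_dest]: "test_fun \<phi> \<Longrightarrow> \<phi> \<in> borel_measurable borel"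
  by (intro borel_measurable_continuous_onI test_fun_continuous)

lemma test_fun_partial_measurable: "test_fun \<phi> \<Longrightarrow> partial j \<phi> \<in> borel_measurable borel"
  by (intro borel_measurable_continuous_onI test_fun_partial_continuous)

lemma test_fun_has_directional_derivative:
  assumes \<phi>: "test_fun \<phi>"
  shows "((\<lambda>h. \<phi> (x + h *\<^sub>R axis j 1)) has_real_derivative partial j \<phi> (x + h *\<^sub>R axis j 1)) (at h)"
proof -
  let ?D = "frechet_derivative \<phi> (at (x + h *\<^sub>R axis j 1))"
  have D: "(\<phi> has_derivative ?D) (at (x + h *\<^sub>R axis j 1))"
    using test_fun_differentiable[OF \<phi>] by (simp add: frechet_derivative_works)
  have "((\<lambda>h. x + h *\<^sub>R axis j 1) has_derivative (\<lambda>k. k *\<^sub>R axis j 1)) (at h)"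
    by (auto intro!: derivative_eq_intros)
  then have "((\<lambda>h. \<phi> (x + h *\<^sub>R axis j 1)) has_derivative (\<lambda>k. ?D (k *\<^sub>R axis j 1))) (at h)"
    using D by (rule has_derivative_compose)
  moreover have "?D (k *\<^sub>R axis j 1) = partial j \<phi> (x + h *\<^sub>R axis j 1) * k" for k
    using linear_scale[OF has_derivative_linear[OF D], of k "axis j 1"] by (simp add: partial_def)
  ultimately show ?thesis by (simp add: has_field_derivative_def)
qed

lemma continuous_vanishing_outside_cball_bounded:
  fixes g :: "'a::heine_borel \<Rightarrow> real"
  assumes g: "continuous_on UNIV g" and zero: "\<And>x. x \<notin> cball a R \<Longrightarrow> g x = 0"
  obtains B where "0 \<le> B" "\<And>x. \<bar>g x\<bar> \<le> B * indicator (cball a R) x"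
proof -
  have "bounded (g ` cball a R)"
    using g by (intro compact_imp_bounded compact_continuous_image) (auto intro: continuous_on_subset)
  then obtain B where B: "0 < B" "\<And>x. x \<in> cball a R \<Longrightarrow> \<bar>g x\<bar> \<le> B" unfolding bounded_pos by auto
  show thesis by (rule that[of B]) (use B zero in \<open>auto split: split_indicator\<close>)
qed

lemma test_fun_bounds:
  assumes \<phi>: "test_fun \<phi>"
  obtains B R where "0 \<le> B" "\<And>x. \<bar>\<phi> x\<bar> \<le> B * indicator (cball 0 R) x"
    "\<And>x. \<bar>partial j \<phi> x\<bar> \<le> B * indicator (cball 0 R) x"
proof -
  obtain R where "{x. \<phi> x \<noteq> 0} \<subseteq> cball 0 R"
    using \<phi> unfolding test_fun_def bounded_iff by fastforce
  then have zero: "\<phi> x = 0" if "x \<notin> cball 0 R" for x using that by auto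
  have partial_zero: "partial j \<phi> x = 0" if "x \<notin> cball 0 R" for x
  proof -
    have "(\<phi> has_derivative (\<lambda>_. 0)) (at x)"
      by (rule has_derivative_transform_within_open[OF has_derivative_const, where s = "- cball 0 R"])
        (use that zero in auto)
    then show ?thesis by (simp add: partial_def frechet_derivative_at[symmetric])
  qed
  obtain B where B: "0 \<le> B" "\<And>x. \<bar>\<phi> x\<bar> \<le> B * indicator (cball 0 R) x"
    using continuous_vanishing_outside_cball_bounded[OF test_fun_continuous[OF \<phi>] zero] by metis
  obtain C where C: "0 \<le> C" "\<And>x. \<bar>partial j \<phi> x\<bar> \<le> C * indicator (cball 0 R) x"
    using continuous_vanishing_outside_cball_bounded[OF test_fun_partial_continuous[OF \<phi>] partial_zero] by metis
  show thesis
  proof (rule that[of "max B C" R])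
    show "\<bar>\<phi> x\<bar> \<le> max B C * indicator (cball 0 R) x" "\<bar>partial j \<phi> x\<bar> \<le> max B C * indicator (cball 0 R) x" for x
      using B(2)[of x] C(2)[of x] by (auto split: split_indicator_asm split_indicator)
  qed (use B in simp)
qed

lemma integrable_indicator_cball: "integrable lborel (\<lambda>x. B * indicator (cball (a :: 'a::euclidean_space) R) x :: real)"
  using emeasure_bounded_finite[of "cball a R"] by (intro integrable_mult_right integrable_real_indicator) auto

lemma integrable_mult_bounded_indicator_cball:
  fixes \<psi> \<kappa> :: "'a::euclidean_space \<Rightarrow> real"
  assumes [measurable]: "\<psi> \<in> borel_measurable borel" "\<kappa> \<in> borel_measurable borel"
    and \<psi>: "\<And>x. \<bar>\<psi> x\<bar> \<le> B * indicator (cball a R) x" and \<kappa>: "\<And>x. \<bar>\<kappa> x\<bar> \<le> C"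
  shows "integrable lborel (\<lambda>x. \<psi> x * \<kappa> x)"
proof (rule Bochner_Integration.integrable_bound)
  show "integrable lborel (\<lambda>x. B * indicator (cball a R) x * C)"
    by (intro integrable_mult_left integrable_indicator_cball)
  have "\<bar>\<psi> x * \<kappa> x\<bar> \<le> B * indicator (cball a R) x * C" for x
    unfolding abs_mult by (intro mult_mono \<psi> \<kappa> order_trans[OF abs_ge_zero \<psi>]) simp
  then show "AE x in lborel. norm (\<psi> x * \<kappa> x) \<le> norm (B * indicator (cball a R) x * C)"
    unfolding real_norm_def by (intro AE_I2 order_trans[OF _ abs_ge_self])
qed measurable

definition weak_partial :: "2 \<Rightarrow> (R2 \<Rightarrow> 'b::{banach, second_countable_topology}) \<Rightarrow> (R2 \<Rightarrow> 'b) \<Rightarrow> bool" where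
  "weak_partial j u v \<longleftrightarrow> (\<forall>\<phi>. test_fun \<phi> \<longrightarrow>
     integrable lborel (\<lambda>x. partial j \<phi> x *\<^sub>R u x) \<and> integrable lborel (\<lambda>x. \<phi> x *\<^sub>R v x) \<and>
     (\<integral>x. partial j \<phi> x *\<^sub>R u x \<partial>lborel) = - (\<integral>x. \<phi> x *\<^sub>R v x \<partial>lborel))"

lemma weak_partial_add:
  assumes "weak_partial j u v" "weak_partial j u' v'"
  shows "weak_partial j (\<lambda>x. u x + u' x) (\<lambda>x. v x + v' x)"
  using assms unfolding weak_partial_def by (simp add: scaleR_add_right)

lemma weak_gradI:
  assumes "\<And>j. (\<lambda>x. h x $ j) \<in> borel_measurable borel" "\<And>j. weak_partial j u (\<lambda>x. h x $ j)"
  shows "weak_grad u h"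
proof -
  have commute: "z * complex_of_real a = a *\<^sub>R z" for z a by (simp add: scaleR_conv_of_real)
  show ?thesis using assms unfolding weak_grad_def weak_partial_def commute by simp
qed

lemma weak_grad_cong_AE:
  assumes h: "weak_grad v h" and ae: "AE x in lborel. u x = v x"
    and [measurable]: "u \<in> borel_measurable borel" "v \<in> borel_measurable borel"
  shows "weak_grad u h"
  unfolding weak_grad_def
proof (intro conjI allI impI)
  show "(\<lambda>x. h x $ j) \<in> borel_measurable lborel" for j using h by (simp add: weak_grad_def)
  fix \<phi> j assume \<phi>: "test_fun \<phi>"
  have [measurable]: "partial j \<phi> \<in> borel_measurable borel" by (rule test_fun_partial_measurable[OF \<phi>])
  have "(\<integral>x. u x * complex_of_real (partial j \<phi> x) \<partial>lborel) = (\<integral>x. v x * complex_of_real (partial j \<phi> x) \<partial>lborel)"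
    using ae by (intro integral_cong_AE) auto
  then show "(\<integral>x. u x * complex_of_real (partial j \<phi> x) \<partial>lborel) = - (\<integral>x. h x $ j * complex_of_real (\<phi> x) \<partial>lborel)"
    using h \<phi> by (simp add: weak_grad_def)
qed

lemma abs_heat_kernel_deriv_axis_le:
  "\<bar>heat_kernel_deriv (axis j 1) s (z :: R2)\<bar> \<le> 2 * pos_powr (1 / 2) s * heat_kernel (2 * s) z"
proof (cases "0 < s")
  case True
  have "pos_powr (1 / 2) s = 1 / sqrt s" using True by (simp add: powr_minus_divide powr_half_sqrt)
  then show ?thesis using abs_heat_kernel_deriv_le[OF True, of "axis j 1" z] by simp
qed simp

text \<open>Both sides are the derivative at 0 of \<open>h \<mapsto> \<integral>x. k x * \<phi> (x + h *\<^sub>R e)\<close>, which by translation invariance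
  can be taken on either factor.\<close>
lemma integral_by_parts_directional:
  fixes k \<phi> k' \<phi>' :: "'a::euclidean_space \<Rightarrow> real"
  assumes k: "integrable lborel k" "\<And>x. \<bar>k x\<bar> \<le> K" and k' [measurable]: "k' \<in> borel_measurable borel" "\<And>x. \<bar>k' x\<bar> \<le> K"
    and \<phi>: "integrable lborel \<phi>" "\<And>x. \<bar>\<phi> x\<bar> \<le> B" and \<phi>' [measurable]: "\<phi>' \<in> borel_measurable borel" "\<And>x. \<bar>\<phi>' x\<bar> \<le> B"
    and deriv_k: "\<And>x h. ((\<lambda>h. k (x + h *\<^sub>R e)) has_real_derivative k' (x + h *\<^sub>R e)) (at h)"
    and deriv_\<phi>: "\<And>x h. ((\<lambda>h. \<phi> (x + h *\<^sub>R e)) has_real_derivative \<phi>' (x + h *\<^sub>R e)) (at h)"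
  shows "(\<integral>x. \<phi>' x * k x \<partial>lborel) = - (\<integral>x. \<phi> x * k' x \<partial>lborel)"
proof -
  have [measurable]: "k \<in> borel_measurable borel" "\<phi> \<in> borel_measurable borel" using k(1) \<phi>(1) by simp_all
  have int_k: "integrable lborel (\<lambda>x. k x * \<phi> (x + h *\<^sub>R e))" for h
    by (rule Bochner_Integration.integrable_bound[OF integrable_mult_right[OF k(1), of B]])
      (auto simp: abs_mult mult.commute[of B] intro!: AE_I2 mult_left_mono order_trans[OF \<phi>(2) abs_ge_self])
  have int_\<phi>: "integrable lborel (\<lambda>x. k (x - h *\<^sub>R e) * \<phi> x)" for h
    by (rule Bochner_Integration.integrable_bound[OF integrable_mult_right[OF \<phi>(1), of K]])
      (auto simp: abs_mult intro!: AE_I2 mult_right_mono order_trans[OF k(2) abs_ge_self])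
  have "((\<lambda>h. \<integral>x. k x * \<phi> (x + h *\<^sub>R e) \<partial>lborel) has_vector_derivative (\<integral>x. k x * \<phi>' (x + 0 *\<^sub>R e) \<partial>lborel)) (at 0)"
  proof (rule has_vector_derivative_integral_dominated[where e = 1 and w = "\<lambda>x. B * \<bar>k x\<bar>"])
    show "((\<lambda>h. k x * \<phi> (x + h *\<^sub>R e)) has_vector_derivative k x * \<phi>' (x + h *\<^sub>R e)) (at h)" for x h
      using DERIV_cmult[OF deriv_\<phi>] by (simp add: has_real_derivative_iff_has_vector_derivative)
    show "norm (k x * \<phi>' (x + h *\<^sub>R e)) \<le> B * \<bar>k x\<bar>" for x h
      using mult_right_mono[OF \<phi>'(2) abs_ge_zero[of "k x"]] by (simp add: abs_mult mult.commute[of "\<bar>k x\<bar>"])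
  qed (use k int_k in auto)
  moreover have "((\<lambda>h. \<integral>x. k (x - h *\<^sub>R e) * \<phi> x \<partial>lborel) has_vector_derivative (\<integral>x. - k' (x - 0 *\<^sub>R e) * \<phi> x \<partial>lborel))
       (at 0)"
  proof (rule has_vector_derivative_integral_dominated[where e = 1 and w = "\<lambda>x. K * \<bar>\<phi> x\<bar>"])
    show "((\<lambda>h. k (x - h *\<^sub>R e) * \<phi> x) has_vector_derivative - k' (x - h *\<^sub>R e) * \<phi> x) (at h)" for x h
    proof -
      have "((\<lambda>h. k (x + (- h) *\<^sub>R e)) has_real_derivative k' (x + (- h) *\<^sub>R e) * (- 1)) (at h)"
        by (rule DERIV_chain2[OF deriv_k]) (auto intro!: derivative_eq_intros)
      from DERIV_cmult_right[OF this, of "\<phi> x"] show ?thesis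
        by (simp add: has_real_derivative_iff_has_vector_derivative)
    qed
    show "norm (- k' (x - h *\<^sub>R e) * \<phi> x) \<le> K * \<bar>\<phi> x\<bar>" for x h
      using mult_right_mono[OF k'(2) abs_ge_zero[of "\<phi> x"]] by (simp add: abs_mult)
  qed (use \<phi> int_\<phi> in auto)
  moreover have "(\<integral>x. k x * \<phi> (x + h *\<^sub>R e) \<partial>lborel) = (\<integral>x. k (x - h *\<^sub>R e) * \<phi> x \<partial>lborel)" for h
    using integral_lborel_shift[of "\<lambda>x. k (x - h *\<^sub>R e) * \<phi> x" "h *\<^sub>R e"] by (simp add: add.commute)
  ultimately have "(\<integral>x. k x * \<phi>' x \<partial>lborel) = (\<integral>x. - k' x * \<phi> x \<partial>lborel)"
    by (simp add: vector_derivative_unique_at)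
  then show ?thesis by (simp add: mult.commute)
qed

lemma weak_partial_heat_kernel:
  "weak_partial j (\<lambda>x. heat_kernel s (x - y)) (\<lambda>x. heat_kernel_deriv (axis j 1) s (x - y))"
proof (cases "0 < s")
  case s: True
  let ?k = "\<lambda>x :: R2. heat_kernel s (x - y)" and ?k' = "\<lambda>x :: R2. heat_kernel_deriv (axis j 1) s (x - y)"
  define K where "K = max (1 / (4 * pi * s)) (2 * pos_powr (1 / 2) s * (1 / (4 * pi * (2 * s))))"
  have K: "\<bar>?k x\<bar> \<le> K" "\<bar>?k' x\<bar> \<le> K" for x
  proof -
    show "\<bar>?k x\<bar> \<le> K" using heat_kernel_le[of s "x - y"] s by (simp add: K_def le_max_iff_disj)
    have "heat_kernel (2 * s) (x - y) \<le> 1 / (4 * pi * (2 * s))" using heat_kernel_le[of "2 * s" "x - y"] s by simp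
    then have "\<bar>?k' x\<bar> \<le> 2 * pos_powr (1 / 2) s * (1 / (4 * pi * (2 * s)))"
      by (intro order_trans[OF abs_heat_kernel_deriv_axis_le mult_left_mono]) simp_all
    then show "\<bar>?k' x\<bar> \<le> K" unfolding K_def by (rule max.coboundedI2)
  qed
  have k_int: "integrable lborel ?k"
    using nn_integral_heat_kernel_shift[OF s, of y] by (intro integrableI_nonneg) auto
  have deriv_k: "((\<lambda>h. ?k (x + h *\<^sub>R axis j 1)) has_real_derivative ?k' (x + h *\<^sub>R axis j 1)) (at h)" for x h
    using heat_kernel_has_directional_derivative[of s "x - y" "axis j 1" h] by (simp only: diff_add_eq)
  show ?thesis
    unfolding weak_partial_def
  proof (intro allI impI conjI)
    fix \<phi> assume \<phi> [measurable]: "test_fun \<phi>"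
    have [measurable]: "partial j \<phi> \<in> borel_measurable borel" by (rule test_fun_partial_measurable[OF \<phi>])
    obtain B R where B: "0 \<le> B" "\<And>x. \<bar>\<phi> x\<bar> \<le> B * indicator (cball 0 R) x"
      "\<And>x. \<bar>partial j \<phi> x\<bar> \<le> B * indicator (cball 0 R) x"
      using test_fun_bounds[OF \<phi>, of j] by blast
    have B': "\<bar>\<phi> x\<bar> \<le> B" "\<bar>partial j \<phi> x\<bar> \<le> B" for x
      using B(1) B(2,3)[of x] by (auto split: split_indicator_asm)
    note int = integrable_mult_bounded_indicator_cball
    show "integrable lborel (\<lambda>x. partial j \<phi> x *\<^sub>R ?k x)" "integrable lborel (\<lambda>x. \<phi> x *\<^sub>R ?k' x)"
      unfolding scaleR_conv_of_real of_real_eq_id id_apply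
      by (rule int[OF _ _ B(3) K(1)] int[OF _ _ B(2) K(2)]; measurable)+
    have "integrable lborel \<phi>" using int[OF _ _ B(2), of "\<lambda>_. 1" 1] by simp
    then have "(\<integral>x. partial j \<phi> x * ?k x \<partial>lborel) = - (\<integral>x. \<phi> x * ?k' x \<partial>lborel)"
      by (intro integral_by_parts_directional[OF k_int K(1) _ K(2) _ B'(1) _ B'(2)
        deriv_k test_fun_has_directional_derivative[OF \<phi>]]) measurable
    then show "(\<integral>x. partial j \<phi> x *\<^sub>R ?k x \<partial>lborel) = - (\<integral>x. \<phi> x *\<^sub>R ?k' x \<partial>lborel)" by simp
  qed
qed (simp add: weak_partial_def)

lemma
  fixes \<kappa> :: "'z::euclidean_space \<Rightarrow> 'a::euclidean_space \<Rightarrow> real"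
    and c :: "'z \<Rightarrow> 'b::{banach, second_countable_topology}" and \<psi> :: "'a \<Rightarrow> real"
  assumes [measurable]: "case_prod \<kappa> \<in> borel_measurable (lborel \<Otimes>\<^sub>M lborel)"
    "c \<in> borel_measurable borel" "\<psi> \<in> borel_measurable borel" "A \<in> sets borel"
    and fin: "(\<integral>\<^sup>+ x. (\<integral>\<^sup>+ z. ennreal (\<bar>\<kappa> z x\<bar> * norm (c z)) \<partial>lborel) * indicator A x \<partial>lborel) < \<infinity>"
    and \<psi>: "\<And>x. \<bar>\<psi> x\<bar> \<le> B * indicator A x" and int: "\<And>z. integrable lborel (\<lambda>x. \<psi> x * \<kappa> z x)"
  shows integrable_scaleR_superposition: "integrable lborel (\<lambda>x. \<psi> x *\<^sub>R (\<integral>z. \<kappa> z x *\<^sub>R c z \<partial>lborel))"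
    and integral_scaleR_superposition: "(\<integral>x. \<psi> x *\<^sub>R (\<integral>z. \<kappa> z x *\<^sub>R c z \<partial>lborel) \<partial>lborel)
        = (\<integral>z. (\<integral>x. \<psi> x * \<kappa> z x \<partial>lborel) *\<^sub>R c z \<partial>lborel)"
proof -
  define g where "g x z = (\<psi> x * \<kappa> z x) *\<^sub>R c z" for x z
  have [measurable]: "case_prod g \<in> borel_measurable (lborel \<Otimes>\<^sub>M lborel)" unfolding g_def by measurable
  have "(\<integral>\<^sup>+ x. \<integral>\<^sup>+ z. ennreal (norm (g x z)) \<partial>lborel \<partial>lborel)
     \<le> (\<integral>\<^sup>+ x. ennreal B * ((\<integral>\<^sup>+ z. ennreal (\<bar>\<kappa> z x\<bar> * norm (c z)) \<partial>lborel) * indicator A x) \<partial>lborel)"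
  proof (rule nn_integral_mono)
    fix x
    have "(\<integral>\<^sup>+ z. ennreal (norm (g x z)) \<partial>lborel) = ennreal \<bar>\<psi> x\<bar> * (\<integral>\<^sup>+ z. ennreal (\<bar>\<kappa> z x\<bar> * norm (c z)) \<partial>lborel)"
      by (subst nn_integral_cmult[symmetric]) (simp_all add: g_def abs_mult ennreal_mult'[symmetric] mult.assoc)
    also have "\<dots> \<le> ennreal (B * indicator A x) * (\<integral>\<^sup>+ z. ennreal (\<bar>\<kappa> z x\<bar> * norm (c z)) \<partial>lborel)"
      by (intro mult_right_mono ennreal_leI \<psi>) simp
    finally show "(\<integral>\<^sup>+ z. ennreal (norm (g x z)) \<partial>lborel)
         \<le> ennreal B * ((\<integral>\<^sup>+ z. ennreal (\<bar>\<kappa> z x\<bar> * norm (c z)) \<partial>lborel) * indicator A x)"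
      by (simp split: split_indicator_asm split_indicator)
  qed
  also have "\<dots> < \<infinity>" using fin by (simp add: nn_integral_cmult ennreal_mult_less_top)
  finally have g_fin: "(\<integral>\<^sup>+ x. \<integral>\<^sup>+ z. ennreal (norm (g x z)) \<partial>lborel \<partial>lborel) < \<infinity>" .
  have over_z: "(\<integral>z. g x z \<partial>lborel) = \<psi> x *\<^sub>R (\<integral>z. \<kappa> z x *\<^sub>R c z \<partial>lborel)" for x
    unfolding g_def scaleR_scaleR[symmetric] by (rule integral_scaleR_right)
  have over_x: "(\<integral>x. g x z \<partial>lborel) = (\<integral>x. \<psi> x * \<kappa> z x \<partial>lborel) *\<^sub>R c z" for z
    unfolding g_def using int by (intro integral_scaleR_left)
  show "integrable lborel (\<lambda>x. \<psi> x *\<^sub>R (\<integral>z. \<kappa> z x *\<^sub>R c z \<partial>lborel))"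
    unfolding over_z[symmetric] using g_fin by (intro lborel_Fubini(2)) auto
  show "(\<integral>x. \<psi> x *\<^sub>R (\<integral>z. \<kappa> z x *\<^sub>R c z \<partial>lborel) \<partial>lborel) = (\<integral>z. (\<integral>x. \<psi> x * \<kappa> z x \<partial>lborel) *\<^sub>R c z \<partial>lborel)"
    unfolding over_z[symmetric] over_x[symmetric] using g_fin by (intro lborel_Fubini(1)) auto
qed

lemma weak_partial_superposition:
  fixes k k' :: "'z::euclidean_space \<Rightarrow> R2 \<Rightarrow> real" and c :: "'z \<Rightarrow> 'b::{banach, second_countable_topology}"
  assumes [measurable]: "case_prod k \<in> borel_measurable (lborel \<Otimes>\<^sub>M lborel)"
    "case_prod k' \<in> borel_measurable (lborel \<Otimes>\<^sub>M lborel)" "c \<in> borel_measurable borel"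
    and weak: "\<And>z. weak_partial j (k z) (k' z)"
    and fin: "\<And>R. (\<integral>\<^sup>+ x. (\<integral>\<^sup>+ z. ennreal (\<bar>k z x\<bar> * norm (c z)) \<partial>lborel) * indicator (cball 0 R) x \<partial>lborel) < \<infinity>"
    and fin': "\<And>R. (\<integral>\<^sup>+ x. (\<integral>\<^sup>+ z. ennreal (\<bar>k' z x\<bar> * norm (c z)) \<partial>lborel) * indicator (cball 0 R) x \<partial>lborel) < \<infinity>"
  shows "weak_partial j (\<lambda>x. \<integral>z. k z x *\<^sub>R c z \<partial>lborel) (\<lambda>x. \<integral>z. k' z x *\<^sub>R c z \<partial>lborel)"
  unfolding weak_partial_def
proof (intro allI impI conjI)
  fix \<phi> assume \<phi> [measurable]: "test_fun \<phi>"
  have [measurable]: "partial j \<phi> \<in> borel_measurable borel" by (rule test_fun_partial_measurable[OF \<phi>])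
  obtain B R where B: "0 \<le> B" "\<And>x. \<bar>\<phi> x\<bar> \<le> B * indicator (cball 0 R) x"
    "\<And>x. \<bar>partial j \<phi> x\<bar> \<le> B * indicator (cball 0 R) x"
    using test_fun_bounds[OF \<phi>, of j] by blast
  have k: "integrable lborel (\<lambda>x. partial j \<phi> x * k z x)" "integrable lborel (\<lambda>x. \<phi> x * k' z x)"
    "(\<integral>x. partial j \<phi> x * k z x \<partial>lborel) = - (\<integral>x. \<phi> x * k' z x \<partial>lborel)" for z
    using weak[of z] \<phi> unfolding weak_partial_def by simp_all
  show "integrable lborel (\<lambda>x. partial j \<phi> x *\<^sub>R (\<integral>z. k z x *\<^sub>R c z \<partial>lborel))"
    by (rule integrable_scaleR_superposition[OF _ _ _ _ fin B(3) k(1)]) auto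
  show "integrable lborel (\<lambda>x. \<phi> x *\<^sub>R (\<integral>z. k' z x *\<^sub>R c z \<partial>lborel))"
    by (rule integrable_scaleR_superposition[OF _ _ _ _ fin' B(2) k(2)]) auto
  have "(\<integral>x. partial j \<phi> x *\<^sub>R (\<integral>z. k z x *\<^sub>R c z \<partial>lborel) \<partial>lborel)
       = (\<integral>z. (\<integral>x. partial j \<phi> x * k z x \<partial>lborel) *\<^sub>R c z \<partial>lborel)"
    by (rule integral_scaleR_superposition[OF _ _ _ _ fin B(3) k(1)]) auto
  also have "\<dots> = - (\<integral>z. (\<integral>x. \<phi> x * k' z x \<partial>lborel) *\<^sub>R c z \<partial>lborel)" by (simp add: k(3))
  also have "(\<integral>z. (\<integral>x. \<phi> x * k' z x \<partial>lborel) *\<^sub>R c z \<partial>lborel) = (\<integral>x. \<phi> x *\<^sub>R (\<integral>z. k' z x *\<^sub>R c z \<partial>lborel) \<partial>lborel)"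
    by (rule integral_scaleR_superposition[OF _ _ _ _ fin' B(2) k(2), symmetric]) auto
  finally show "(\<integral>x. partial j \<phi> x *\<^sub>R (\<integral>z. k z x *\<^sub>R c z \<partial>lborel) \<partial>lborel)
       = - (\<integral>x. \<phi> x *\<^sub>R (\<integral>z. k' z x *\<^sub>R c z \<partial>lborel) \<partial>lborel)" .
qed

section \<open>The gradient of the evolution\<close>

lemma heat_weak_partial:
  fixes f :: "R2 \<Rightarrow> 'b::{banach, second_countable_topology}"
  assumes f [measurable]: "Lp_mem p f" and p: "1 < p" and t: "0 < t"
  shows "weak_partial j (convolve (heat_kernel t) f) (convolve (heat_kernel_deriv (axis j 1) t) f)"
proof -
  have fin: "(\<integral>\<^sup>+ x. (\<integral>\<^sup>+ z. ennreal (\<bar>\<kappa> (x - z)\<bar> * norm (f z)) \<partial>lborel) * indicator (cball 0 R) x \<partial>lborel) < \<infinity>"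
    if [measurable]: "\<kappa> \<in> borel_measurable borel" and \<kappa>: "\<And>z. \<bar>\<kappa> z\<bar> \<le> A * heat_kernel s z" and s: "0 < s" and A: "0 \<le> A"
    for \<kappa> :: "R2 \<Rightarrow> real" and A s R :: real
  proof -
    define C where "C = Lp_norm p f * s powr (- (1 / p))"
    have "(\<integral>\<^sup>+ z. ennreal (\<bar>\<kappa> (x - z)\<bar> * norm (f z)) \<partial>lborel) \<le> ennreal A * ennreal C" for x
    proof -
      have "(\<integral>\<^sup>+ z. ennreal (\<bar>\<kappa> (x - z)\<bar> * norm (f z)) \<partial>lborel)
           \<le> (\<integral>\<^sup>+ z. ennreal A * ennreal (heat_kernel s (x - z) * norm (f z)) \<partial>lborel)"
        using mult_right_mono[OF \<kappa> norm_ge_zero] A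
        by (intro nn_integral_mono) (simp add: ennreal_mult'[symmetric] ennreal_leI mult.assoc)
      also have "\<dots> = ennreal A * (\<integral>\<^sup>+ z. ennreal (heat_kernel s (x - z) * norm (f z)) \<partial>lborel)"
        by (rule nn_integral_cmult) measurable
      also have "\<dots> \<le> ennreal A * ennreal C" unfolding C_def
        by (intro mult_left_mono nn_integral_heat_kernel_mult_le f p s) simp
      finally show ?thesis .
    qed
    then have "(\<integral>\<^sup>+ x. (\<integral>\<^sup>+ z. ennreal (\<bar>\<kappa> (x - z)\<bar> * norm (f z)) \<partial>lborel) * indicator (cball 0 R) x \<partial>lborel)
       \<le> (\<integral>\<^sup>+ x. ennreal A * ennreal C * indicator (cball 0 R) (x :: R2) \<partial>lborel)"
      by (intro nn_integral_mono mult_right_mono) simp_all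
    also have "\<dots> < \<infinity>" using emeasure_bounded_finite[of "cball (0 :: R2) R"]
      by (simp add: nn_integral_cmult_indicator ennreal_mult_less_top)
    finally show ?thesis .
  qed
  show ?thesis
    unfolding convolve_def[abs_def]
  proof (rule weak_partial_superposition[OF _ _ _ weak_partial_heat_kernel])
    show "(\<integral>\<^sup>+ x. (\<integral>\<^sup>+ z. ennreal (\<bar>heat_kernel t (x - z)\<bar> * norm (f z)) \<partial>lborel) * indicator (cball 0 R) x \<partial>lborel)
         < \<infinity>" for R
      by (rule fin[where A = 1 and s = t]) (use t in auto)
    show "(\<integral>\<^sup>+ x. (\<integral>\<^sup>+ z. ennreal (\<bar>heat_kernel_deriv (axis j 1) t (x - z)\<bar> * norm (f z)) \<partial>lborel)
         * indicator (cball 0 R) x \<partial>lborel) < \<infinity>" for R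
      by (rule fin[OF _ abs_heat_kernel_deriv_axis_le]) (use t in auto)
  qed measurable
qed

lemma nn_integral_heat_kernel_time_integral_less_top:
  fixes \<kappa> :: "real \<Rightarrow> R2 \<Rightarrow> real" and v :: "real \<Rightarrow> 'b::{banach, second_countable_topology}"
  assumes [measurable]: "case_prod \<kappa> \<in> borel_measurable (lborel \<Otimes>\<^sub>M lborel)" "v \<in> borel_measurable borel"
    and a: "0 \<le> a" "a < 1" and b: "0 \<le> b" "b < 1" and c: "0 < c" and t: "0 < t" and A: "0 \<le> A" and M: "0 \<le> M"
    and \<kappa>: "\<And>\<tau> x. \<bar>\<kappa> \<tau> x\<bar> \<le> A * pos_powr a (t - \<tau>) * heat_kernel (c * (t - \<tau>)) x"
      and v: "\<And>\<tau>. norm (v \<tau>) \<le> M * pos_powr b \<tau>"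
  shows "(\<integral>\<^sup>+ x. (\<integral>\<^sup>+ \<tau>. ennreal (\<bar>\<kappa> \<tau> x\<bar> * norm (v \<tau>)) \<partial>lborel) * indicator S x \<partial>lborel) < \<infinity>"
proof -
  let ?w = "\<lambda>\<tau>. A * M * (pos_powr a (t - \<tau>) * pos_powr b \<tau>)"
  have "(\<integral>\<^sup>+ x. (\<integral>\<^sup>+ \<tau>. ennreal (\<bar>\<kappa> \<tau> x\<bar> * norm (v \<tau>)) \<partial>lborel) * indicator S x \<partial>lborel)
     \<le> (\<integral>\<^sup>+ x. \<integral>\<^sup>+ \<tau>. ennreal (\<bar>\<kappa> \<tau> x\<bar> * norm (v \<tau>)) \<partial>lborel \<partial>lborel)"
    by (intro nn_integral_mono) (simp split: split_indicator)
  also have "\<dots> = (\<integral>\<^sup>+ \<tau>. \<integral>\<^sup>+ x. ennreal (\<bar>\<kappa> \<tau> x\<bar> * norm (v \<tau>)) \<partial>lborel \<partial>lborel)" by (rule lborel_Tonelli) measurable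
  also have "\<dots> \<le> (\<integral>\<^sup>+ \<tau>. ennreal (?w \<tau>) \<partial>lborel)"
  proof (rule nn_integral_mono)
    fix \<tau> :: real
    have "ennreal (\<bar>\<kappa> \<tau> x\<bar> * norm (v \<tau>)) \<le> ennreal (?w \<tau>) * ennreal (heat_kernel (c * (t - \<tau>)) x)" for x
    proof -
      have "\<bar>\<kappa> \<tau> x\<bar> * norm (v \<tau>) \<le> (A * pos_powr a (t - \<tau>) * heat_kernel (c * (t - \<tau>)) x) * (M * pos_powr b \<tau>)"
        using A by (intro mult_mono \<kappa> v) auto
      then show ?thesis using A M by (simp add: ennreal_mult'[symmetric] ennreal_leI mult_ac)
    qed
    then have "(\<integral>\<^sup>+ x. ennreal (\<bar>\<kappa> \<tau> x\<bar> * norm (v \<tau>)) \<partial>lborel)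
        \<le> ennreal (?w \<tau>) * (\<integral>\<^sup>+ x. ennreal (heat_kernel (c * (t - \<tau>)) (x :: R2)) \<partial>lborel)"
      by (subst nn_integral_cmult[symmetric]) (auto intro: nn_integral_mono)
    then show "(\<integral>\<^sup>+ x. ennreal (\<bar>\<kappa> \<tau> x\<bar> * norm (v \<tau>)) \<partial>lborel) \<le> ennreal (?w \<tau>)"
      using c by (cases "\<tau> < t") (simp_all add: nn_integral_heat_kernel)
  qed
  also have "\<dots> = ennreal (A * M) * (\<integral>\<^sup>+ \<tau>. ennreal (pos_powr a (t - \<tau>) * pos_powr b \<tau>) \<partial>lborel)"
    using A M by (simp add: ennreal_mult' nn_integral_cmult)
  also have "\<dots> < \<infinity>"
    using le_less_trans[OF nn_integral_pos_powr_mult_le[OF a b t]] by (simp add: ennreal_mult_less_top)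
  finally show ?thesis .
qed

lemma singular_part_weak_partial:
  fixes f :: "R2 \<Rightarrow> 'b::{banach, second_countable_topology}"
  assumes f [measurable]: "Lp_mem p f" and p: "1 < p" and E: "0 < E" and t: "0 < t"
  shows "weak_partial j (singular_part E f t) (\<lambda>x. convolve (\<lambda>r. heat_kernel_deriv (axis j 1) r x) (heat_charge E f) t)"
proof -
  have b: "0 \<le> 1 / p" "1 / p < 1" using p by auto
  have M: "0 \<le> charge_const (1 / p) * Lp_norm p f" using p by (simp add: charge_const_def)
  note fin = nn_integral_heat_kernel_time_integral_less_top[OF _ _ _ _ b _ t _ M _ norm_heat_charge_le[OF f p E]]
  show ?thesis
    unfolding singular_part_def[abs_def] convolve_def
  proof (rule weak_partial_superposition)
    show "weak_partial j (heat_kernel (t - r)) (heat_kernel_deriv (axis j 1) (t - r))" for r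
      using weak_partial_heat_kernel[of j "t - r" 0] by simp
    have kernel_le: "\<bar>heat_kernel (t - r) (x :: R2)\<bar> \<le> 1 * pos_powr 0 (t - r) * heat_kernel (1 * (t - r)) x" for r x
      by (cases "r < t") simp_all
    show "(\<integral>\<^sup>+ x. (\<integral>\<^sup>+ r. ennreal (\<bar>heat_kernel (t - r) x\<bar> * norm (heat_charge E f r)) \<partial>lborel)
         * indicator (cball (0 :: R2) R) x \<partial>lborel) < \<infinity>" for R
      by (rule fin[OF _ _ _ _ _ _ kernel_le]) auto
    show "(\<integral>\<^sup>+ x. (\<integral>\<^sup>+ r. ennreal (\<bar>heat_kernel_deriv (axis j 1) (t - r) x\<bar> * norm (heat_charge E f r)) \<partial>lborel)
         * indicator (cball (0 :: R2) R) x \<partial>lborel) < \<infinity>" for R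
      by (rule fin[OF _ _ _ _ _ _ abs_heat_kernel_deriv_axis_le]) auto
  qed measurable
qed

definition evol_partial :: "real \<Rightarrow> (R2 \<Rightarrow> 'b::{banach, second_countable_topology}) \<Rightarrow> real \<Rightarrow> 2 \<Rightarrow> R2 \<Rightarrow> 'b" where
  "evol_partial E f t j x = convolve (heat_kernel_deriv (axis j 1) t) f x
     + convolve (\<lambda>r. heat_kernel_deriv (axis j 1) r x) (heat_charge E f) t"

lemma evol_partial_measurable [measurable]:
  assumes [measurable]: "f \<in> borel_measurable borel"
  shows "evol_partial E f t j \<in> borel_measurable borel"
  unfolding evol_partial_def[abs_def] by measurable

lemma evol_weak_partial:
  assumes f: "Lp_mem p f" and p: "1 < p" and E: "0 < E" and t: "0 < t"
  shows "weak_partial j (evol E f t) (evol_partial E f t j)"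
  unfolding evol_def[abs_def] evol_partial_def[abs_def]
  by (intro weak_partial_add heat_weak_partial[OF f p t] singular_part_weak_partial[OF f p E t])

lemma
  fixes f :: "R2 \<Rightarrow> 'b::{banach, second_countable_topology}"
  assumes f [measurable]: "Lp_mem q f" and q: "1 < q" "q \<le> p" and s: "0 < s"
  shows Lp_mem_heat_smoothing: "Lp_mem p (convolve (heat_kernel s) f)"
    and Lp_norm_heat_smoothing_le: "Lp_norm p (convolve (heat_kernel s) f) \<le> s powr (- (1 / q - 1 / p)) * Lp_norm q f"
proof -
  define S where "S = Lp_norm q f * s powr (- (1 / q))"
  have bound: "norm (convolve (heat_kernel s) f x) \<le> S" for x
    using norm_heat_le[OF f q(1), of s x] s by (simp add: S_def)
  note interpolation = Lp_interpolation[OF Lp_mem_heat[OF f q(1) s] _ q(2) bound]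
  show "Lp_mem p (convolve (heat_kernel s) f)" using q by (intro interpolation(1)) simp
  have "Lp_norm p (convolve (heat_kernel s) f)
       \<le> S powr (1 - q / p) * Lp_norm q (convolve (heat_kernel s) f) powr (q / p)"
    using q by (intro interpolation(2)) simp
  also have "\<dots> \<le> S powr (1 - q / p) * Lp_norm q f powr (q / p)"
    using q by (intro mult_left_mono powr_mono2 Lp_norm_heat_le f s) auto
  also have "\<dots> = s powr (- (1 / q) * (1 - q / p)) * (Lp_norm q f powr (1 - q / p) * Lp_norm q f powr (q / p))"
    by (simp add: S_def powr_mult powr_powr)
  also have "- (1 / q) * (1 - q / p) = - (1 / q - 1 / p)" using q by (simp add: field_simps)
  also have "Lp_norm q f powr (1 - q / p) * Lp_norm q f powr (q / p) = Lp_norm q f"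
    by (simp add: powr_add[symmetric])
  finally show "Lp_norm p (convolve (heat_kernel s) f) \<le> s powr (- (1 / q - 1 / p)) * Lp_norm q f" .
qed

lemma
  fixes f :: "R2 \<Rightarrow> 'b::{banach, second_countable_topology}"
  assumes f [measurable]: "Lp_mem q f" and q: "1 < q" "q \<le> p" and t: "0 < t"
  shows Lp_mem_heat_partial: "Lp_mem p (convolve (heat_kernel_deriv (axis j 1) t) f)"
    and Lp_norm_heat_partial_le: "Lp_norm p (convolve (heat_kernel_deriv (axis j 1) t) f)
        \<le> 2 * t powr (- (1 / 2) - (1 / q - 1 / p)) * Lp_norm q f"
proof -
  let ?H = "convolve (heat_kernel (2 * t)) (\<lambda>y. norm (f y))"
  define c where "c = 2 * pos_powr (1 / 2) t"
  have c: "0 \<le> c" by (simp add: c_def)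
  have H: "Lp_mem p ?H" "Lp_norm p ?H \<le> (2 * t) powr (- (1 / q - 1 / p)) * Lp_norm q f"
    using Lp_mem_heat_smoothing[OF Lp_mem_norm[OF f] q, of
      "2 * t"] Lp_norm_heat_smoothing_le[OF Lp_mem_norm[OF f] q, of "2 * t"] t
    by (simp_all add: Lp_norm_norm)
  have "norm (convolve (heat_kernel_deriv (axis j 1) t) f x) \<le> c * ?H x" for x
    unfolding c_def by (rule heat_dominated[OF f q(1) _ abs_heat_kernel_deriv_axis_le]) (use t in simp)
  then have le: "AE x in lborel. norm (convolve (heat_kernel_deriv (axis j 1) t) f x) \<le> c * norm (?H x)"
    using order_trans[OF _ mult_left_mono[OF abs_ge_self c]] by (intro AE_I2) simp
  have "convolve (heat_kernel_deriv (axis j 1) t) f \<in> borel_measurable borel" by measurable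
  note dominated = Lp_dominated[OF this H(1) _ c le]
  show "Lp_mem p (convolve (heat_kernel_deriv (axis j 1) t) f)" using q by (intro dominated(1)) simp
  have "Lp_norm p (convolve (heat_kernel_deriv (axis j 1) t) f) \<le> c * Lp_norm p ?H" using q by (intro dominated(2)) simp
  also have "\<dots> \<le> c * ((2 * t) powr (- (1 / q - 1 / p)) * Lp_norm q f)" using H(2) c by (rule mult_left_mono)
  also have "\<dots> \<le> c * (t powr (- (1 / q - 1 / p)) * Lp_norm q f)"
    using q t c by (intro mult_left_mono mult_right_mono powr_mono2') (auto simp: field_simps)
  also have "\<dots> = 2 * t powr (- (1 / 2) - (1 / q - 1 / p)) * Lp_norm q f"
    by (simp only: diff_conv_add_uminus[of "- (1 / 2)"] powr_add c_def pos_powr_pos[OF t] mult.assoc)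
  finally show "Lp_norm p (convolve (heat_kernel_deriv (axis j 1) t) f)
       \<le> 2 * t powr (- (1 / 2) - (1 / q - 1 / p)) * Lp_norm q f" .
qed

lemma
  fixes f :: "R2 \<Rightarrow> 'b::{banach, second_countable_topology}" and j :: 2
  assumes f [measurable]: "Lp_mem q f" and q: "1 < q" and p: "1 < p" "p < 2" and E: "0 < E" and t: "0 < t"
  defines "S \<equiv> \<lambda>x. convolve (\<lambda>r. heat_kernel_deriv (axis j 1) r x) (heat_charge E f) t"
  shows Lp_mem_singular_partial: "Lp_mem p S"
    and Lp_norm_singular_partial_le: "Lp_norm p S
        \<le> heat_convolution_const p (1 / 2) (1 / q) 2 * (2 * charge_const (1 / q))
        * t powr (- (1 / 2) - (1 / q - 1 / p)) * Lp_norm q f"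
proof -
  define M where "M = 2 * charge_const (1 / q) * Lp_norm q f"
  have M: "0 \<le> M" using q by (simp add: M_def charge_const_def)
  let ?g = "\<lambda>r x. heat_kernel_deriv (axis j 1) (t - r) x *\<^sub>R heat_charge E f r"
  have bound: "norm (?g r x) \<le> M * (pos_powr (1 / 2) (t - r) * heat_kernel (2 * (t - r)) x * pos_powr (1 / q) r)" for r
    and x :: R2
  proof -
    have "norm (?g r x) \<le> (2 * pos_powr (1 / 2) (t - r) * heat_kernel (2 * (t - r)) x)
         * (charge_const (1 / q) * Lp_norm q f * pos_powr (1 / q) r)"
      unfolding norm_scaleR real_norm_def
      by (rule mult_mono[OF abs_heat_kernel_deriv_axis_le norm_heat_charge_le[OF f q E]]) simp_all
    then show ?thesis by (simp add: M_def mult_ac)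
  qed
  have "case_prod ?g \<in> borel_measurable (lborel \<Otimes>\<^sub>M lborel)" by measurable
  note time_integral = Lp_heat_kernel_time_integral[OF this p(1) _ _ _ _ _ t M bound]
  have S: "S = (\<lambda>x. \<integral>r. ?g r x \<partial>lborel)" by (simp add: S_def convolve_def)
  show "Lp_mem p S" unfolding S using p q by (intro time_integral(1)) auto
  have "Lp_norm p S \<le> heat_convolution_const p (1 / 2) (1 / q) 2 * M * t powr (1 / p - 1 / 2 - 1 / q)"
    unfolding S using p q by (intro time_integral(2)) auto
  also have "1 / p - 1 / 2 - 1 / q = - (1 / 2) - (1 / q - 1 / p)" by simp
  finally show "Lp_norm p S \<le> heat_convolution_const p (1 / 2) (1 / q) 2
       * (2 * charge_const (1 / q)) * t powr (- (1 / 2) - (1 / q - 1 / p)) * Lp_norm q f"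
    by (simp add: M_def mult_ac)
qed

definition evol_partial_const :: "real \<Rightarrow> real \<Rightarrow> real" where
  "evol_partial_const p q = 2 + heat_convolution_const p (1 / 2) (1 / q) 2 * (2 * charge_const (1 / q))"

lemma
  fixes f :: "R2 \<Rightarrow> 'b::{banach, second_countable_topology}"
  assumes f [measurable]: "Lp_mem q f" and pq: "1 < q" "q \<le> p" "p < 2" and E: "0 < E" and t: "0 < t"
  shows Lp_mem_evol_partial: "Lp_mem p (evol_partial E f t j)"
    and Lp_norm_evol_partial_le: "Lp_norm p (evol_partial E f t j)
        \<le> evol_partial_const p q * t powr (- (1 / 2) - (1 / q - 1 / p)) * Lp_norm q f"
proof -
  have p: "1 < p" using pq by simp
  note heat = Lp_mem_heat_partial[OF f pq(1,2) t, of j] Lp_norm_heat_partial_le[OF f pq(1,2) t, of j]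
  note singular = Lp_mem_singular_partial[OF f pq(1) p pq(3) E t, of j]
    Lp_norm_singular_partial_le[OF f pq(1) p pq(3) E t, of j]
  have "norm (evol_partial E f t j x) \<le> norm (convolve (heat_kernel_deriv (axis j 1) t) f x)
      + norm (convolve (\<lambda>r. heat_kernel_deriv (axis j 1) r x) (heat_charge E f) t)" for x
    unfolding evol_partial_def by (rule norm_triangle_ineq)
  note sum = Lp_triangle[OF evol_partial_measurable heat(1) singular(1) less_imp_le[OF p] this]
  show "Lp_mem p (evol_partial E f t j)" by (rule sum(1)) measurable
  have "Lp_norm p (evol_partial E f t j) \<le> Lp_norm p (convolve (heat_kernel_deriv (axis j 1) t) f)
      + Lp_norm p (\<lambda>x. convolve (\<lambda>r. heat_kernel_deriv (axis j 1) r x) (heat_charge E f) t)"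
    by (rule sum(2)) measurable
  then show "Lp_norm p (evol_partial E f t j)
      \<le> evol_partial_const p q * t powr (- (1 / 2) - (1 / q - 1 / p)) * Lp_norm q f"
    using heat(2) singular(2) by (simp add: evol_partial_const_def distrib_right)
qed

lemma norm_vec2_le: "norm (v :: 'a::real_normed_vector ^ 2) \<le> norm (v $ 1) + norm (v $ 2)"
  unfolding norm_vec_def using L2_set_le_sum[of UNIV "\<lambda>i. norm (v $ i)"] by (simp add: UNIV_2)

definition evol_grad :: "real \<Rightarrow> (R2 \<Rightarrow> complex) \<Rightarrow> real \<Rightarrow> R2 \<Rightarrow> complex^2" where
  "evol_grad E f t x = (\<chi> j. evol_partial E f t j x)"

lemma evol_weak_grad:
  assumes f [measurable]: "Lp_mem p f" and "1 < p" "0 < E" "0 < t"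
  shows "weak_grad (evol E f t) (evol_grad E f t)"
  using evol_weak_partial[OF assms] by (intro weak_gradI) (simp_all add: evol_grad_def)

lemma
  assumes f [measurable]: "Lp_mem q f" and pq: "1 < q" "q \<le> p" "p < 2" and E: "0 < E" and t: "0 < t"
  shows Lp_mem_evol_grad: "Lp_mem p (evol_grad E f t)"
    and Lp_norm_evol_grad_le: "Lp_norm p (evol_grad E f t)
        \<le> 2 * evol_partial_const p q * t powr (- (1 / 2) - (1 / q - 1 / p)) * Lp_norm q f"
proof -
  have meas: "evol_grad E f t \<in> borel_measurable borel"
    by (subst borel_measurable_euclidean_space) (auto simp: Basis_vec_def inner_axis evol_grad_def)
  have "norm (evol_grad E f t x) \<le> norm (evol_partial E f t 1 x) + norm (evol_partial E f t 2 x)" for x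
    using norm_vec2_le[of "evol_grad E f t x"] by (simp add: evol_grad_def)
  note sum = Lp_triangle[OF meas Lp_mem_evol_partial[OF assms] Lp_mem_evol_partial[OF assms] _ this]
  show "Lp_mem p (evol_grad E f t)" using pq by (intro sum(1)) simp
  have "Lp_norm p (evol_grad E f t) \<le> Lp_norm p (evol_partial E f t 1) + Lp_norm p (evol_partial E f t 2)"
    using pq by (intro sum(2)) simp
  then show "Lp_norm p (evol_grad E f t)
      \<le> 2 * evol_partial_const p q * t powr (- (1 / 2) - (1 / q - 1 / p)) * Lp_norm q f"
    using Lp_norm_evol_partial_le[OF assms, of 1] Lp_norm_evol_partial_le[OF assms, of 2] by simp
qed

section \<open>The gradient estimate\<close>

lemma Pac_eq:
  "Pac alpha g x = g x - Gk (Ealpha alpha) x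
      *\<^sub>R (\<integral>y. Gk (Ealpha alpha) y *\<^sub>R g y \<partial>lborel) /\<^sub>R (Lp_norm 2 (Gk (Ealpha alpha)))\<^sup>2"
proof -
  let ?N = "Lp_norm 2 (Gk (Ealpha alpha))"
  define I where "I = (\<integral>y. Gk (Ealpha alpha) y *\<^sub>R g y \<partial>lborel)"
  have "(\<integral>y. g y * complex_of_real (psi alpha y) \<partial>lborel) = (\<integral>y. inverse ?N *\<^sub>R Gk (Ealpha alpha) y *\<^sub>R g y \<partial>lborel)"
    by (intro Bochner_Integration.integral_cong) (simp_all add: psi_def scaleR_conv_of_real divide_inverse mult_ac)
  also have "\<dots> = I /\<^sub>R ?N" unfolding I_def by (rule integral_scaleR_right)
  finally show ?thesis
    unfolding I_def[symmetric]
    by (simp add: Pac_def Pd_def psi_def scaleR_conv_of_real divide_inverse power2_eq_square mult_ac)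
qed

lemma Lp_mem_Pac:
  assumes g [measurable]: "Lp_mem p g" and p: "1 \<le> p" "p \<le> 2"
  shows "Lp_mem p (Pac alpha g)"
proof -
  define c where "c = (\<integral>y. Gk (Ealpha alpha) y *\<^sub>R g y \<partial>lborel) /\<^sub>R (Lp_norm 2 (Gk (Ealpha alpha)))\<^sup>2"
  have Pac: "Pac alpha g = (\<lambda>x. g x - Gk (Ealpha alpha) x *\<^sub>R c)" by (simp add: Pac_eq c_def fun_eq_iff)
  have Gc: "Lp_mem p (\<lambda>x. Gk (Ealpha alpha) x *\<^sub>R c)"
    by (rule Lp_dominated(1)[OF _ Lp_mem_Gk[OF Ealpha_pos p, of alpha], where c = "norm c"]) (use p in auto)
  show ?thesis
    unfolding Pac by (rule Lp_triangle(1)[OF _ g Gc p(1)]) (simp_all add: norm_triangle_ineq4 del: norm_scaleR)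
qed

lemma ac_state_Pac:
  assumes g: "Lp_mem 2 g"
  shows "ac_state alpha (Pac alpha g)"
proof -
  let ?G = "Gk (Ealpha alpha)"
  define N where "N = Lp_norm 2 ?G"
  define I where "I = (\<integral>y. ?G y *\<^sub>R g y \<partial>lborel)"
  have N: "N \<noteq> 0" using Lp_norm_Gk_pos[OF Ealpha_pos, of alpha] by (simp add: N_def)
  have "(\<integral>\<^sup>+ y. ennreal (?G y * ?G y) \<partial>lborel) = ennreal (N\<^sup>2)"
    using nn_integral_Lp_norm[OF Lp_mem_Gk[OF Ealpha_pos, of 2 alpha]] by (simp add: N_def power2_eq_square)
  then have GG: "has_bochner_integral lborel (\<lambda>y. ?G y * ?G y) (N\<^sup>2)" by (intro has_bochner_integral_nn_integral) auto
  have Gg: "integrable lborel (\<lambda>y. ?G y *\<^sub>R g y)" using integrable_Gk_scaleR[OF g _ Ealpha_pos, of alpha 0] by simp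
  have "(\<integral>y. ?G y *\<^sub>R Pac alpha g y \<partial>lborel) = (\<integral>y. ?G y *\<^sub>R g y - (?G y * ?G y) *\<^sub>R (I /\<^sub>R N\<^sup>2) \<partial>lborel)"
    by (simp add: Pac_eq I_def N_def scaleR_diff_right mult_ac)
  also have "\<dots> = I - N\<^sup>2 *\<^sub>R (I /\<^sub>R N\<^sup>2)"
    using Gg GG by (subst Bochner_Integration.integral_diff) (auto simp: I_def has_bochner_integral_iff)
  also have "\<dots> = 0" using N by simp
  finally show ?thesis using Lp_mem_Pac[OF g, of alpha] by (simp add: ac_state_def)
qed

theorem theorem2p9:
  fixes alpha p q :: real
  assumes "1 < q" and "q < p" and "p < 2"
  shows "\<exists>C. \<forall>t > 0. \<forall>g :: R2 \<Rightarrow> complex. Lp_mem 2 g \<and> Lp_mem q g \<longrightarrow>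
           (\<exists>u. heat_sg alpha t (Pac alpha g) u) \<and>
           (\<forall>u. heat_sg alpha t (Pac alpha g) u \<longrightarrow>
              (\<exists>h. weak_grad u h \<and> Lp_mem p h \<and>
                   Lp_norm p h \<le> C * t powr (- 1 / 2 - (1 / q - 1 / p)) * Lp_norm q (Pac alpha g)))"
proof (intro exI[of _ "2 * evol_partial_const p q"] allI impI, elim conjE)
  fix t :: real and g :: "R2 \<Rightarrow> complex"
  assume t: "0 < t" and g: "Lp_mem 2 g" "Lp_mem q g"
  define f where "f = Pac alpha g"
  define h where "h = evol_grad (Ealpha alpha) f t"
  have f: "ac_state alpha f" "Lp_mem 2 f" "Lp_mem q f"
    using assms unfolding f_def by (auto intro!: ac_state_Pac Lp_mem_Pac g)
  have "weak_grad u h" if u: "heat_sg alpha t f u" for u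
  proof (rule weak_grad_cong_AE)
    show "weak_grad (evol (Ealpha alpha) f t) h" unfolding h_def by (rule evol_weak_grad[OF f(2) _ _ t]) simp_all
    show "AE x in lborel. u x = evol (Ealpha alpha) f t x" by (rule heat_sg_unique[OF f(1) t u])
  qed (use f(2) u in \<open>auto simp: heat_sg_def dest: Lp_mem_measurable\<close>)
  moreover have "Lp_mem p h" "Lp_norm p h
       \<le> 2 * evol_partial_const p q * t powr (- 1 / 2 - (1 / q - 1 / p)) * Lp_norm q f"
    using assms Lp_mem_evol_grad[OF f(3) _ _ _ _ t] Lp_norm_evol_grad_le[OF f(3) _ _ _ _ t] unfolding h_def by simp_all
  ultimately show "(\<exists>u. heat_sg alpha t (Pac alpha g) u) \<and>
      (\<forall>u. heat_sg alpha t (Pac alpha g) u \<longrightarrow> (\<exists>h. weak_grad u h \<and> Lp_mem p h \<and>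
        Lp_norm p h \<le> 2 * evol_partial_const p q * t powr (- 1 / 2 - (1 / q - 1 / p)) * Lp_norm q (Pac alpha g)))"
    using heat_sg_evol[OF f(1) t] unfolding f_def by blast
qed

end
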